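(* Let $\Gamma$ be a residually finite countable discrete group such that $Wh^{\mathbb{F}_p}(\Gamma)$ is torsion, and let $f\in M_r(\mathbb{Z}\Gamma)\cap\mathrm{GL}_r(c_0(\Gamma,\mathbb{Z}_p))$. Then for every sequence $\Gamma_n\to e$ the $p$-adic entropy $h_p(f)$ of the $\Gamma$-action on $X_f$ exists and $h_p(f)=\log_p\det_\Gamma f$ in $\mathbb{Q}_p$.
   Context: $\log_p:\mathbb{Q}_p^*\to\mathbb{Q}_p$ is the $p$-adic logarithm with $\log_p(p)=0$. With $T=(\mathbb{R}/\mathbb{Z})^r$ and $f=\sum a_\gamma\gamma$, $a_\gamma\in M_r(\mathbb{Z})$, $X_f\subset T^\Gamma$ is the closed subgroup of all $(x_{\gamma'})$ (row vectors) with $\sum_{\gamma'}x_{\gamma'}a^T_{\gamma^{-1}\gamma'}=0$ in $T$ for all $\gamma$ ($a^T$ transpose), $\Gamma$ acting by $\gamma\cdot(x_{\gamma'})=(x_{\gamma^{-1}\gamma'})$; $\mathrm{Fix}_N(X_f)$: points fixed by all of $N$. $\Gamma_n\to e$: normal finite-index subgroups with only $e$ in infinitely many $\Gamma_n$. $h_p(f):=\lim_n\frac{1}{(\Gamma:\Gamma_n)}\log_p|\mathrm{Fix}_{\Gamma_n}(X_f)|$. $c_0(\Gamma)$: formal series $\sum x_\gamma\gamma$, $x_\gamma\in\mathbb{Q}_p$, $|x_\gamma|_p\to0$, convolution product, norm $\max|x_\gamma|_p$; $c_0(\Gamma,\mathbb{Z}_p)$: norm $\le1$. $K_1(R)=\mathrm{GL}_\infty(R)/E_\infty(R)$,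 $Wh^{\mathbb{F}_p}(\Gamma)=K_1(\mathbb{F}_p\Gamma)/\langle\Gamma\rangle$. Under the hypothesis, $\log_p\det_\Gamma:\mathrm{GL}_r(c_0(\Gamma,\mathbb{Z}_p))\to\mathbb{Q}_p$ is the composite of $\mathrm{GL}_r\to K_1(c_0(\Gamma,\mathbb{Z}_p))$ with the unique homomorphism $K_1(c_0(\Gamma,\mathbb{Z}_p))\to\mathbb{Q}_p$ that equals $u\mapsto\mathrm{tr}_\Gamma(\log u)$ on each $1+pM_s(c_0(\Gamma,\mathbb{Z}_p))$ (where $\mathrm{tr}_\Gamma((f_{ij}))=\sum_i$ coefficient of $e$ in $f_{ii}$, $\log u=-\sum_{\nu\ge1}(1-u)^\nu/\nu$) and vanishes on the image of $\Gamma$. Concretely, if $f^N=\mathrm{diag}(\gamma,1_{s-1})\,\varepsilon\,g$ in $\mathrm{GL}_s(c_0(\Gamma,\mathbb{Z}_p))$ with $N\ge1$, $\gamma\in\Gamma$, $\varepsilon$ a product of elementary matrices and $g\in1+pM_s(c_0(\Gamma,\mathbb{Z}_p))$, then $\log_p\det_\Gamma f=\frac1N\mathrm{tr}_\Gamma\log g$. *)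

theory Defs
  imports Complex_Main "HOL-Computational_Algebra.Primes" "HOL-Library.Countable"
begin

definition vp :: "nat \<Rightarrow> rat \<Rightarrow> int" where
  "vp p q = int (multiplicity (int p) (fst (quotient_of q))) - int (multiplicity (int p) (snd (quotient_of q)))"

definition rnorm :: "nat \<Rightarrow> rat \<Rightarrow> real" where
  "rnorm p q = (if q = 0 then 0 else real p powr (- real_of_int (vp p q)))"

definition pcauchy :: "nat \<Rightarrow> (nat \<Rightarrow> rat) \<Rightarrow> bool" where
  "pcauchy p X \<longleftrightarrow> (\<forall>e>0. \<exists>N. \<forall>m\<ge>N. \<forall>n\<ge>N. rnorm p (X m - X n) < e)"

definition pequiv :: "nat \<Rightarrow> (nat \<Rightarrow> rat) \<Rightarrow> (nat \<Rightarrow> rat) \<Rightarrow> bool" where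
  "pequiv p X Y \<longleftrightarrow> (\<lambda>n. rnorm p (X n - Y n)) \<longlonglongrightarrow> 0"

type_synonym qp = "(nat \<Rightarrow> rat) set"

definition qp_of :: "nat \<Rightarrow> (nat \<Rightarrow> rat) \<Rightarrow> qp" where
  "qp_of p X = {Y. pcauchy p Y \<and> pequiv p X Y}"

definition Qp :: "nat \<Rightarrow> qp set" where
  "Qp p = {qp_of p X | X. pcauchy p X}"

definition qp_rep :: "qp \<Rightarrow> nat \<Rightarrow> rat" where
  "qp_rep A = (SOME X. X \<in> A)"

definition qp_const :: "nat \<Rightarrow> rat \<Rightarrow> qp" where
  "qp_const p q = qp_of p (\<lambda>_. q)"

definition qp_zero :: "nat \<Rightarrow> qp" where "qp_zero p = qp_const p 0"
definition qp_one :: "nat \<Rightarrow> qp" where "qp_one p = qp_const p 1"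

definition qp_add :: "nat \<Rightarrow> qp \<Rightarrow> qp \<Rightarrow> qp" where
  "qp_add p A B = qp_of p (\<lambda>n. qp_rep A n + qp_rep B n)"

definition qp_neg :: "nat \<Rightarrow> qp \<Rightarrow> qp" where
  "qp_neg p A = qp_of p (\<lambda>n. - qp_rep A n)"

definition qp_mul :: "nat \<Rightarrow> qp \<Rightarrow> qp \<Rightarrow> qp" where
  "qp_mul p A B = qp_of p (\<lambda>n. qp_rep A n * qp_rep B n)"

definition qp_pow :: "nat \<Rightarrow> qp \<Rightarrow> nat \<Rightarrow> qp" where
  "qp_pow p A k = ((qp_mul p A) ^^ k) (qp_one p)"

definition qp_norm :: "nat \<Rightarrow> qp \<Rightarrow> real" where
  "qp_norm p A = lim (\<lambda>n. rnorm p (qp_rep A n))"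

definition qp_val :: "nat \<Rightarrow> qp \<Rightarrow> int" where
  "qp_val p A = (THE k::int. qp_norm p A = real p powr (- real_of_int k))"

definition qp_tendsto :: "nat \<Rightarrow> (nat \<Rightarrow> qp) \<Rightarrow> qp \<Rightarrow> bool" where
  "qp_tendsto p X L \<longleftrightarrow> L \<in> Qp p \<and> (\<forall>n. X n \<in> Qp p) \<and>
     (\<lambda>n. qp_norm p (qp_add p (X n) (qp_neg p L))) \<longlonglongrightarrow> 0"

definition qp_fsum :: "nat \<Rightarrow> ('a \<Rightarrow> qp) \<Rightarrow> 'a set \<Rightarrow> qp" where
  "qp_fsum p f F = qp_of p (\<lambda>n. \<Sum>x\<in>F. qp_rep (f x) n)"

definition qp_has_sum :: "nat \<Rightarrow> ('a \<Rightarrow> qp) \<Rightarrow> 'a set \<Rightarrow> qp \<Rightarrow> bool" where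
  "qp_has_sum p f A L \<longleftrightarrow> L \<in> Qp p \<and> (\<forall>x\<in>A. f x \<in> Qp p) \<and>
     (\<forall>e>0. \<exists>F0. finite F0 \<and> F0 \<subseteq> A \<and>
        (\<forall>F. finite F \<and> F0 \<subseteq> F \<and> F \<subseteq> A \<longrightarrow> qp_norm p (qp_add p (qp_fsum p f F) (qp_neg p L)) < e))"

definition qp_sumv :: "nat \<Rightarrow> ('a \<Rightarrow> qp) \<Rightarrow> 'a set \<Rightarrow> qp" where
  "qp_sumv p f A = (THE L. qp_has_sum p f A L)"

text \<open>The (Iwasawa) p-adic logarithm on Q_p^* with log_p(p) = 0:
  write x = p^k w with |w|_p = 1; then w^(p-1) lies in 1 + pZ_p and
  log_p x = (1/(p-1)) log(w^(p-1)), log(1-y) = - sum_{nu>=1} y^nu/nu.\<close>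
definition qp_log :: "nat \<Rightarrow> qp \<Rightarrow> qp" where
  "qp_log p x = (let w = qp_mul p x (qp_const p ((of_nat p :: rat) powi (- qp_val p x)));
                     y = qp_add p (qp_one p) (qp_neg p (qp_pow p w (p - 1)))
                 in qp_mul p (qp_const p (1 / of_nat (p - 1)))
                      (qp_neg p (qp_sumv p (\<lambda>\<nu>::nat. qp_mul p (qp_const p (1 / of_nat (Suc \<nu>))) (qp_pow p y (Suc \<nu>))) UNIV)))"

record 'a rops =
  rcar :: "'a set"
  rzero :: 'a
  rone :: 'a
  radd :: "'a \<Rightarrow> 'a \<Rightarrow> 'a"
  rmul :: "'a \<Rightarrow> 'a \<Rightarrow> 'a"

type_synonym 'a mat = "nat \<Rightarrow> nat \<Rightarrow> 'a"

definition idm :: "('a, 'b) rops_scheme \<Rightarrow> 'a mat" where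
  "idm R = (\<lambda>i j. if i = j then rone R else rzero R)"

text \<open>A matrix that agrees with the identity outside the upper left s x s block
  (this is how M_s(R) and GL_s(R) sit inside GL_infinity(R)).\<close>
definition fin_id :: "('a, 'b) rops_scheme \<Rightarrow> nat \<Rightarrow> 'a mat \<Rightarrow> bool" where
  "fin_id R s A \<longleftrightarrow> (\<forall>i j. s \<le> i \<or> s \<le> j \<longrightarrow> A i j = idm R i j)"

definition rsum :: "('a, 'b) rops_scheme \<Rightarrow> (nat \<Rightarrow> 'a) \<Rightarrow> nat \<Rightarrow> 'a" where
  "rsum R g s = foldr (\<lambda>k acc. radd R (g k) acc) [0..<s] (rzero R)"

text \<open>Product in GL_infinity (of matrices that are the identity outside a finite block).\<close>
definition mmul :: "('a, 'b) rops_scheme \<Rightarrow> 'a mat \<Rightarrow> 'a mat \<Rightarrow> 'a mat" where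
  "mmul R A B = (let s = (LEAST s. fin_id R s A \<and> fin_id R s B) in
     (\<lambda>i j. if i < s \<and> j < s then rsum R (\<lambda>k. rmul R (A i k) (B k j)) s else idm R i j))"

definition mpow :: "('a, 'b) rops_scheme \<Rightarrow> 'a mat \<Rightarrow> nat \<Rightarrow> 'a mat" where
  "mpow R A n = ((mmul R A) ^^ n) (idm R)"

definition GLn :: "('a, 'b) rops_scheme \<Rightarrow> nat \<Rightarrow> 'a mat set" where
  "GLn R n = {A. fin_id R n A \<and> (\<forall>i j. A i j \<in> rcar R) \<and>
      (\<exists>B. fin_id R n B \<and> (\<forall>i j. B i j \<in> rcar R) \<and> mmul R A B = idm R \<and> mmul R B A = idm R)}"

definition GL_inf :: "('a, 'b) rops_scheme \<Rightarrow> 'a mat set" where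
  "GL_inf R = (\<Union>n. GLn R n)"

definition elem :: "('a, 'b) rops_scheme \<Rightarrow> nat \<Rightarrow> nat \<Rightarrow> 'a \<Rightarrow> 'a mat" where
  "elem R i j a = (\<lambda>k l. if k = i \<and> l = j then a else idm R k l)"

definition gmat :: "('a, 'b) rops_scheme \<Rightarrow> 'a \<Rightarrow> 'a mat" where
  "gmat R g = (\<lambda>k l. if k = 0 \<and> l = 0 then g else idm R k l)"

text \<open>The subgroup of GL_infinity(R) generated by E_infinity(R) and the matrices diag(g,1,...)
  for g in G (its image in K_1(R) is the subgroup generated by the image of G).\<close>
inductive_set EG_gen :: "('a, 'b) rops_scheme \<Rightarrow> 'a set \<Rightarrow> 'a mat set"
  for R :: "('a, 'b) rops_scheme" and G :: "'a set" where
  id: "idm R \<in> EG_gen R G"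
| el: "X \<in> EG_gen R G \<Longrightarrow> i \<noteq> j \<Longrightarrow> a \<in> rcar R \<Longrightarrow> mmul R (elem R i j a) X \<in> EG_gen R G"
| gr: "X \<in> EG_gen R G \<Longrightarrow> g \<in> G \<Longrightarrow> mmul R (gmat R g) X \<in> EG_gen R G"

definition normal_fi :: "'g::group_add set \<Rightarrow> bool" where
  "normal_fi N \<longleftrightarrow> 0 \<in> N \<and> (\<forall>a\<in>N. \<forall>b\<in>N. a + b \<in> N) \<and> (\<forall>a\<in>N. - a \<in> N) \<and>
     (\<forall>g. \<forall>a\<in>N. g + a - g \<in> N) \<and> finite ((\<lambda>x. (\<lambda>n. x + n) ` N) ` UNIV)"

definition grp_index :: "'g::group_add set \<Rightarrow> nat" where
  "grp_index N = card ((\<lambda>x. (\<lambda>n. x + n) ` N) ` (UNIV :: 'g set))"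

definition residually_finite :: "'g::group_add itself \<Rightarrow> bool" where
  "residually_finite _ \<longleftrightarrow> (\<forall>g::'g. g \<noteq> 0 \<longrightarrow> (\<exists>N. normal_fi N \<and> g \<notin> N))"

definition tends_to_e :: "(nat \<Rightarrow> 'g::group_add set) \<Rightarrow> bool" where
  "tends_to_e Gs \<longleftrightarrow> (\<forall>n. normal_fi (Gs n)) \<and> (\<forall>g. g \<noteq> 0 \<longrightarrow> finite {n. g \<in> Gs n})"

definition fpG :: "nat \<Rightarrow> ('g::group_add \<Rightarrow> int) rops" where
  "fpG p = \<lparr> rcar = {a. finite {g. a g \<noteq> 0} \<and> (\<forall>g. 0 \<le> a g \<and> a g < int p)},
            rzero = (\<lambda>_. 0),
            rone = (\<lambda>g. if g = 0 then 1 else 0),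
            radd = (\<lambda>a b g. (a g + b g) mod int p),
            rmul = (\<lambda>a b g. (\<Sum>d\<in>{d. a d \<noteq> 0}. a d * b (- d + g)) mod int p) \<rparr>"

definition fp_grp :: "nat \<Rightarrow> 'g::group_add \<Rightarrow> ('g \<Rightarrow> int)" where
  "fp_grp p h = (\<lambda>g. if g = h then 1 else 0)"

text \<open>Wh^{F_p}(Gamma) = K_1(F_p Gamma)/<Gamma> is a torsion group.\<close>
definition Wh_torsion :: "nat \<Rightarrow> 'g::group_add itself \<Rightarrow> bool" where
  "Wh_torsion p _ \<longleftrightarrow> (\<forall>A \<in> GL_inf (fpG p :: ('g \<Rightarrow> int) rops).
      \<exists>n>0. mpow (fpG p) A n \<in> EG_gen (fpG p) (range (fp_grp p :: 'g \<Rightarrow> 'g \<Rightarrow> int)))"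

type_synonym 'g c0 = "'g \<Rightarrow> qp"

definition c0_set :: "nat \<Rightarrow> 'g c0 set" where
  "c0_set p = {a. (\<forall>g. a g \<in> Qp p) \<and> (\<forall>e>0. finite {g. e \<le> qp_norm p (a g)})}"

definition c0Zp :: "nat \<Rightarrow> 'g c0 set" where
  "c0Zp p = {a \<in> c0_set p. \<forall>g. qp_norm p (a g) \<le> 1}"

definition c0_norm :: "nat \<Rightarrow> 'g c0 \<Rightarrow> real" where
  "c0_norm p a = (SUP g. qp_norm p (a g))"

definition c0_zero :: "nat \<Rightarrow> 'g c0" where "c0_zero p = (\<lambda>_. qp_zero p)"
definition c0_one :: "nat \<Rightarrow> 'g::group_add c0" where
  "c0_one p = (\<lambda>g. if g = 0 then qp_one p else qp_zero p)"
definition c0_grp :: "nat \<Rightarrow> 'g \<Rightarrow> 'g c0" where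
  "c0_grp p h = (\<lambda>g. if g = h then qp_one p else qp_zero p)"
definition c0_add :: "nat \<Rightarrow> 'g c0 \<Rightarrow> 'g c0 \<Rightarrow> 'g c0" where
  "c0_add p a b = (\<lambda>g. qp_add p (a g) (b g))"
definition c0_neg :: "nat \<Rightarrow> 'g c0 \<Rightarrow> 'g c0" where
  "c0_neg p a = (\<lambda>g. qp_neg p (a g))"
definition c0_smul :: "nat \<Rightarrow> qp \<Rightarrow> 'g c0 \<Rightarrow> 'g c0" where
  "c0_smul p c a = (\<lambda>g. qp_mul p c (a g))"
definition c0_mul :: "nat \<Rightarrow> 'g::group_add c0 \<Rightarrow> 'g c0 \<Rightarrow> 'g c0" where
  "c0_mul p a b = (\<lambda>g. qp_sumv p (\<lambda>d. qp_mul p (a d) (b (- d + g))) UNIV)"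

definition c0_ring :: "nat \<Rightarrow> ('g::group_add c0) rops" where
  "c0_ring p = \<lparr> rcar = c0Zp p, rzero = c0_zero p, rone = c0_one p,
                 radd = c0_add p, rmul = c0_mul p \<rparr>"

definition one_plus_pM :: "nat \<Rightarrow> nat \<Rightarrow> ('g::group_add c0) mat set" where
  "one_plus_pM p s = {u. fin_id (c0_ring p) s u \<and> (\<forall>i j. u i j \<in> c0Zp p) \<and>
      (\<forall>i j g. qp_norm p (c0_add p (u i j) (c0_neg p (idm (c0_ring p) i j)) g) \<le> 1 / real p)}"

definition bmul :: "('a, 'b) rops_scheme \<Rightarrow> nat \<Rightarrow> 'a mat \<Rightarrow> 'a mat \<Rightarrow> 'a mat" where
  "bmul R s A B = (\<lambda>i j. if i < s \<and> j < s then rsum R (\<lambda>k. rmul R (A i k) (B k j)) s else rzero R)"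

definition bid :: "('a, 'b) rops_scheme \<Rightarrow> nat \<Rightarrow> 'a mat" where
  "bid R s = (\<lambda>i j. if i < s \<and> j < s then idm R i j else rzero R)"

definition bpow :: "('a, 'b) rops_scheme \<Rightarrow> nat \<Rightarrow> 'a mat \<Rightarrow> nat \<Rightarrow> 'a mat" where
  "bpow R s A n = ((bmul R s A) ^^ n) (bid R s)"

definition one_minus :: "nat \<Rightarrow> nat \<Rightarrow> ('g::group_add c0) mat \<Rightarrow> 'g c0 mat" where
  "one_minus p s u = (\<lambda>i j. if i < s \<and> j < s then c0_add p (idm (c0_ring p) i j) (c0_neg p (u i j)) else c0_zero p)"

definition log_part :: "nat \<Rightarrow> nat \<Rightarrow> ('g::group_add c0) mat \<Rightarrow> nat \<Rightarrow> 'g c0 mat" where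
  "log_part p s u n = (\<lambda>i j. c0_neg p (foldr (\<lambda>\<nu> acc. c0_add p
       (c0_smul p (qp_const p (1 / of_nat \<nu>)) (bpow (c0_ring p) s (one_minus p s u) \<nu> i j)) acc)
       [1..<Suc n] (c0_zero p)))"

definition mlog :: "nat \<Rightarrow> nat \<Rightarrow> ('g::group_add c0) mat \<Rightarrow> 'g c0 mat" where
  "mlog p s u = (THE L. (\<forall>i j. \<not> (i < s \<and> j < s) \<longrightarrow> L i j = c0_zero p) \<and> (\<forall>i j. L i j \<in> c0_set p) \<and>
      (\<lambda>n. \<Sum>i<s. \<Sum>j<s. c0_norm p (c0_add p (log_part p s u n i j) (c0_neg p (L i j)))) \<longlonglongrightarrow> 0)"

definition trlog :: "nat \<Rightarrow> nat \<Rightarrow> ('g::group_add c0) mat \<Rightarrow> qp" where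
  "trlog p s u = qp_fsum p (\<lambda>i. mlog p s u i i 0) {..<s}"

text \<open>Homomorphisms GL_infinity(c_0(Gamma,Z_p)) \<rightarrow> Q_p vanishing on E_infinity (i.e. homomorphisms on K_1),
  equal to tr_Gamma log on each 1 + pM_s, vanishing on the image of Gamma; extended by 0 outside GL_infinity.\<close>
definition logdet_hom :: "nat \<Rightarrow> (('g::group_add c0) mat \<Rightarrow> qp) \<Rightarrow> bool" where
  "logdet_hom p \<phi> \<longleftrightarrow>
     (\<forall>A. A \<notin> GL_inf (c0_ring p) \<longrightarrow> \<phi> A = qp_zero p) \<and>
     (\<forall>A \<in> GL_inf (c0_ring p). \<phi> A \<in> Qp p) \<and>
     (\<forall>A \<in> GL_inf (c0_ring p). \<forall>B \<in> GL_inf (c0_ring p).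
         \<phi> (mmul (c0_ring p) A B) = qp_add p (\<phi> A) (\<phi> B)) \<and>
     (\<forall>i j a. i \<noteq> j \<longrightarrow> a \<in> c0Zp p \<longrightarrow> \<phi> (elem (c0_ring p) i j a) = qp_zero p) \<and>
     (\<forall>g. \<phi> (gmat (c0_ring p) (c0_grp p g)) = qp_zero p) \<and>
     (\<forall>s u. u \<in> one_plus_pM p s \<longrightarrow> \<phi> u = trlog p s u)"

text \<open>An r x r matrix over Z Gamma: f i j g = coefficient of g in f_ij, i.e. (a_g)_ij.\<close>
definition ZG_mat :: "nat \<Rightarrow> (nat \<Rightarrow> nat \<Rightarrow> 'g \<Rightarrow> int) \<Rightarrow> bool" where
  "ZG_mat r f \<longleftrightarrow> (\<forall>i j. finite {g. f i j g \<noteq> 0}) \<and> (\<forall>i j. r \<le> i \<or> r \<le> j \<longrightarrow> f i j = (\<lambda>_. 0))"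

definition emb_c0 :: "nat \<Rightarrow> nat \<Rightarrow> (nat \<Rightarrow> nat \<Rightarrow> 'g::group_add \<Rightarrow> int) \<Rightarrow> 'g c0 mat" where
  "emb_c0 p r f = (\<lambda>i j. if i < r \<and> j < r then (\<lambda>g. qp_const p (of_int (f i j g))) else idm (c0_ring p) i j)"

definition logdet :: "nat \<Rightarrow> nat \<Rightarrow> (nat \<Rightarrow> nat \<Rightarrow> 'g::group_add \<Rightarrow> int) \<Rightarrow> qp" where
  "logdet p r f = (THE \<phi>. logdet_hom p \<phi>) (emb_c0 p r f)"

definition fsupp :: "nat \<Rightarrow> (nat \<Rightarrow> nat \<Rightarrow> 'g \<Rightarrow> int) \<Rightarrow> 'g set" where
  "fsupp r f = {d. \<exists>i<r. \<exists>j<r. f i j d \<noteq> 0}"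

text \<open>Points of T^Gamma, T = (R/Z)^r, via their unique representatives in [0,1)^r;
  x g i is the i-th coordinate of x_g. Condition: for all g and j<r,
  sum_{g'} sum_i (x_{g'})_i (a_{g^-1 g'})_{ji} = 0 in R/Z, written with g' = g d.\<close>
definition Xf :: "nat \<Rightarrow> (nat \<Rightarrow> nat \<Rightarrow> 'g::group_add \<Rightarrow> int) \<Rightarrow> ('g \<Rightarrow> nat \<Rightarrow> real) set" where
  "Xf r f = {x. (\<forall>g i. i < r \<longrightarrow> 0 \<le> x g i \<and> x g i < 1) \<and> (\<forall>g i. r \<le> i \<longrightarrow> x g i = 0) \<and>
      (\<forall>g. \<forall>j<r. (\<Sum>d\<in>fsupp r f. \<Sum>i<r. x (g + d) i * of_int (f j i d)) \<in> \<int>)}"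

definition FixN :: "nat \<Rightarrow> (nat \<Rightarrow> nat \<Rightarrow> 'g::group_add \<Rightarrow> int) \<Rightarrow> 'g set \<Rightarrow> ('g \<Rightarrow> nat \<Rightarrow> real) set" where
  "FixN r f N = {x \<in> Xf r f. \<forall>g\<in>N. \<forall>g'. x (- g + g') = x g'}"

end

theory Submission
  imports Defs "HOL-Number_Theory.Residues" "HOL-Library.Poly_Mapping" "Jordan_Normal_Form.Determinant"
begin

text \<open>For a normal subgroup N of finite index let rho_N(A) be the matrix by which A acts on the s-th power of
  the group ring of Gamma/N. The map A \<mapsto> log_p det rho_N(A) is additive, vanishes on elementary matrices and
  on Gamma (invertible integral matrices have determinant 1 or -1) and equals tr log rho_N(u) on 1 + pM_s.
  Since tr rho_N(x) is (Gamma : N) times the sum of the traces of the coefficients of x at the elements of N,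
  log_p det rho_N(u) / (Gamma : N) tends to tr_Gamma log u as N shrinks to e. As Wh(Gamma) is torsion,
  a power of every A is a product of such matrices. Hence the limit exists for every A, and it is the only
  homomorphism with the properties required of log_p det_Gamma. Finally, the points of X_f fixed by N are the
  torsion points y with rho_N(f) y integral, and there are |det rho_N(f)| of them.

  All p-adic statements are expressed by rational approximations: capx A q e says that q approximates the
  p-adic number A up to e, and zapx m a \<alpha> that the finitely supported integral \<alpha> approximates a
  modulo p^m, so the algebra takes place in integral group rings.\<close>

text \<open>The obstacle is the division by (Gamma : N). The index may be divisible by high powers
  of p, so a congruence between determinants can lose all its digits when their logarithms are
  divided by it. Two devices cope with this. In \<open>Rel\<close> the working precision p^(-M) is
  chosen after the quotient, so that errors of that size survive any fixed index. On 1 + pM_s the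
  comparison with tr_Gamma log uses a truncation fixed before the quotient; there the index is an
  exact factor of the trace and cancels before that comparison. Logarithms of determinants enter
  through integers only: for d prime to p, log d is the limit of (d^n - 1)/n along n = (p - 1)p^k,
  and this expression respects congruences of d uniformly in k. The torsion hypothesis acts through
  reduction modulo p: elementary matrices and group elements lift from F_p Gamma, and a matrix that
  reduces to the identity lies in 1 + pM_s. As the homomorphism is unique, the limit is the same for
  all sequences of subgroups.\<close>

locale padic =
  fixes p :: nat
  assumes prime_p: "prime p"
begin

lemma p_gt_1: "1 < real p" and p_pos: "0 < real p" and p_ge_2: "2 \<le> p"
  using prime_ge_2_nat[OF prime_p] by auto

lemma prime_int_p: "prime (int p)"
  using prime_p by simp

lemma prime_elem_int_p: "prime_elem (int p)"
  using prime_int_p by blast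

section \<open>Powers of 1/p as the scale of all error bounds\<close>

definition pe :: "nat \<Rightarrow> real" where
  "pe m = 1 / real p ^ m"

lemma pe_pos [simp]: "0 < pe m"
  unfolding pe_def using p_pos by simp

lemma pe_nonneg [simp]: "0 \<le> pe m"
  using pe_pos by (rule less_imp_le)

lemma pe_antimono: "m \<le> n \<Longrightarrow> pe n \<le> pe m"
  unfolding pe_def using p_gt_1 by (intro divide_left_mono power_increasing) auto

lemma pe_0 [simp]: "pe 0 = 1"
  by (simp add: pe_def)

lemma pe_le_1 [simp]: "pe m \<le> 1"
  using pe_antimono[of 0 m] by simp

lemma pe_add: "pe (m + n) = pe m * pe n"
  by (simp add: pe_def power_add)

lemma pe_tendsto_0: "pe \<longlonglongrightarrow> 0"
proof -
  have "(\<lambda>m. (1 / real p) ^ m) \<longlonglongrightarrow> 0"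
    using p_gt_1 by (intro LIMSEQ_power_zero) auto
  then show ?thesis
    by (simp add: pe_def[abs_def] power_divide)
qed

lemma ex_pe_less: "0 < e \<Longrightarrow> \<exists>m. pe m < e"
  using order_tendstoD(2)[OF pe_tendsto_0, of e] by (auto simp: eventually_sequentially)

text \<open>In the logarithm series the denominator \<nu> costs a factor of at most \<nu> in
  absolute value while the numerator is at most p^(-\<nu>); this limit therefore controls the tails
  of the series.\<close>

lemma ex_pe_times_less:
  assumes "0 < e"
  shows "\<exists>K0. \<forall>n\<ge>K0. real n * pe n < e"
proof -
  have "(\<lambda>n. real n * pe n) \<longlonglongrightarrow> 0"
    using powser_times_n_limit_0[of "1 / real p"] p_gt_1
    by (simp add: pe_def power_divide)
  from order_tendstoD(2)[OF this assms] show ?thesis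
    by (auto simp: eventually_sequentially)
qed

subsection \<open>The p-adic absolute value on the rationals\<close>

text \<open>Cross multiplication frees the valuation from the reduced fraction returned by
  \<open>quotient_of\<close>.\<close>

lemma vp_frac:
  assumes "a \<noteq> 0" "b \<noteq> 0"
  shows "vp p (of_int a / of_int b)
    = int (multiplicity (int p) a) - int (multiplicity (int p) b)"
proof -
  obtain c d where cd: "quotient_of (of_int a / of_int b) = (c, d)" by fastforce
  have eq: "(of_int a / of_int b :: rat) = of_int c / of_int d"
    using cd by (rule quotient_of_div)
  have d: "d > 0" using cd by (rule quotient_of_denom_pos)
  have "of_int (a * d) = (of_int (c * b) :: rat)"
    using eq assms d by (simp add: field_simps)
  then have ad: "a * d = c * b" by (simp only: of_int_eq_iff)
  have c: "c \<noteq> 0" using ad assms d by auto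
  have "multiplicity (int p) (a * d) = multiplicity (int p) a + multiplicity (int p) d"
    using assms d by (intro prime_elem_multiplicity_mult_distrib[OF prime_elem_int_p]) auto
  moreover have "multiplicity (int p) (c * b) = multiplicity (int p) c + multiplicity (int p) b"
    using assms c by (intro prime_elem_multiplicity_mult_distrib[OF prime_elem_int_p]) auto
  ultimately show ?thesis
    using ad by (simp add: vp_def cd)
qed

lemma rat_frac:
  fixes x :: rat
  obtains a b :: int where "x = of_int a / of_int b" "b > 0" "coprime a b"
  using quotient_of_div[of x] quotient_of_denom_pos[of x] quotient_of_coprime[of x]
  by (metis surj_pair)

lemma rnorm_0 [simp]: "rnorm p 0 = 0"
  by (simp add: rnorm_def)

lemma rnorm_frac:
  assumes "a \<noteq> 0" "b \<noteq> 0"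
  shows "rnorm p (of_int a / of_int b)
    = real p powr (real (multiplicity (int p) b) - real (multiplicity (int p) a))"
  using assms by (simp add: rnorm_def vp_frac)

lemma rnorm_nonneg [simp]: "0 \<le> rnorm p x"
  by (simp add: rnorm_def)

lemma rnorm_eq_0_iff [simp]: "rnorm p x = 0 \<longleftrightarrow> x = 0"
  using p_pos by (simp add: rnorm_def)

lemma rnorm_mult: "rnorm p (x * y) = rnorm p x * rnorm p y"
proof (cases "x = 0 \<or> y = 0")
  case False
  obtain a b where x: "x = of_int a / of_int b" "b > 0" by (rule rat_frac)
  obtain c d where y: "y = of_int c / of_int d" "d > 0" by (rule rat_frac)
  have nz: "a \<noteq> 0" "c \<noteq> 0" using False x y by auto
  have xy: "x * y = of_int (a * c) / of_int (b * d)" using x y by simp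
  have "rnorm p (x * y) = real p powr (real (multiplicity (int p) (b * d)) - real (multiplicity (int p) (a * c)))"
    unfolding xy using nz x y by (intro rnorm_frac) auto
  also have "\<dots> = rnorm p x * rnorm p y"
    using nz x(2) y(2)
    by (simp add: x(1) y(1) rnorm_frac prime_elem_multiplicity_mult_distrib[OF prime_elem_int_p]
        powr_add[symmetric] algebra_simps)
  finally show ?thesis .
qed auto

lemma rnorm_1 [simp]: "rnorm p 1 = 1"
  using rnorm_mult[of 1 1] rnorm_eq_0_iff[of 1] by simp

lemma rnorm_minus [simp]: "rnorm p (- x) = rnorm p x"
proof -
  have "(rnorm p (-1))\<^sup>2 = 1\<^sup>2"
    using rnorm_mult[of "-1" "-1"] by (simp add: power2_eq_square)
  then have "rnorm p (-1) = 1"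
    by (subst (asm) power2_eq_iff_nonneg) auto
  then show ?thesis using rnorm_mult[of "-1" x] by simp
qed

lemma rnorm_minus_commute: "rnorm p (x - y) = rnorm p (y - x)"
  by (metis minus_diff_eq rnorm_minus)

lemma rnorm_power: "rnorm p (x ^ n) = rnorm p x ^ n"
  by (induction n) (auto simp: rnorm_mult)

lemma rnorm_inverse: "rnorm p (inverse x) = inverse (rnorm p x)"
proof (cases "x = 0")
  case False
  then have "rnorm p x * rnorm p (inverse x) = 1"
    by (simp flip: rnorm_mult)
  then show ?thesis by (metis inverse_unique)
qed auto

lemma rnorm_divide: "rnorm p (x / y) = rnorm p x / rnorm p y"
  by (simp add: divide_inverse rnorm_mult rnorm_inverse)

lemma rnorm_of_int: "z \<noteq> 0 \<Longrightarrow> rnorm p (of_int z) = pe (multiplicity (int p) z)"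
  using rnorm_frac[of z 1] p_pos
  by (simp add: pe_def powr_minus powr_realpow divide_inverse)

lemma rnorm_of_int_le_iff: "rnorm p (of_int z) \<le> pe m \<longleftrightarrow> int p ^ m dvd z"
proof (cases "z = 0")
  case False
  have "pe (multiplicity (int p) z) \<le> pe m \<longleftrightarrow> m \<le> multiplicity (int p) z"
    using p_gt_1 by (simp add: pe_def field_simps)
  also have "\<dots> \<longleftrightarrow> int p ^ m dvd z"
    using False prime_int_p by (subst power_dvd_iff_le_multiplicity) auto
  finally show ?thesis using False by (simp add: rnorm_of_int)
qed auto

lemma rnorm_of_int_le_1 [simp]: "rnorm p (of_int z) \<le> 1"
  using rnorm_of_int_le_iff[of z 0] by simp

lemma rnorm_of_nat_le_1 [simp]: "rnorm p (of_nat z) \<le> 1"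
  using rnorm_of_int_le_1[of "int z"] by simp

lemma rnorm_p: "rnorm p (of_nat p) = pe 1"
  using rnorm_of_int[of "int p"] prime_int_p p_ge_2 by simp

lemma rnorm_coprime:
  assumes "coprime z (int p)" shows "rnorm p (of_int z) = 1"
proof -
  have "\<not> int p dvd z"
    using assms prime_int_p by (metis coprime_common_divisor dvd_refl not_prime_unit)
  then show ?thesis
    using rnorm_of_int[of z] by (cases "z = 0") (auto simp: not_dvd_imp_multiplicity_0)
qed

text \<open>Two integers are both divisible by the smaller of their two powers of p, hence so is
  their sum. Fractions are brought to the common denominator \<open>b * d\<close>, whose absolute
  value factors out.\<close>

lemma rnorm_add_le_max: "rnorm p (x + y) \<le> max (rnorm p x) (rnorm p y)"
proof -
  have int: "rnorm p (of_int a + of_int b) \<le> max (rnorm p (of_int a)) (rnorm p (of_int b))" for a b :: int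
  proof (cases "a = 0 \<or> b = 0")
    case False
    then have a: "rnorm p (of_int a) = pe (multiplicity (int p) a)"
      and b: "rnorm p (of_int b) = pe (multiplicity (int p) b)"
      by (auto intro: rnorm_of_int)
    define m where "m = min (multiplicity (int p) a) (multiplicity (int p) b)"
    have "int p ^ m dvd a" "int p ^ m dvd b"
      by (auto simp: m_def min_def intro: multiplicity_dvd multiplicity_dvd')
    then have "rnorm p (of_int (a + b)) \<le> pe m"
      by (subst rnorm_of_int_le_iff) auto
    also have "pe m \<le> max (rnorm p (of_int a)) (rnorm p (of_int b))"
      by (auto simp: a b m_def min_def)
    finally show ?thesis by simp
  qed auto
  obtain a b where x: "x = of_int a / of_int b" "b > 0" by (rule rat_frac)
  obtain c d where y: "y = of_int c / of_int d" "d > 0" by (rule rat_frac)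
  have "x + y = of_int (a * d + c * b) / of_int (b * d)"
    using x y by (simp add: field_simps)
  then have "rnorm p (x + y) = rnorm p (of_int (a * d) + of_int (c * b)) / rnorm p (of_int (b * d))"
    by (simp add: rnorm_divide)
  also have "\<dots> \<le> max (rnorm p (of_int (a * d))) (rnorm p (of_int (c * b))) / rnorm p (of_int (b * d))"
    by (intro divide_right_mono int) auto
  also have "\<dots> = max (rnorm p (of_int (a * d) / of_int (b * d))) (rnorm p (of_int (c * b) / of_int (b * d)))"
    by (simp only: rnorm_divide max_divide_distrib_right rnorm_nonneg if_True)
  also have "of_int (a * d) / of_int (b * d) = x" using x y by simp
  also have "of_int (c * b) / of_int (b * d) = y" using x y by simp
  finally show ?thesis .
qed

lemma rnorm_add_le: "rnorm p x \<le> e \<Longrightarrow> rnorm p y \<le> e \<Longrightarrow> rnorm p (x + y) \<le> e"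
  using rnorm_add_le_max[of x y] by simp

lemma rnorm_diff_le: "rnorm p x \<le> e \<Longrightarrow> rnorm p y \<le> e \<Longrightarrow> rnorm p (x - y) \<le> e"
  using rnorm_add_le[of x e "- y"] by simp

lemma rnorm_triangle: "rnorm p (x - y) \<le> e \<Longrightarrow> rnorm p (y - z) \<le> e \<Longrightarrow> rnorm p (x - z) \<le> e"
  using rnorm_add_le[of "x - y" e "y - z"] by simp

lemma rnorm_sum_le:
  assumes "0 \<le> e" "\<And>x. x \<in> S \<Longrightarrow> rnorm p (f x) \<le> e"
  shows "rnorm p (sum f S) \<le> e"
  using assms by (induction S rule: infinite_finite_induct) (auto intro: rnorm_add_le)

text \<open>The isosceles principle of ultrametric spaces. It makes the absolute values along a
  non-null Cauchy sequence eventually constant.\<close>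

lemma rnorm_eq_of_close: "rnorm p (x - y) < rnorm p x \<Longrightarrow> rnorm p y = rnorm p x"
proof -
  assume a: "rnorm p (x - y) < rnorm p x"
  have "rnorm p y \<le> max (rnorm p x) (rnorm p (x - y))"
    using rnorm_add_le_max[of x "- (x - y)"] by (simp only: rnorm_minus) simp
  moreover have "rnorm p x \<le> max (rnorm p y) (rnorm p (x - y))"
    using rnorm_add_le_max[of y "x - y"] by simp
  ultimately show ?thesis using a by auto
qed

text \<open>The power of p that divides n is at most n. This crude bound replaces a logarithmic
  estimate of the valuations of the denominators in the logarithm series.\<close>

lemma rnorm_inverse_of_nat_le: "0 < n \<Longrightarrow> rnorm p (1 / of_nat n) \<le> real n"
proof -
  assume n: "0 < n"
  have "int p ^ multiplicity (int p) (int n) dvd int n" by (rule multiplicity_dvd)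
  then have "int p ^ multiplicity (int p) (int n) \<le> int n" using n by (intro zdvd_imp_le) auto
  then have le: "real p ^ multiplicity (int p) (int n) \<le> real n"
    by (metis of_int_le_iff of_int_of_nat_eq of_int_power)
  have "rnorm p (of_nat n) = pe (multiplicity (int p) (int n))"
    using rnorm_of_int[of "int n"] n by simp
  then show ?thesis using le by (simp add: rnorm_divide pe_def)
qed

text \<open>The integers are dense in the rationals of absolute value at most 1: such a fraction in
  lowest terms has a denominator prime to p, which is invertible modulo p^m.\<close>

lemma ex_int_approx:
  assumes "rnorm p x \<le> 1"
  shows "\<exists>z::int. rnorm p (x - of_int z) \<le> pe m"
proof -
  obtain a b where x: "x = of_int a / of_int b" "b > 0" and cop: "coprime a b" by (rule rat_frac)
  have nd: "\<not> int p dvd b"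
  proof
    assume pb: "int p dvd b"
    then have "rnorm p (of_int b) \<le> pe 1" by (subst rnorm_of_int_le_iff) auto
    moreover have "pe 1 < 1" using p_gt_1 by (simp add: pe_def)
    ultimately have b1: "rnorm p (of_int b) < 1" by simp
    have "coprime a (int p)"
      using pb cop by (meson coprime_divisors dvd_refl)
    then have "rnorm p (of_int a) = 1" by (rule rnorm_coprime)
    then have "1 \<le> rnorm p (of_int b)"
      using assms x(2) rnorm_nonneg[of "of_int b"]
      by (simp add: x(1) rnorm_divide divide_simps split: if_splits del: rnorm_nonneg)
    with b1 show False by simp
  qed
  then have "coprime (int p) b"
    using prime_int_p by (simp add: prime_imp_coprime)
  then have "coprime b (int p ^ m)" by (simp add: coprime_commute)
  \<comment> \<open>Bezout supplies an inverse \<open>c\<close> of the denominator modulo p^m, so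
    \<open>a * c\<close> is the integer sought.\<close>
  then obtain c t where c: "c * b + t * int p ^ m = 1"
    by (metis bezout_int coprime_imp_gcd_eq_1)
  have "x - of_int (a * c) = of_int a * of_int (t * int p ^ m) / of_int b"
  proof -
    have "t * int p ^ m = 1 - c * b" using c by simp
    then show ?thesis using x by (simp only: of_int_diff of_int_mult) (simp add: field_simps)
  qed
  moreover have "rnorm p (of_int b) = 1"
    using nd prime_int_p by (intro rnorm_coprime) (metis coprime_commute prime_imp_coprime)
  moreover have "rnorm p (of_int (a * (t * int p ^ m))) \<le> pe m"
    by (subst rnorm_of_int_le_iff) auto
  ultimately show ?thesis by (intro exI[of _ "a * c"]) (simp add: rnorm_divide)
qed

subsection \<open>The p-adic numbers\<close>

lemma pcauchy_const: "pcauchy p (\<lambda>_. q)"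
  by (simp add: pcauchy_def)

lemma pcauchyI:
  assumes "\<And>m n. m \<le> n \<Longrightarrow> rnorm p (X n - X m) \<le> d m" "d \<longlonglongrightarrow> 0"
  shows "pcauchy p X"
  unfolding pcauchy_def
proof (intro allI impI)
  fix e :: real assume "e > 0"
  then obtain N where N: "d N < e"
    using order_tendstoD(2)[OF assms(2)] by (metis eventually_sequentially order_refl)
  have "rnorm p (X m - X n) < e" if "m \<ge> N" "n \<ge> N" for m n
    using rnorm_triangle[of "X m" "X N" "d N" "X n"] assms(1)[OF that(1)] assms(1)[OF that(2)] N
    by (simp add: rnorm_minus_commute)
  then show "\<exists>N. \<forall>m\<ge>N. \<forall>n\<ge>N. rnorm p (X m - X n) < e" by blast
qed

lemma pcauchy_eventually:
  assumes "pcauchy p X" "e > 0"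
  shows "\<forall>\<^sub>F m in sequentially. \<forall>\<^sub>F n in sequentially. rnorm p (X n - X m) < e"
proof -
  obtain N where "\<forall>m\<ge>N. \<forall>n\<ge>N. rnorm p (X m - X n) < e"
    using assms unfolding pcauchy_def by blast
  then have N: "rnorm p (X n - X m) < e" if "m \<ge> N" "n \<ge> N" for m n
    using that by (simp add: rnorm_minus_commute)
  show ?thesis
    by (rule eventually_sequentiallyI[of N], rule eventually_sequentiallyI[of N]) (rule N)
qed

lemma pequiv_iff: "pequiv p X Y \<longleftrightarrow> (\<forall>e>0. \<forall>\<^sub>F n in sequentially. rnorm p (X n - Y n) \<le> e)"
proof -
  have "(\<forall>e>0. \<forall>\<^sub>F n in sequentially. rnorm p (X n - Y n) < e)
    \<longleftrightarrow> (\<forall>e>0. \<forall>\<^sub>F n in sequentially. rnorm p (X n - Y n) \<le> e)" (is "?l \<longleftrightarrow> ?r")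
  proof
    assume ?l then show ?r by (auto elim!: eventually_mono)
  next
    assume r: ?r
    show ?l
    proof (intro allI impI)
      fix e :: real assume "e > 0"
      then have "\<forall>\<^sub>F n in sequentially. rnorm p (X n - Y n) \<le> e / 2"
        using r half_gt_zero[OF \<open>e > 0\<close>] by blast
      then show "\<forall>\<^sub>F n in sequentially. rnorm p (X n - Y n) < e"
        by (rule eventually_mono) (use \<open>e > 0\<close> in auto)
    qed
  qed
  then show ?thesis by (simp add: pequiv_def tendsto_iff dist_real_def)
qed

lemma pequiv_refl [simp]: "pequiv p X X"
  by (simp add: pequiv_iff)

lemma pequiv_sym: "pequiv p X Y \<Longrightarrow> pequiv p Y X"
  unfolding pequiv_def by (simp add: rnorm_minus_commute)

lemma pequiv_trans:
  assumes "pequiv p X Y" "pequiv p Y Z" shows "pequiv p X Z"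
  unfolding pequiv_iff
proof (intro allI impI)
  fix e :: real assume "e > 0"
  with assms have "\<forall>\<^sub>F n in sequentially. rnorm p (X n - Y n) \<le> e"
    "\<forall>\<^sub>F n in sequentially. rnorm p (Y n - Z n) \<le> e" by (auto simp: pequiv_iff)
  then show "\<forall>\<^sub>F n in sequentially. rnorm p (X n - Z n) \<le> e"
    by eventually_elim (rule rnorm_triangle)
qed

lemma qp_of_self: "pcauchy p X \<Longrightarrow> X \<in> qp_of p X"
  by (simp add: qp_of_def)

lemma qp_of_cong: "pequiv p X Y \<Longrightarrow> qp_of p X = qp_of p Y"
  by (auto simp: qp_of_def intro: pequiv_trans pequiv_sym)

lemma qp_of_in_Qp [intro]: "pcauchy p X \<Longrightarrow> qp_of p X \<in> Qp p"
  by (auto simp: Qp_def)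

lemma qp_rep_qp_of:
  assumes "pcauchy p X" shows "pequiv p X (qp_rep (qp_of p X))" "pcauchy p (qp_rep (qp_of p X))"
proof -
  have "qp_rep (qp_of p X) \<in> qp_of p X"
    unfolding qp_rep_def by (rule someI[where P = "\<lambda>Y. Y \<in> _"]) (rule qp_of_self[OF assms])
  then show "pequiv p X (qp_rep (qp_of p X))" "pcauchy p (qp_rep (qp_of p X))"
    by (auto simp: qp_of_def)
qed

lemma pcauchy_rep: "A \<in> Qp p \<Longrightarrow> pcauchy p (qp_rep A)"
  by (auto simp: Qp_def qp_rep_qp_of)

lemma qp_of_rep: "A \<in> Qp p \<Longrightarrow> qp_of p (qp_rep A) = A"
  unfolding Qp_def using qp_of_cong[OF qp_rep_qp_of(1)] by auto

section \<open>Approximation of p-adic numbers by rationals\<close>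

definition capx :: "qp \<Rightarrow> rat \<Rightarrow> real \<Rightarrow> bool" where
  "capx A q e \<longleftrightarrow> A \<in> Qp p \<and> (\<forall>\<^sub>F n in sequentially. rnorm p (qp_rep A n - q) \<le> e)"

lemma capx_Qp: "capx A q e \<Longrightarrow> A \<in> Qp p"
  by (simp add: capx_def)

text \<open>Passing from \<open>X\<close> to the chosen representative changes late terms by at most
  e, and the ultrametric inequality absorbs this. For e = 0 a tail condition could depend on the
  representative, hence the strict positivity here and in most later rules.\<close>

lemma capx_qp_of:
  assumes X: "pcauchy p X" and e: "e > 0"
  shows "capx (qp_of p X) q e \<longleftrightarrow> (\<forall>\<^sub>F n in sequentially. rnorm p (X n - q) \<le> e)"
proof -
  have c: "\<forall>\<^sub>F n in sequentially. rnorm p (X n - qp_rep (qp_of p X) n) \<le> e"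
    using qp_rep_qp_of(1)[OF X] e by (simp add: pequiv_iff)
  have "(\<forall>\<^sub>F n in sequentially. rnorm p (qp_rep (qp_of p X) n - q) \<le> e)
      \<longleftrightarrow> (\<forall>\<^sub>F n in sequentially. rnorm p (X n - q) \<le> e)"
  proof
    assume "\<forall>\<^sub>F n in sequentially. rnorm p (qp_rep (qp_of p X) n - q) \<le> e"
    with c show "\<forall>\<^sub>F n in sequentially. rnorm p (X n - q) \<le> e"
      by eventually_elim (rule rnorm_triangle)
  next
    assume "\<forall>\<^sub>F n in sequentially. rnorm p (X n - q) \<le> e"
    with c show "\<forall>\<^sub>F n in sequentially. rnorm p (qp_rep (qp_of p X) n - q) \<le> e"
      by eventually_elim (metis rnorm_triangle rnorm_minus_commute)
  qed
  then show ?thesis using X by (auto simp: capx_def)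
qed

lemma capx_mono: "capx A q e \<Longrightarrow> e \<le> e' \<Longrightarrow> capx A q e'"
  unfolding capx_def by (auto elim: eventually_mono)

lemma capx_shift: "capx A q e \<Longrightarrow> rnorm p (q - q') \<le> e \<Longrightarrow> capx A q' e"
  unfolding capx_def by (auto elim!: eventually_mono intro: rnorm_triangle)

lemma capx_close: "capx A q e \<Longrightarrow> capx A q' e' \<Longrightarrow> rnorm p (q - q') \<le> max e e'"
proof -
  assume "capx A q e" "capx A q' e'"
  then have "\<forall>\<^sub>F n in sequentially. rnorm p (qp_rep A n - q) \<le> e"
    "\<forall>\<^sub>F n in sequentially. rnorm p (qp_rep A n - q') \<le> e'"
    by (auto simp: capx_def)
  then have "\<forall>\<^sub>F n in sequentially. rnorm p (q - q') \<le> max e e'"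
  proof eventually_elim
    case (elim n)
    then show ?case
      using rnorm_triangle[of q "qp_rep A n" "max e e'" q'] by (simp add: rnorm_minus_commute le_max_iff_disj)
  qed
  then show ?thesis by simp
qed

lemma capx_ex: "A \<in> Qp p \<Longrightarrow> e > 0 \<Longrightarrow> \<exists>q. capx A q e"
proof -
  assume A: "A \<in> Qp p" and e: "e > 0"
  have "\<forall>\<^sub>F m in sequentially. \<forall>\<^sub>F n in sequentially. rnorm p (qp_rep A n - qp_rep A m) < e"
    by (rule pcauchy_eventually[OF pcauchy_rep[OF A] e])
  then obtain m where "\<forall>\<^sub>F n in sequentially. rnorm p (qp_rep A n - qp_rep A m) < e"
    using eventually_happens by fastforce
  then have "\<forall>\<^sub>F n in sequentially. rnorm p (qp_rep A n - qp_rep A m) \<le> e"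
    by (rule eventually_mono) auto
  then show ?thesis using A by (auto simp: capx_def)
qed

text \<open>Equality in Q_p is tested by common rational approximations. Through this rule the
  identities between p-adic operations reduce to identities between rationals.\<close>

lemma Qp_eqI:
  assumes "A \<in> Qp p" "B \<in> Qp p" "\<And>e. e > 0 \<Longrightarrow> \<exists>q. capx A q e \<and> capx B q e"
  shows "A = B"
proof -
  have "pequiv p (qp_rep A) (qp_rep B)"
    unfolding pequiv_iff
  proof (intro allI impI)
    fix e :: real assume "e > 0"
    then obtain q where "capx A q e" "capx B q e" using assms(3) by blast
    then have "\<forall>\<^sub>F n in sequentially. rnorm p (qp_rep A n - q) \<le> e"
      "\<forall>\<^sub>F n in sequentially. rnorm p (qp_rep B n - q) \<le> e" by (auto simp: capx_def)
    then show "\<forall>\<^sub>F n in sequentially. rnorm p (qp_rep A n - qp_rep B n) \<le> e"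
      by eventually_elim (metis rnorm_triangle rnorm_minus_commute)
  qed
  then have "qp_of p (qp_rep A) = qp_of p (qp_rep B)" by (rule qp_of_cong)
  then show ?thesis using assms(1,2) by (simp add: qp_of_rep)
qed

lemma Qp_eqI_pe:
  assumes "\<And>m. \<exists>q. capx A q (pe m) \<and> capx B q (pe m)"
  shows "A = B"
proof (rule Qp_eqI)
  fix e :: real assume "e > 0"
  then obtain m where "pe m < e" using ex_pe_less by blast
  then show "\<exists>q. capx A q e \<and> capx B q e" using assms[of m] by (meson capx_mono less_imp_le)
qed (use assms capx_Qp in blast)+

lemma capx_limit:
  assumes "pcauchy p X" "e > 0" "\<And>n. n \<ge> m \<Longrightarrow> rnorm p (X n - X m) \<le> e"
  shows "capx (qp_of p X) (X m) e"
  using assms by (auto simp: capx_qp_of eventually_sequentially)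

lemma qp_const_Qp [simp]: "qp_const p q \<in> Qp p"
  by (auto simp: qp_const_def pcauchy_const)

lemma capx_const_iff: "e > 0 \<Longrightarrow> capx (qp_const p q) q' e \<longleftrightarrow> rnorm p (q - q') \<le> e"
  by (simp add: qp_const_def capx_qp_of pcauchy_const)

lemma capx_const: "e > 0 \<Longrightarrow> capx (qp_const p q) q e"
  by (simp add: capx_const_iff)

lemma capx_zero: "e > 0 \<Longrightarrow> capx (qp_zero p) 0 e"
  by (simp add: qp_zero_def capx_const)

lemma capx_one: "e > 0 \<Longrightarrow> capx (qp_one p) 1 e"
  by (simp add: qp_one_def capx_const)

lemma qp_zero_Qp [simp]: "qp_zero p \<in> Qp p" and qp_one_Qp [simp]: "qp_one p \<in> Qp p"
  by (simp_all add: qp_zero_def qp_one_def)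

text \<open>One rational centre for a whole tail suffices, since two points of an ultrametric ball
  are no farther apart than its radius.\<close>

lemma pcauchy_eventuallyI:
  assumes "\<And>e. e > 0 \<Longrightarrow> \<exists>q. \<forall>\<^sub>F n in sequentially. rnorm p (X n - q) \<le> e"
  shows "pcauchy p X"
  unfolding pcauchy_def
proof (intro allI impI)
  fix e :: real assume "e > 0"
  then obtain q where "\<forall>\<^sub>F n in sequentially. rnorm p (X n - q) \<le> e / 2" using assms[of "e / 2"] by auto
  then obtain N where N: "\<And>n. n \<ge> N \<Longrightarrow> rnorm p (X n - q) \<le> e / 2" by (auto simp: eventually_sequentially)
  have "rnorm p (X m - X n) < e" if "m \<ge> N" "n \<ge> N" for m n
    using rnorm_triangle[of "X m" q "e / 2" "X n"] N[OF that(1)] N[OF that(2)] \<open>e > 0\<close>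
    by (simp add: rnorm_minus_commute)
  then show "\<exists>N. \<forall>m\<ge>N. \<forall>n\<ge>N. rnorm p (X m - X n) < e" by blast
qed

lemma capx_mul_ev:
  assumes "rnorm p (a - q) \<le> e1" "rnorm p (b - q') \<le> e2"
    "rnorm p q * e2 \<le> e" "e1 * rnorm p q' \<le> e" "e1 * e2 \<le> e"
  shows "rnorm p (a * b - q * q') \<le> e"
proof -
  have nn: "0 \<le> e1" "0 \<le> e2" using assms(1,2) rnorm_nonneg order_trans by blast+
  have "a * b - q * q' = (a - q) * (b - q') + (q * (b - q') + (a - q) * q')" by (simp add: algebra_simps)
  moreover have "rnorm p ((a - q) * (b - q')) \<le> e"
    using mult_mono[OF assms(1,2)] nn assms(5) by (simp add: rnorm_mult)
  moreover have "rnorm p (q * (b - q')) \<le> e"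
    using mult_left_mono[OF assms(2), of "rnorm p q"] assms(3) by (simp add: rnorm_mult)
  moreover have "rnorm p ((a - q) * q') \<le> e"
    using mult_right_mono[OF assms(1), of "rnorm p q'"] assms(4) by (simp add: rnorm_mult)
  ultimately show ?thesis using rnorm_add_le by presburger
qed

section \<open>The ring operations of Q_p\<close>

lemma pcauchy_add:
  assumes A: "A \<in> Qp p" and B: "B \<in> Qp p"
  shows "pcauchy p (\<lambda>n. qp_rep A n + qp_rep B n)"
proof (rule pcauchy_eventuallyI)
  fix e :: real assume e: "e > 0"
  obtain q q' where "capx A q e" "capx B q' e" using capx_ex e A B by metis
  then have "\<forall>\<^sub>F n in sequentially. rnorm p (qp_rep A n - q) \<le> e"
    "\<forall>\<^sub>F n in sequentially. rnorm p (qp_rep B n - q') \<le> e" by (auto simp: capx_def)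
  then have "\<forall>\<^sub>F n in sequentially. rnorm p (qp_rep A n + qp_rep B n - (q + q')) \<le> e"
    by eventually_elim (simp add: add_diff_add rnorm_add_le)
  then show "\<exists>q. \<forall>\<^sub>F n in sequentially. rnorm p (qp_rep A n + qp_rep B n - q) \<le> e" by blast
qed

text \<open>Multiplication is not uniformly continuous, so the precisions are chosen in turn: a
  rough approximation \<open>q\<close> of the first factor bounds its size and fixes the precision
  \<open>e2\<close> for the second, whose approximation \<open>q'\<close> then fixes the precision
  \<open>e1\<close> for the first.\<close>

lemma pcauchy_mul:
  assumes A: "A \<in> Qp p" and B: "B \<in> Qp p"
  shows "pcauchy p (\<lambda>n. qp_rep A n * qp_rep B n)"
proof (rule pcauchy_eventuallyI)
  fix e :: real assume e: "e > 0"
  obtain q where q: "capx A q 1" using capx_ex[OF A, of 1] by auto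
  define e2 where "e2 = e / (rnorm p q + 1)"
  have e2: "e2 > 0" using e rnorm_nonneg[of q] unfolding e2_def by (intro divide_pos_pos) linarith+
  obtain q' where q': "capx B q' e2" using capx_ex[OF B e2] by auto
  \<comment> \<open>The bound 1 keeps the refined approximation \<open>q1\<close> within 1 of
    \<open>q\<close>, so that \<open>e2\<close>, which was chosen from \<open>q\<close>, still works
    for \<open>q1\<close>.\<close>
  define e1 where "e1 = min 1 (min (e / e2) (e / (rnorm p q' + 1)))"
  have e1: "e1 > 0" using e e2 rnorm_nonneg[of q'] unfolding e1_def
    by (auto intro!: divide_pos_pos add_nonneg_pos)
  obtain q1 where q1: "capx A q1 e1" using capx_ex[OF A e1] by auto
  have "rnorm p (q1 - q) \<le> max e1 1" using q1 q by (rule capx_close)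
  then have "rnorm p (q1 - q) \<le> 1" by (simp add: e1_def)
  then have q1n: "rnorm p q1 \<le> rnorm p q + 1"
    using rnorm_add_le[of "q1 - q" "rnorm p q + 1" q] rnorm_nonneg[of q] by auto
  have b1: "rnorm p q1 * e2 \<le> e"
    using mult_right_mono[OF q1n, of e2] e2 rnorm_nonneg[of q] by (simp add: e2_def)
  have "e1 \<le> e / (rnorm p q' + 1)" by (simp add: e1_def)
  then have "e1 * (rnorm p q' + 1) \<le> e" using rnorm_nonneg[of q']
    by (subst (asm) pos_le_divide_eq) linarith+
  then have b2: "e1 * rnorm p q' \<le> e" using e1 by (simp add: distrib_left)
  have "e1 \<le> e / e2" by (simp add: e1_def)
  then have b3: "e1 * e2 \<le> e" using e2 by (simp add: pos_le_divide_eq)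
  from q1 q' have "\<forall>\<^sub>F n in sequentially. rnorm p (qp_rep A n - q1) \<le> e1"
    "\<forall>\<^sub>F n in sequentially. rnorm p (qp_rep B n - q') \<le> e2" by (auto simp: capx_def)
  then have "\<forall>\<^sub>F n in sequentially. rnorm p (qp_rep A n * qp_rep B n - q1 * q') \<le> e"
    by eventually_elim (rule capx_mul_ev[OF _ _ b1 b2 b3])
  then show "\<exists>q. \<forall>\<^sub>F n in sequentially. rnorm p (qp_rep A n * qp_rep B n - q) \<le> e" by blast
qed

lemma pcauchy_neg: "A \<in> Qp p \<Longrightarrow> pcauchy p (\<lambda>n. - qp_rep A n)"
  using pcauchy_rep[of A] by (simp add: pcauchy_def) (metis minus_diff_minus rnorm_minus diff_minus_eq_add add.commute)

lemma qp_add_Qp [simp]: "A \<in> Qp p \<Longrightarrow> B \<in> Qp p \<Longrightarrow> qp_add p A B \<in> Qp p"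
  unfolding qp_add_def by (intro qp_of_in_Qp pcauchy_add)

lemma qp_mul_Qp [simp]: "A \<in> Qp p \<Longrightarrow> B \<in> Qp p \<Longrightarrow> qp_mul p A B \<in> Qp p"
  unfolding qp_mul_def by (intro qp_of_in_Qp pcauchy_mul)

lemma qp_neg_Qp [simp]: "A \<in> Qp p \<Longrightarrow> qp_neg p A \<in> Qp p"
  unfolding qp_neg_def by (intro qp_of_in_Qp pcauchy_neg)

lemma capx_add:
  assumes "capx A q e" "capx B q' e" "e > 0"
  shows "capx (qp_add p A B) (q + q') e"
proof -
  have AB: "A \<in> Qp p" "B \<in> Qp p" using assms capx_Qp by auto
  have "\<forall>\<^sub>F n in sequentially. rnorm p (qp_rep A n - q) \<le> e"
    "\<forall>\<^sub>F n in sequentially. rnorm p (qp_rep B n - q') \<le> e" using assms by (auto simp: capx_def)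
  then have "\<forall>\<^sub>F n in sequentially. rnorm p (qp_rep A n + qp_rep B n - (q + q')) \<le> e"
    by eventually_elim (simp add: add_diff_add rnorm_add_le)
  then show ?thesis unfolding qp_add_def
    by (subst capx_qp_of[OF pcauchy_add[OF AB] assms(3)])
qed

lemma capx_neg:
  assumes "capx A q e" "e > 0"
  shows "capx (qp_neg p A) (- q) e"
proof -
  have A: "A \<in> Qp p" using assms capx_Qp by auto
  have "\<forall>\<^sub>F n in sequentially. rnorm p (qp_rep A n - q) \<le> e" using assms by (auto simp: capx_def)
  then have "\<forall>\<^sub>F n in sequentially. rnorm p (- qp_rep A n - (- q)) \<le> e"
    by eventually_elim (metis minus_diff_minus rnorm_minus)
  then show ?thesis unfolding qp_neg_def
    by (subst capx_qp_of[OF pcauchy_neg[OF A] assms(2)])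
qed

lemma capx_mul:
  assumes "capx A q e1" "capx B q' e2" "e > 0"
    "rnorm p q * e2 \<le> e" "e1 * rnorm p q' \<le> e" "e1 * e2 \<le> e"
  shows "capx (qp_mul p A B) (q * q') e"
proof -
  have AB: "A \<in> Qp p" "B \<in> Qp p" using assms capx_Qp by auto
  have "\<forall>\<^sub>F n in sequentially. rnorm p (qp_rep A n - q) \<le> e1"
    "\<forall>\<^sub>F n in sequentially. rnorm p (qp_rep B n - q') \<le> e2" using assms by (auto simp: capx_def)
  then have "\<forall>\<^sub>F n in sequentially. rnorm p (qp_rep A n * qp_rep B n - q * q') \<le> e"
    by eventually_elim (rule capx_mul_ev[OF _ _ assms(4-6)])
  then show ?thesis unfolding qp_mul_def
    by (subst capx_qp_of[OF pcauchy_mul[OF AB] assms(3)])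
qed

lemma capx_mul_int:
  assumes "capx A q (pe m)" "capx B q' (pe m)" "rnorm p q \<le> 1" "rnorm p q' \<le> 1"
  shows "capx (qp_mul p A B) (q * q') (pe m)"
  using assms by (intro capx_mul[of A q "pe m" B q' "pe m"]) (auto intro: mult_left_le_one_le mult_left_le)

text \<open>The scalar is known exactly, so its own error \<open>d\<close> can be taken as small as
  desired and only the error of \<open>A\<close>, scaled by the absolute value of c,
  remains.\<close>

lemma capx_cmul:
  assumes "capx A q e" "e > 0" "e' > 0" "rnorm p c * e \<le> e'"
  shows "capx (qp_mul p (qp_const p c) A) (c * q) e'"
proof -
  define d where "d = min (e' / e) (e' / (rnorm p q + 1))"
  have d: "d > 0" using assms rnorm_nonneg[of q] unfolding d_def
    by (auto intro!: divide_pos_pos add_nonneg_pos)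
  have "d \<le> e' / (rnorm p q + 1)" by (simp add: d_def)
  then have "d * (rnorm p q + 1) \<le> e'" using rnorm_nonneg[of q]
    by (subst (asm) pos_le_divide_eq) linarith+
  then have "d * rnorm p q \<le> e'" using d by (simp add: distrib_left)
  moreover have "d * e \<le> e'" using assms by (simp add: d_def min_def field_simps)
  ultimately show ?thesis using assms d by (intro capx_mul[OF capx_const[of d] assms(1)]) auto
qed

lemma pcauchy_fsum:
  assumes "finite F" "\<And>x. x \<in> F \<Longrightarrow> f x \<in> Qp p"
  shows "pcauchy p (\<lambda>n. \<Sum>x\<in>F. qp_rep (f x) n)"
proof (rule pcauchy_eventuallyI)
  fix e :: real assume e: "e > 0"
  have "\<forall>x\<in>F. \<exists>q. capx (f x) q e" using capx_ex e assms by blast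
  then obtain q where q: "\<And>x. x \<in> F \<Longrightarrow> capx (f x) (q x) e" by metis
  have "\<forall>\<^sub>F n in sequentially. \<forall>x\<in>F. rnorm p (qp_rep (f x) n - q x) \<le> e"
    using assms q by (intro eventually_ball_finite) (auto simp: capx_def)
  then have "\<forall>\<^sub>F n in sequentially. rnorm p ((\<Sum>x\<in>F. qp_rep (f x) n) - (\<Sum>x\<in>F. q x)) \<le> e"
    by eventually_elim (use e in \<open>auto simp flip: sum_subtractf intro!: rnorm_sum_le\<close>)
  then show "\<exists>q. \<forall>\<^sub>F n in sequentially. rnorm p ((\<Sum>x\<in>F. qp_rep (f x) n) - q) \<le> e" by blast
qed

lemma qp_fsum_Qp: "finite F \<Longrightarrow> (\<And>x. x \<in> F \<Longrightarrow> f x \<in> Qp p) \<Longrightarrow> qp_fsum p f F \<in> Qp p"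
  unfolding qp_fsum_def by (intro qp_of_in_Qp pcauchy_fsum)

lemma capx_fsum:
  assumes "finite F" "\<And>x. x \<in> F \<Longrightarrow> capx (f x) (q x) e" "e > 0"
  shows "capx (qp_fsum p f F) (\<Sum>x\<in>F. q x) e"
proof -
  have "\<forall>\<^sub>F n in sequentially. \<forall>x\<in>F. rnorm p (qp_rep (f x) n - q x) \<le> e"
    using assms by (intro eventually_ball_finite) (auto simp: capx_def)
  then have "\<forall>\<^sub>F n in sequentially. rnorm p ((\<Sum>x\<in>F. qp_rep (f x) n) - (\<Sum>x\<in>F. q x)) \<le> e"
    by eventually_elim (use assms in \<open>auto simp flip: sum_subtractf intro!: rnorm_sum_le\<close>)
  moreover have "pcauchy p (\<lambda>n. \<Sum>x\<in>F. qp_rep (f x) n)"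
    using assms capx_Qp by (intro pcauchy_fsum) auto
  ultimately show ?thesis unfolding qp_fsum_def using assms by (simp add: capx_qp_of)
qed

text \<open>If the absolute values do not tend to 0, some late term exceeds the oscillation of the
  tail of the Cauchy sequence; by the isosceles principle all later terms have the same absolute
  value.\<close>

lemma qp_norm_cases:
  assumes A: "A \<in> Qp p"
  shows "(\<lambda>n. rnorm p (qp_rep A n)) \<longlonglongrightarrow> 0 \<or>
    (\<exists>c>0. (\<exists>q. c = rnorm p q) \<and> (\<forall>\<^sub>F n in sequentially. rnorm p (qp_rep A n) = c))"
proof (cases "(\<lambda>n. rnorm p (qp_rep A n)) \<longlonglongrightarrow> 0")
  case False
  then obtain e where e: "e > 0" "\<not> (\<forall>\<^sub>F n in sequentially. rnorm p (qp_rep A n) < e)"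
    by (auto simp: tendsto_iff dist_real_def)
  obtain N where N: "\<And>m n. m \<ge> N \<Longrightarrow> n \<ge> N \<Longrightarrow> rnorm p (qp_rep A m - qp_rep A n) < e"
    using pcauchy_rep[OF A] e(1) unfolding pcauchy_def by meson
  obtain m where m: "m \<ge> N" "rnorm p (qp_rep A m) \<ge> e"
    using e(2) by (auto simp: eventually_sequentially not_less)
  have "rnorm p (qp_rep A n) = rnorm p (qp_rep A m)" if "n \<ge> N" for n
    using rnorm_eq_of_close[of "qp_rep A m" "qp_rep A n"] N[OF m(1) that] m(2) by simp
  then show ?thesis using e(1) m(2) by (intro disjI2 exI[of _ "rnorm p (qp_rep A m)"])
     (auto simp: eventually_sequentially)
qed auto

lemma qp_norm_tendsto: "A \<in> Qp p \<Longrightarrow> (\<lambda>n. rnorm p (qp_rep A n)) \<longlonglongrightarrow> qp_norm p A"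
  unfolding qp_norm_def convergent_LIMSEQ_iff[symmetric]
  using qp_norm_cases[of A] by (auto simp: convergent_def dest: tendsto_eventually)

lemma qp_norm_nonneg: "A \<in> Qp p \<Longrightarrow> 0 \<le> qp_norm p A"
  by (rule LIMSEQ_le_const[OF qp_norm_tendsto]) auto

text \<open>\<open>qp_norm\<close> is a limit of reals. A bound on the tail passes to the limit;
  conversely a bound on the limit yields one on the tail because the absolute values are eventually
  constant or tend to 0 < e.\<close>

lemma qp_norm_le_iff:
  assumes A: "A \<in> Qp p" and e: "e > 0"
  shows "qp_norm p A \<le> e \<longleftrightarrow> capx A 0 e"
proof
  assume "capx A 0 e"
  then have "\<forall>\<^sub>F n in sequentially. rnorm p (qp_rep A n) \<le> e" by (simp add: capx_def)
  then show "qp_norm p A \<le> e"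
    by (intro tendsto_upperbound[OF qp_norm_tendsto[OF A]]) auto
next
  assume le: "qp_norm p A \<le> e"
  from qp_norm_cases[OF A] have "\<forall>\<^sub>F n in sequentially. rnorm p (qp_rep A n) \<le> e"
  proof
    assume "(\<lambda>n. rnorm p (qp_rep A n)) \<longlonglongrightarrow> 0"
    from order_tendstoD(2)[OF this e] show ?thesis by (rule eventually_mono) auto
  next
    assume "\<exists>c>0. (\<exists>q. c = rnorm p q) \<and> (\<forall>\<^sub>F n in sequentially. rnorm p (qp_rep A n) = c)"
    then obtain c where c: "\<forall>\<^sub>F n in sequentially. rnorm p (qp_rep A n) = c" by blast
    then have "qp_norm p A = c"
      using LIMSEQ_unique[OF qp_norm_tendsto[OF A] tendsto_eventually] by blast
    then show ?thesis using c le by (auto elim: eventually_mono)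
  qed
  then show "capx A 0 e" using A by (simp add: capx_def)
qed

lemma qp_norm_leI: "capx A q e \<Longrightarrow> rnorm p q \<le> e \<Longrightarrow> e > 0 \<Longrightarrow> qp_norm p A \<le> e"
  by (subst qp_norm_le_iff) (auto intro: capx_Qp capx_shift)

lemma capx_norm_le: "A \<in> Qp p \<Longrightarrow> qp_norm p A \<le> e \<Longrightarrow> capx A q e \<Longrightarrow> e > 0 \<Longrightarrow> rnorm p q \<le> e"
  using capx_close[of A q e 0 e] by (simp add: qp_norm_le_iff)

lemma qp_norm_diff_leI: "capx A q e \<Longrightarrow> capx B q e \<Longrightarrow> e > 0 \<Longrightarrow> qp_norm p (qp_add p A (qp_neg p B)) \<le> e"
  using capx_add[of A q e "qp_neg p B" "-q"] capx_neg[of B q e]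
  by (subst qp_norm_le_iff) (auto intro: capx_Qp)

lemma capx_of_norm_diff:
  assumes "A \<in> Qp p" "capx B q e" "e > 0" "qp_norm p (qp_add p A (qp_neg p B)) \<le> e"
  shows "capx A q e"
proof -
  have B: "B \<in> Qp p" using assms capx_Qp by blast
  obtain q' where q': "capx A q' e" using capx_ex[OF assms(1,3)] by blast
  have "capx (qp_add p A (qp_neg p B)) (q' + - q) e"
    using q' assms by (intro capx_add capx_neg) auto
  then have "rnorm p (q' - q) \<le> e"
    using capx_norm_le[of "qp_add p A (qp_neg p B)" e] assms B by auto
  then show ?thesis using q' by (rule capx_shift[rotated])
qed

lemma capx_int:
  assumes "A \<in> Qp p" "qp_norm p A \<le> 1"
  shows "\<exists>z::int. capx A (of_int z) (pe m)"
proof -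
  obtain q where q: "capx A q (pe m)" using capx_ex[OF assms(1)] by fastforce
  then have "rnorm p q \<le> 1"
    using capx_norm_le[of A 1 q] assms capx_mono[OF q pe_le_1] by auto
  then obtain z :: int where "rnorm p (q - of_int z) \<le> pe m" using ex_int_approx by blast
  then show ?thesis using q capx_shift by blast
qed

section \<open>Convergence of sequences and unordered sums\<close>

lemma qp_tendstoI:
  assumes "L \<in> Qp p" "\<And>n. X n \<in> Qp p"
    "\<And>e. e > 0 \<Longrightarrow> \<forall>\<^sub>F n in sequentially. \<exists>q. capx (X n) q e \<and> capx L q e"
  shows "qp_tendsto p X L"
proof -
  have "(\<lambda>n. qp_norm p (qp_add p (X n) (qp_neg p L))) \<longlonglongrightarrow> 0"
    unfolding tendsto_iff
  proof (intro allI impI)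
    fix e :: real assume e: "e > 0"
    then have "\<forall>\<^sub>F n in sequentially. \<exists>q. capx (X n) q (e / 2) \<and> capx L q (e / 2)" using assms(3) by simp
    then show "\<forall>\<^sub>F n in sequentially. dist (qp_norm p (qp_add p (X n) (qp_neg p L))) 0 < e"
    proof eventually_elim
      case (elim n)
      then have "qp_norm p (qp_add p (X n) (qp_neg p L)) \<le> e / 2"
        using qp_norm_diff_leI half_gt_zero[OF e] by blast
      moreover have "0 \<le> qp_norm p (qp_add p (X n) (qp_neg p L))" using assms by (intro qp_norm_nonneg) auto
      ultimately show ?case using e by (simp add: dist_real_def)
    qed
  qed
  then show ?thesis using assms by (simp add: qp_tendsto_def)
qed

lemma qp_has_sum_unique:
  assumes "qp_has_sum p f A L" "qp_has_sum p f A L'"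
  shows "L = L'"
proof (rule Qp_eqI)
  show L: "L \<in> Qp p" "L' \<in> Qp p" using assms by (auto simp: qp_has_sum_def)
  fix e :: real assume e: "e > 0"
  obtain F where F: "finite F \<and> F \<subseteq> A \<and> (\<forall>G. finite G \<and> F \<subseteq> G \<and> G \<subseteq> A \<longrightarrow>
      qp_norm p (qp_add p (qp_fsum p f G) (qp_neg p L)) < e)"
    using assms(1)[unfolded qp_has_sum_def] e by blast
  obtain F' where F': "finite F' \<and> F' \<subseteq> A \<and> (\<forall>G. finite G \<and> F' \<subseteq> G \<and> G \<subseteq> A \<longrightarrow>
      qp_norm p (qp_add p (qp_fsum p f G) (qp_neg p L')) < e)"
    using assms(2)[unfolded qp_has_sum_def] e by blast
  define G where "G = F \<union> F'"
  have G: "qp_norm p (qp_add p (qp_fsum p f G) (qp_neg p L)) < e"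
    "qp_norm p (qp_add p (qp_fsum p f G) (qp_neg p L')) < e"
    using F F' by (auto simp: G_def)
  have S: "qp_fsum p f G \<in> Qp p"
  proof (rule qp_fsum_Qp)
    show "finite G" using F F' by (simp add: G_def)
    have "\<forall>x\<in>A. f x \<in> Qp p" using assms(1) by (simp add: qp_has_sum_def)
    then show "f x \<in> Qp p" if "x \<in> G" for x using that F F' by (auto simp: G_def)
  qed
  obtain q q' where q: "capx L q e" "capx L' q' e" using capx_ex[OF _ e] L by metis
  have "capx (qp_fsum p f G) q e" "capx (qp_fsum p f G) q' e"
    using S q G e by (auto intro: capx_of_norm_diff)
  then have "rnorm p (q - q') \<le> e" using capx_close by fastforce
  then show "\<exists>q. capx L q e \<and> capx L' q e" using q capx_shift by blast
qed

text \<open>The value of an infinite sum is presented by explicit rationals: \<open>q m\<close>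
  approximates all sufficiently large finite partial sums up to p^(-m). The sequence is Cauchy
  because two precisions can be compared on one partial sum, taken over the union of both index
  sets.\<close>

lemma qp_sumI:
  assumes f: "\<And>x. x \<in> A \<Longrightarrow> f x \<in> Qp p"
    and q: "\<And>m. \<exists>F0. finite F0 \<and> F0 \<subseteq> A \<and>
      (\<forall>F. finite F \<and> F0 \<subseteq> F \<and> F \<subseteq> A \<longrightarrow> capx (qp_fsum p f F) (q m) (pe m))"
  shows "qp_has_sum p f A (qp_of p q)" "qp_sumv p f A = qp_of p q"
    "capx (qp_of p q) (q m) (pe m)" "pcauchy p q"
proof -
  have le: "rnorm p (q n - q m) \<le> pe m" if "m \<le> n" for m n
  proof -
    obtain F0 where F0: "finite F0 \<and> F0 \<subseteq> A \<and>
      (\<forall>F. finite F \<and> F0 \<subseteq> F \<and> F \<subseteq> A \<longrightarrow> capx (qp_fsum p f F) (q m) (pe m))" using q[of m] ..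
    obtain F1 where F1: "finite F1 \<and> F1 \<subseteq> A \<and>
      (\<forall>F. finite F \<and> F1 \<subseteq> F \<and> F \<subseteq> A \<longrightarrow> capx (qp_fsum p f F) (q n) (pe n))" using q[of n] ..
    from F0 F1 have "capx (qp_fsum p f (F0 \<union> F1)) (q m) (pe m)" "capx (qp_fsum p f (F0 \<union> F1)) (q n) (pe n)"
      by auto
    from capx_close[OF this(2,1)] show ?thesis using pe_antimono[OF that] by simp
  qed
  show c: "pcauchy p q" by (rule pcauchyI[OF le pe_tendsto_0])
  have lim: "capx (qp_of p q) (q m) (pe m)" for m
    using le by (intro capx_limit[OF c]) auto
  then show "capx (qp_of p q) (q m) (pe m)" .
  show hs: "qp_has_sum p f A (qp_of p q)"
    unfolding qp_has_sum_def
  proof (intro conjI ballI allI impI)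
    show "qp_of p q \<in> Qp p" using c by auto
    show "f x \<in> Qp p" if "x \<in> A" for x using f that .
    fix e :: real assume "e > 0"
    then obtain m where m: "pe m < e" using ex_pe_less by blast
    obtain F0 where F0: "finite F0 \<and> F0 \<subseteq> A \<and>
      (\<forall>F. finite F \<and> F0 \<subseteq> F \<and> F \<subseteq> A \<longrightarrow> capx (qp_fsum p f F) (q m) (pe m))" using q[of m] ..
    have "qp_norm p (qp_add p (qp_fsum p f F) (qp_neg p (qp_of p q))) < e"
      if "finite F \<and> F0 \<subseteq> F \<and> F \<subseteq> A" for F
      using qp_norm_diff_leI[of "qp_fsum p f F" "q m" "pe m" "qp_of p q"] F0 that lim[of m] m by auto
    then show "\<exists>F0. finite F0 \<and> F0 \<subseteq> A \<and> (\<forall>F. finite F \<and> F0 \<subseteq> F \<and> F \<subseteq> A \<longrightarrow>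
        qp_norm p (qp_add p (qp_fsum p f F) (qp_neg p (qp_of p q))) < e)" using F0 by blast
  qed
  show "qp_sumv p f A = qp_of p q"
    unfolding qp_sumv_def
  proof (rule the_equality)
    show "L = qp_of p q" if "qp_has_sum p f A L" for L
      using that hs by (rule qp_has_sum_unique)
  qed (rule hs)
qed

lemma qp_add_zero: "A \<in> Qp p \<Longrightarrow> qp_add p A (qp_zero p) = A"
  and qp_zero_add: "A \<in> Qp p \<Longrightarrow> qp_add p (qp_zero p) A = A"
  by (rule Qp_eqI, simp, simp, metis capx_ex capx_add capx_zero add_0_right add_0_left)+

lemma qp_add_const: "qp_add p (qp_const p a) (qp_const p b) = qp_const p (a + b)"
  by (rule Qp_eqI) (auto intro!: exI[of _ "a + b"] capx_add capx_const)

lemma qp_neg_const: "qp_neg p (qp_const p a) = qp_const p (- a)"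
  by (rule Qp_eqI) (auto intro!: exI[of _ "- a"] capx_neg capx_const)

lemma qp_mul_const: "qp_mul p (qp_const p a) (qp_const p b) = qp_const p (a * b)"
proof (rule Qp_eqI)
  fix e :: real assume "e > 0"
  moreover have "rnorm p a * (e / (rnorm p a + 1)) \<le> e"
  proof -
    have "0 < rnorm p a + 1" using rnorm_nonneg[of a] by linarith
    then show ?thesis using \<open>e > 0\<close>
      by (simp only: times_divide_eq_right pos_divide_le_eq) (simp add: algebra_simps)
  qed
  moreover have "e / (rnorm p a + 1) > 0" using \<open>e > 0\<close> rnorm_nonneg[of a] by (intro divide_pos_pos) linarith+
  ultimately show "\<exists>q. capx (qp_mul p (qp_const p a) (qp_const p b)) q e \<and> capx (qp_const p (a * b)) q e"
    by (intro exI[of _ "a * b"] conjI capx_cmul[of _ _ "e / (rnorm p a + 1)"] capx_const)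
qed auto

lemma qp_cmul_eq_iff:
  assumes "A \<in> Qp p" "B \<in> Qp p" "c \<noteq> 0" "qp_mul p (qp_const p c) A = qp_mul p (qp_const p c) B"
  shows "A = B"
proof (rule Qp_eqI[OF assms(1,2)])
  fix e :: real assume e: "e > 0"
  have c: "rnorm p c > 0" using assms(3) by (simp add: less_le)
  obtain q q' where q: "capx A q e" "capx B q' e" using capx_ex[OF _ e] assms by metis
  have "capx (qp_mul p (qp_const p c) A) (c * q) (rnorm p c * e)"
    "capx (qp_mul p (qp_const p c) B) (c * q') (rnorm p c * e)"
    using q c e by (auto intro!: capx_cmul)
  from capx_close[OF this(1)[unfolded assms(4)] this(2)]
  have "rnorm p (c * (q - q')) \<le> rnorm p c * e" by (simp add: right_diff_distrib)
  then have "rnorm p (q - q') \<le> e" using c by (simp add: rnorm_mult)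
  then show "\<exists>q. capx A q e \<and> capx B q e" using q capx_shift by blast
qed

subsection \<open>Logarithms of integers prime to p\<close>

text \<open>For an integer d prime to p this sequence in k converges to the p-adic logarithm of d.\<close>
definition Lk :: "nat \<Rightarrow> int \<Rightarrow> rat" where
  "Lk k d = (of_int d ^ ((p - 1) * p ^ k) - 1) / of_nat ((p - 1) * p ^ k)"

lemma coprime_p_iff: "coprime z (int p) \<longleftrightarrow> \<not> int p dvd z"
  using prime_int_p by (metis coprime_commute prime_imp_coprime coprime_common_divisor dvd_refl not_prime_unit)

lemma rnorm_p1: "rnorm p (of_nat (p - 1)) = 1"
proof -
  have "\<not> int p dvd int (p - 1)"
    using p_ge_2 by (auto dest!: dvd_imp_le simp flip: of_nat_diff simp: int_dvd_int_iff)
  then have "coprime (int (p - 1)) (int p)" by (simp add: coprime_p_iff)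
  from rnorm_coprime[OF this] show ?thesis by simp
qed

lemma rnorm_pk: "rnorm p (of_nat (p ^ k)) = pe k"
  using rnorm_p by (simp add: rnorm_power pe_def power_divide)

lemma rnorm_Lk_denom: "rnorm p (of_nat ((p - 1) * p ^ k)) = pe k"
  using rnorm_p1 rnorm_pk by (simp only: of_nat_mult rnorm_mult)

lemma Lk_denom_nz: "(of_nat ((p - 1) * p ^ k) :: rat) \<noteq> 0"
  using rnorm_Lk_denom[of k] rnorm_eq_0_iff pe_pos by (metis less_irrefl)

text \<open>Each p-th power gains one factor of p. In the factorisation of X^p - Y^p the cofactor of
  X - Y is congruent to p Y^(p-1), hence to 0, modulo p. The assumption m >= 1 provides the
  congruence of X and Y modulo p.\<close>

lemma cong_pow_p:
  fixes x y :: int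
  assumes "m \<ge> 1" "int p ^ m dvd x - y"
  shows "int p ^ (m + k) dvd x ^ (p ^ k) - y ^ (p ^ k)"
proof (induction k)
  case (Suc k)
  define X where "X = x ^ (p ^ k)"
  define Y where "Y = y ^ (p ^ k)"
  have XY: "int p ^ (m + k) dvd X - Y" using Suc by (simp add: X_def Y_def)
  moreover have "int p dvd int p ^ (m + k)" using assms by (intro dvd_power) auto
  ultimately have "[X = Y] (mod int p)" by (metis cong_iff_dvd_diff dvd_trans)
  then have "[(\<Sum>i<p. Y ^ (p - Suc i) * X ^ i) = (\<Sum>i<p. Y ^ (p - Suc i) * Y ^ i)] (mod int p)"
    by (intro cong_sum cong_mult cong_pow) auto
  also have "(\<Sum>i<p. Y ^ (p - Suc i) * Y ^ i) = (\<Sum>i<p. Y ^ (p - 1))"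
    by (intro sum.cong) (auto simp flip: power_add)
  also have "\<dots> = int p * Y ^ (p - 1)" by simp
  also have "[\<dots> = 0] (mod int p)" by (simp add: cong_0_iff)
  finally have "int p dvd (\<Sum>i<p. Y ^ (p - Suc i) * X ^ i)" by (simp add: cong_0_iff)
  then have "int p ^ (m + k) * int p dvd (X - Y) * (\<Sum>i<p. Y ^ (p - Suc i) * X ^ i)"
    by (rule mult_dvd_mono[OF XY])
  then have "int p ^ (m + k) * int p dvd X ^ p - Y ^ p"
    by (simp only: power_diff_sumr2)
  then show ?case by (simp add: X_def Y_def power_mult[symmetric] mult.commute)
qed (use assms in simp)

lemma fermat_int: "coprime d (int p) \<Longrightarrow> int p dvd d ^ (p - 1) - 1"
proof -
  assume d: "coprime d (int p)"
  define a where "a = nat (d mod int p)"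
  have a: "int a = d mod int p" using p_pos by (simp add: a_def)
  have "\<not> int p dvd int a" using d by (simp add: a coprime_p_iff dvd_mod_iff)
  then have "[a ^ (p - 1) = 1] (mod p)"
    by (intro fermat_theorem prime_p) (simp add: int_dvd_int_iff)
  then have "[int a ^ (p - 1) = 1] (mod int p)"
    by (metis cong_int_iff of_nat_1 of_nat_power)
  moreover have "[d ^ (p - 1) = int a ^ (p - 1)] (mod int p)"
    by (intro cong_pow) (simp add: a cong_def)
  ultimately show ?thesis by (metis cong_iff_dvd_diff cong_trans)
qed

lemma Lk_diff: "Lk k d - Lk k d' = of_int (d ^ ((p - 1) * p ^ k) - d' ^ ((p - 1) * p ^ k)) / of_nat ((p - 1) * p ^ k)"
  by (simp add: Lk_def diff_divide_distrib)

text \<open>The k digits gained by raising to the power p^k are exactly those lost in dividing by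
  p^k. The bound is therefore uniform in k, and an approximant of a determinant may replace the
  determinant.\<close>

lemma rnorm_Lk_diff:
  assumes "m \<ge> 1" "int p ^ m dvd d - d'"
  shows "rnorm p (Lk k d - Lk k d') \<le> pe m"
proof -
  have "d - d' dvd d ^ (p - 1) - d' ^ (p - 1)" by (simp only: power_diff_sumr2) simp
  then have "int p ^ m dvd d ^ (p - 1) - d' ^ (p - 1)" using assms(2) dvd_trans by blast
  from cong_pow_p[OF assms(1) this, of k]
  have "int p ^ (m + k) dvd d ^ ((p - 1) * p ^ k) - d' ^ ((p - 1) * p ^ k)"
    by (simp add: power_mult)
  then have "rnorm p (of_int (d ^ ((p - 1) * p ^ k) - d' ^ ((p - 1) * p ^ k))) \<le> pe (m + k)"
    by (simp only: rnorm_of_int_le_iff)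
  then have "rnorm p (Lk k d - Lk k d') \<le> pe (m + k) / pe k"
    unfolding Lk_diff rnorm_divide rnorm_Lk_denom by (intro divide_right_mono) auto
  then show ?thesis using pe_pos[of k] by (simp add: pe_add)
qed

lemma Lk_1 [simp]: "Lk k 1 = 0"
  by (simp add: Lk_def)

text \<open>By Fermat d^(p-1) is 1 modulo p, so the power p^k makes the numerator divisible by
  p^k.\<close>

lemma rnorm_Lk_le:
  assumes "coprime d (int p)"
  shows "rnorm p (Lk k d) \<le> 1"
proof -
  have "int p ^ (1 + k) dvd (d ^ (p - 1)) ^ p ^ k - 1 ^ p ^ k"
    using fermat_int[OF assms] by (intro cong_pow_p) auto
  then have "int p ^ k dvd d ^ ((p - 1) * p ^ k) - 1"
    using dvd_trans[of "int p ^ k" "int p ^ (1 + k)"] by (simp add: power_mult)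
  then have "rnorm p (of_int (d ^ ((p - 1) * p ^ k) - 1)) \<le> pe k" by (simp only: rnorm_of_int_le_iff)
  then have "rnorm p (Lk k d) \<le> pe k / pe k"
    unfolding Lk_def rnorm_divide rnorm_Lk_denom by (intro divide_right_mono) auto
  then show ?thesis using pe_pos[of k] by simp
qed

text \<open>With n = (p - 1)p^k one has d^n = 1 + n \<open>Lk k d\<close>. Multiplying two such
  expressions shows that additivity fails only by the quadratic term, which is of size
  p^(-k).\<close>

lemma Lk_mult: "Lk k (d * e) = Lk k d + Lk k e + of_nat ((p - 1) * p ^ k) * (Lk k d * Lk k e)"
proof -
  define n where "n = (of_nat ((p - 1) * p ^ k) :: rat)"
  have n: "n \<noteq> 0" unfolding n_def by (rule Lk_denom_nz)
  have "Lk k z * n = of_int z ^ ((p - 1) * p ^ k) - 1" for z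
    using Lk_denom_nz[of k] by (simp add: Lk_def n_def del: of_nat_mult)
  then have z: "of_int z ^ ((p - 1) * p ^ k) = 1 + Lk k z * n" for z by (simp add: algebra_simps)
  have "Lk k (d * e) * n = (1 + Lk k d * n) * (1 + Lk k e * n) - 1"
    by (subst z[symmetric])+ (simp add: power_mult_distrib \<open>Lk k (d * e) * n = _\<close>
      \<open>\<And>z. Lk k z * n = of_int z ^ ((p - 1) * p ^ k) - 1\<close>)
  also have "\<dots> = (Lk k d + Lk k e + n * (Lk k d * Lk k e)) * n" by (simp add: algebra_simps)
  finally show ?thesis using n by (simp add: n_def del: of_nat_mult)
qed

lemma rnorm_Lk_mult:
  assumes "coprime d (int p)" "coprime e (int p)"
  shows "rnorm p (Lk k (d * e) - (Lk k d + Lk k e)) \<le> pe k"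
proof -
  have "rnorm p (Lk k d) * rnorm p (Lk k e) \<le> 1 * 1"
    using assms by (intro mult_mono rnorm_Lk_le) auto
  then have "pe k * (rnorm p (Lk k d) * rnorm p (Lk k e)) \<le> pe k"
    by (intro mult_left_le) auto
  then show ?thesis
    unfolding Lk_mult by (simp only: add_diff_cancel_left' rnorm_mult rnorm_Lk_denom)
qed

lemma rnorm_Lk_power:
  assumes "coprime d (int p)"
  shows "rnorm p (Lk k (d ^ n) - of_nat n * Lk k d) \<le> pe k"
proof (induction n)
  case (Suc n)
  have "rnorm p (Lk k (d * d ^ n) - (Lk k d + Lk k (d ^ n))) \<le> pe k"
    using assms by (intro rnorm_Lk_mult) auto
  moreover have "rnorm p ((Lk k d + Lk k (d ^ n)) - (Lk k d + of_nat n * Lk k d)) \<le> pe k"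
    using Suc by simp
  ultimately show ?case using rnorm_triangle by (simp add: algebra_simps)
qed simp

text \<open>The exponent is even because p - 1 is even for odd p, while for p = 2 the factor p^k
  with k >= 1 is even.\<close>

lemma Lk_minus_one: "k \<ge> 1 \<Longrightarrow> Lk k (-1) = 0"
proof -
  assume k: "k \<ge> 1"
  have "even ((p - 1) * p ^ k)"
    using k prime_odd_nat[OF prime_p] p_ge_2 by (cases "p = 2") auto
  then show ?thesis by (simp add: Lk_def)
qed

text \<open>The number of fixed points is the absolute value of a determinant; the sign is invisible
  to the logarithm.\<close>

lemma Lk_abs: "k \<ge> 1 \<Longrightarrow> Lk k \<bar>d\<bar> = Lk k d"
proof -
  assume k: "k \<ge> 1"
  have "even ((p - 1) * p ^ k)"
    using k prime_odd_nat[OF prime_p] p_ge_2 by (cases "p = 2") auto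
  then show ?thesis by (simp add: Lk_def power_even_abs)
qed

lemma one_plus_power_expand:
  fixes a :: "'a::comm_ring_1"
  shows "\<exists>z. (1 + a) ^ n = 1 + of_nat n * a + z * a\<^sup>2"
proof (induction n)
  case (Suc n)
  then obtain z where z: "(1 + a) ^ n = 1 + of_nat n * a + z * a\<^sup>2" by blast
  have "(1 + a) ^ Suc n = 1 + of_nat (Suc n) * a + (of_nat n + z + z * a) * a\<^sup>2"
    by (simp add: z algebra_simps power2_eq_square)
  then show ?case by blast
qed (auto intro: exI[of _ 0])

lemma rnorm_Lk_one_plus:
  assumes "int p dvd d - 1"
  shows "rnorm p (Lk k d - of_int (d ^ (p ^ k) - 1) / of_nat (p ^ k)) \<le> pe k"
proof -
  define a where "a = d ^ (p ^ k) - 1"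
  have "int p ^ (1 + k) dvd d ^ (p ^ k) - 1 ^ (p ^ k)"
    using assms by (intro cong_pow_p) auto
  then have pa: "int p ^ k dvd a"
    using dvd_trans[of "int p ^ k" "int p ^ (1 + k)"] by (simp add: a_def)
  obtain z where z: "(1 + a) ^ (p - 1) = 1 + of_nat (p - 1) * a + z * a\<^sup>2"
    using one_plus_power_expand by blast
  have "d ^ ((p - 1) * p ^ k) = (1 + a) ^ (p - 1)"
    by (simp add: a_def power_mult[symmetric] mult.commute)
  then have "d ^ ((p - 1) * p ^ k) - 1 = of_nat (p - 1) * a + z * a\<^sup>2" using z by simp
  then have A: "of_int d ^ ((p - 1) * p ^ k) - 1 = (of_nat (p - 1) * of_int a + of_int (z * a\<^sup>2) :: rat)"
    by (metis (no_types, lifting) of_int_1 of_int_add of_int_diff of_int_mult of_int_of_nat_eq of_int_power)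
  have "(x * a + w) / (x * y) - a / y = w / (x * y)" if "x * y \<noteq> 0" for x y a w :: rat
    using that by (simp add: field_simps)
  from this[OF Lk_denom_nz[of k, unfolded of_nat_mult]]
  have "Lk k d - of_int a / of_nat (p ^ k) = of_int (z * a\<^sup>2) / of_nat ((p - 1) * p ^ k)"
    unfolding Lk_def A of_nat_mult .
  moreover have "rnorm p (of_int (z * a\<^sup>2)) \<le> pe (k + k)"
    unfolding rnorm_of_int_le_iff power2_eq_square power_add
    by (intro dvd_mult mult_dvd_mono pa)
  then have "rnorm p (of_int (z * a\<^sup>2) / of_nat ((p - 1) * p ^ k)) \<le> pe (k + k) / pe k"
    unfolding rnorm_divide rnorm_Lk_denom by (intro divide_right_mono) auto
  ultimately show ?thesis using pe_pos[of k] by (simp add: a_def pe_add)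
qed

subsection \<open>The logarithm series as a limit of normalised powers\<close>

lemma rnorm_div_nat_le:
  assumes "rnorm p t \<le> pe n"
  shows "rnorm p (t / of_nat n) \<le> real n * pe n" "rnorm p (t / of_nat n) \<le> 1"
proof -
  show le: "rnorm p (t / of_nat n) \<le> real n * pe n"
  proof (cases "n = 0")
    case False
    have "rnorm p (t * (1 / of_nat n)) \<le> pe n * real n"
      using False assms unfolding rnorm_mult by (intro mult_mono rnorm_inverse_of_nat_le) auto
    then show ?thesis by (simp add: mult.commute)
  qed auto
  have "n < p ^ n" using p_ge_2 by (intro power_gt_expt) auto
  then have "real n \<le> real p ^ n" by (metis less_imp_le of_nat_le_iff of_nat_power)
  then have "real n * pe n \<le> 1" using p_pos by (simp add: pe_def)
  with le show "rnorm p (t / of_nat n) \<le> 1" by simp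
qed

text \<open>By Pascal's rule consecutive signed coefficients differ by a binomial coefficient of
  p^M, and the one at j + 1 equals p^M / (j + 1) times an integer. Its absolute value is thus at
  most (j + 1) p^(-M).\<close>

lemma rnorm_signed_binomial:
  assumes "j < p ^ M"
  shows "rnorm p ((-1) ^ j * of_nat ((p ^ M - 1) choose j) - 1) \<le> real j * pe M"
  using assms
proof (induction j)
  case (Suc j)
  define c where "c = (\<lambda>j. (-1) ^ j * of_nat ((p ^ M - 1) choose j) :: rat)"
  obtain n' where n': "p ^ M = Suc n'" using p_ge_2 by (metis Suc_pred' gr0I less_numeral_extra(3) not_numeral_le_zero power_eq_0_iff)
  have "(of_nat (Suc j) * of_nat (p ^ M choose Suc j) :: rat) = of_nat (p ^ M) * of_nat ((p ^ M - 1) choose j)"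
    by (simp only: of_nat_mult[symmetric] binomial_absorption)
  then have "(of_nat (p ^ M choose Suc j) :: rat) = of_nat ((p ^ M - 1) choose j) * (of_nat (p ^ M) * (1 / of_nat (Suc j)))"
    by (simp add: field_simps del: of_nat_Suc)
  moreover have "c (Suc j) = c j + (-1) ^ Suc j * of_nat (p ^ M choose Suc j)"
    by (simp add: c_def n' algebra_simps)
  ultimately have "c (Suc j) - 1 = (c j - 1) + (-1) ^ Suc j * (of_nat ((p ^ M - 1) choose j) * (of_nat (p ^ M) * (1 / of_nat (Suc j))))"
    by simp
  moreover have "rnorm p (c j - 1) \<le> real (Suc j) * pe M"
    using Suc by (auto simp: c_def elim!: order_trans intro: mult_right_mono)
  moreover have "rnorm p ((-1) ^ Suc j * (of_nat ((p ^ M - 1) choose j) * (of_nat (p ^ M) * (1 / of_nat (Suc j))))) \<le> real (Suc j) * pe M"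
  proof -
    have "rnorm p (of_nat ((p ^ M - 1) choose j) * (of_nat (p ^ M) * (1 / of_nat (Suc j))))
      \<le> 1 * (pe M * real (Suc j))"
      unfolding rnorm_mult rnorm_pk by (intro mult_mono rnorm_inverse_of_nat_le) auto
    then show ?thesis by (simp only: rnorm_mult rnorm_power rnorm_minus rnorm_1) (simp add: mult.commute)
  qed
  ultimately show ?case unfolding c_def by (metis rnorm_add_le)
qed simp

text \<open>A finite form of log(1 - y) = lim ((1 - y)^(p^M) - 1) / p^M. An arbitrary sequence t
  stands for the powers of y, so that the same estimate serves numbers and traces of powers of
  matrices. The threshold does not depend on t.\<close>

lemma normalised_binomial_sum_approx:
  assumes e: "e > 0"
  shows "\<exists>M0. \<forall>M\<ge>M0. \<forall>t. (\<forall>\<nu>. rnorm p (t \<nu>) \<le> pe \<nu>) \<longrightarrow>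
    rnorm p (((\<Sum>j\<le>p ^ M. of_nat (p ^ M choose j) * (-1) ^ j * t j) - t 0) / of_nat (p ^ M)
      + (\<Sum>\<nu>=1..M. t \<nu> / of_nat \<nu>)) \<le> e"
proof -
  obtain K where K: "\<And>n. n \<ge> K \<Longrightarrow> real n * pe n < e" using ex_pe_times_less[OF e] by auto
  obtain M1 where M1: "\<And>n. n \<ge> M1 \<Longrightarrow> real n * pe n < e" using ex_pe_times_less[OF e] by auto
  show ?thesis
  proof (intro exI[of _ "max K M1"] allI impI)
    fix M and t :: "nat \<Rightarrow> rat"
    assume M: "max K M1 \<le> M" and t: "\<forall>\<nu>. rnorm p (t \<nu>) \<le> pe \<nu>"
    define n where "n = p ^ M"
    define c where "c = (\<lambda>j. (-1) ^ j * of_nat ((n - 1) choose j) :: rat)"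
    have Mn: "M < n" unfolding n_def using p_ge_2 by (intro power_gt_expt) auto
    have n0: "n > 0" using Mn by simp
    \<comment> \<open>Absorption turns a binomial coefficient divided by p^M into the reciprocal of
      \<nu> times a binomial coefficient of p^M - 1, which is nearly a sign.\<close>
    have coef: "of_nat (n choose \<nu>) * (-1) ^ \<nu> * t \<nu> / of_nat n = - (t \<nu> / of_nat \<nu>) * c (\<nu> - 1)"
      if \<nu>: "1 \<le> \<nu>" for \<nu>
    proof -
      have "(of_nat (\<nu> * (n choose \<nu>)) :: rat) = of_nat (n * ((n - 1) choose (\<nu> - 1)))"
        using \<nu> by (simp only: times_binomial_minus1_eq)
      then have "of_nat (n choose \<nu>) / of_nat n = (of_nat ((n - 1) choose (\<nu> - 1)) / of_nat \<nu> :: rat)"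
        using \<nu> n0 by (simp add: field_simps)
      moreover have "(-1) ^ \<nu> = - ((-1) ^ (\<nu> - 1) :: rat)" using \<nu> by (cases \<nu>) auto
      ultimately have "of_nat (n choose \<nu>) / of_nat n * (-1) ^ \<nu> * t \<nu>
        = - (of_nat ((n - 1) choose (\<nu> - 1)) / of_nat \<nu>) * (-1) ^ (\<nu> - 1) * t \<nu>" by simp
      then show ?thesis by (simp add: c_def mult_ac)
    qed
    have "(\<Sum>j\<le>n. of_nat (n choose j) * (-1) ^ j * t j) - t 0 = (\<Sum>j=1..n. of_nat (n choose j) * (-1) ^ j * t j)"
      by (simp add: sum.atMost_shift sum.atLeast1_atMost_eq del: binomial_Suc_Suc power_Suc)
    then have "((\<Sum>j\<le>n. of_nat (n choose j) * (-1) ^ j * t j) - t 0) / of_nat n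
      = (\<Sum>j=1..n. of_nat (n choose j) * (-1) ^ j * t j / of_nat n)"
      by (simp add: sum_divide_distrib)
    also have "\<dots> = (\<Sum>j=1..n. - (t j / of_nat j) * c (j - 1))"
      by (intro sum.cong) (auto simp: coef)
    finally have A: "((\<Sum>j\<le>n. of_nat (n choose j) * (-1) ^ j * t j) - t 0) / of_nat n
      = (\<Sum>j=1..n. - (t j / of_nat j) * c (j - 1))" .
    \<comment> \<open>The truncated logarithm becomes a sum up to p^M with weights 1 and 0, to be
      compared term by term with the weights \<open>c (j - 1)\<close>.\<close>
    have B: "(\<Sum>\<nu>=1..M. t \<nu> / of_nat \<nu>) = (\<Sum>j=1..n. (t j / of_nat j) * (if j \<le> M then 1 else 0))"
      using Mn by (intro sum.mono_neutral_cong_left) auto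
    have "rnorm p (\<Sum>j=1..n. (t j / of_nat j) * ((if j \<le> M then 1 else 0) - c (j - 1))) \<le> e"
    proof (rule rnorm_sum_le)
      fix j assume j: "j \<in> {1..n}"
      have c1: "rnorm p (c (j - 1)) \<le> 1"
        by (simp add: c_def rnorm_mult rnorm_power)
      then have c2: "rnorm p ((if j \<le> M then 1 else 0) - c (j - 1)) \<le> 1"
        by (intro rnorm_diff_le) auto
      show "rnorm p ((t j / of_nat j) * ((if j \<le> M then 1 else 0) - c (j - 1))) \<le> e"
      \<comment> \<open>For large j the term itself is small and the difference of the weights is
        integral; for small j, which satisfies j \<le> M, the weight \<open>c (j - 1)\<close> is
        close to 1.\<close>
      proof (cases "K \<le> j")
        case True
        have "rnorm p (t j / of_nat j) \<le> e"
          using rnorm_div_nat_le(1)[of "t j" j] t K[OF True] by force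
        then have "rnorm p (t j / of_nat j) * rnorm p ((if j \<le> M then 1 else 0) - c (j - 1)) \<le> e * 1"
          using c2 e by (intro mult_mono) auto
        then show ?thesis by (simp only: rnorm_mult mult_1_right)
      next
        case False
        then have jM: "j \<le> M" using M by simp
        have "rnorm p (c (j - 1) - 1) \<le> real (j - 1) * pe M"
          unfolding c_def n_def using j by (intro rnorm_signed_binomial) (auto simp: n_def)
        also have "\<dots> \<le> real M * pe M" using jM by (intro mult_right_mono) auto
        also have "\<dots> \<le> e" using M1[of M] M by simp
        finally have "rnorm p (1 - c (j - 1)) \<le> e" by (simp add: rnorm_minus_commute)
        moreover have "rnorm p (t j / of_nat j) \<le> 1" using t by (intro rnorm_div_nat_le) auto
        ultimately have "rnorm p (t j / of_nat j) * rnorm p (1 - c (j - 1)) \<le> 1 * e"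
          using e by (intro mult_mono) auto
        then show ?thesis using jM by (simp only: rnorm_mult mult_1_left if_True)
      qed
    qed (use e in simp)
    moreover have "(\<Sum>j=1..n. (t j / of_nat j) * ((if j \<le> M then 1 else 0) - c (j - 1)))
      = (\<Sum>j=1..n. - (t j / of_nat j) * c (j - 1)) + (\<Sum>\<nu>=1..M. t \<nu> / of_nat \<nu>)"
      unfolding B sum.distrib[symmetric] by (intro sum.cong) (auto simp: algebra_simps)
    ultimately show "rnorm p (((\<Sum>j\<le>p ^ M. of_nat (p ^ M choose j) * (-1) ^ j * t j) - t 0) / of_nat (p ^ M)
      + (\<Sum>\<nu>=1..M. t \<nu> / of_nat \<nu>)) \<le> e"
      using A by (simp add: n_def)
  qed
qed

section \<open>The p-adic logarithm of an integer prime to p\<close>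

lemma qp_norm_const: "qp_norm p (qp_const p q) = rnorm p q"
proof (rule antisym)
  have iff: "qp_norm p (qp_const p q) \<le> e \<longleftrightarrow> rnorm p q \<le> e" if "e > 0" for e
    using qp_norm_le_iff[of "qp_const p q" e] capx_const_iff[of e q 0] that by simp
  show "qp_norm p (qp_const p q) \<le> rnorm p q"
  proof (rule field_le_epsilon)
    fix e :: real assume "e > 0"
    moreover have "rnorm p q + e > 0" using \<open>e > 0\<close> rnorm_nonneg[of q] by linarith
    ultimately show "qp_norm p (qp_const p q) \<le> rnorm p q + e" using iff by simp
  qed
  show "rnorm p q \<le> qp_norm p (qp_const p q)"
  proof (rule field_le_epsilon)
    fix e :: real assume "e > 0"
    moreover have "qp_norm p (qp_const p q) + e > 0" using \<open>e > 0\<close> qp_norm_nonneg[of "qp_const p q"] by simp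
    ultimately show "rnorm p q \<le> qp_norm p (qp_const p q) + e" using iff[of "qp_norm p (qp_const p q) + e"] by simp
  qed
qed

lemma qp_val_const_coprime:
  assumes "coprime d (int p)"
  shows "qp_val p (qp_const p (of_int d)) = 0"
proof -
  have "(1 = real p powr - real_of_int k) \<longleftrightarrow> k = 0" for k
    using p_gt_1 by (auto simp: powr_def)
  then show ?thesis
    unfolding qp_val_def qp_norm_const rnorm_coprime[OF assms] by simp
qed

lemma qp_pow_const: "qp_pow p (qp_const p a) n = qp_const p (a ^ n)"
proof (induction n)
  case 0 then show ?case by (simp add: qp_pow_def qp_one_def)
next
  case (Suc n) then show ?case by (simp add: qp_pow_def qp_mul_const)
qed

text \<open>A finite index set that contains the first \<open>K m\<close> indices adds only terms of
  size at most p^(-m), and by the ultrametric inequality their number does not matter. This handles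
  both the unordered sum and the ordered partial sums.\<close>

lemma capx_sumv_log_series:
  assumes y: "rnorm p y \<le> pe 1" and e: "e > 0"
  shows "\<exists>M0. \<forall>M\<ge>M0. capx (qp_sumv p (\<lambda>\<nu>::nat. qp_mul p (qp_const p (1 / of_nat (Suc \<nu>))) (qp_pow p (qp_const p y) (Suc \<nu>))) UNIV)
    (\<Sum>\<nu>=1..M. y ^ \<nu> / of_nat \<nu>) e"
proof -
  define f where "f = (\<lambda>\<nu>::nat. qp_mul p (qp_const p (1 / of_nat (Suc \<nu>))) (qp_pow p (qp_const p y) (Suc \<nu>)))"
  define a where "a = (\<lambda>\<nu>::nat. y ^ Suc \<nu> / of_nat (Suc \<nu>))"
  have f: "f \<nu> = qp_const p (a \<nu>)" for \<nu>
    by (simp add: f_def a_def qp_pow_const qp_mul_const)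
  have "rnorm p (y ^ n) \<le> pe n" for n
    using power_mono[OF y, of n] by (simp add: rnorm_power pe_def power_divide)
  then have a: "rnorm p (a \<nu>) \<le> real (Suc \<nu>) * pe (Suc \<nu>)" for \<nu>
    unfolding a_def by (intro rnorm_div_nat_le)
  have "\<exists>K. \<forall>n\<ge>K. real n * pe n < pe m" for m by (rule ex_pe_times_less) simp
  then obtain K where K: "\<And>m n. n \<ge> K m \<Longrightarrow> real n * pe n < pe m" by metis
  have ak: "rnorm p (a \<nu>) \<le> pe m" if "\<nu> \<ge> K m" for \<nu> m
    using a[of \<nu>] K[of m "Suc \<nu>"] that by simp
  have ex: "\<exists>F0. finite F0 \<and> F0 \<subseteq> UNIV \<and>
      (\<forall>F. finite F \<and> F0 \<subseteq> F \<and> F \<subseteq> UNIV \<longrightarrow> capx (qp_fsum p f F) (\<Sum>\<nu><K m. a \<nu>) (pe m))" for m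
  proof (intro exI[of _ "{..<K m}"] conjI allI impI)
    fix F assume F: "finite F \<and> {..<K m} \<subseteq> F \<and> F \<subseteq> UNIV"
    have "capx (qp_fsum p f F) (\<Sum>\<nu>\<in>F. a \<nu>) (pe m)"
      using F by (intro capx_fsum) (auto simp: f capx_const)
    moreover have "(\<Sum>\<nu>\<in>F. a \<nu>) - (\<Sum>\<nu><K m. a \<nu>) = (\<Sum>\<nu>\<in>F - {..<K m}. a \<nu>)"
      using F by (simp add: sum_diff)
    moreover have "rnorm p (\<Sum>\<nu>\<in>F - {..<K m}. a \<nu>) \<le> pe m"
      by (intro rnorm_sum_le ak) auto
    ultimately show "capx (qp_fsum p f F) (\<Sum>\<nu><K m. a \<nu>) (pe m)"
      by (auto intro: capx_shift)
  qed auto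
  note S = qp_sumI[OF _ ex]
  have fQ: "f \<nu> \<in> Qp p" for \<nu> by (simp add: f)
  obtain m where m: "pe m < e" using ex_pe_less[OF e] by blast
  have "capx (qp_sumv p f UNIV) (\<Sum>\<nu>=1..M. y ^ \<nu> / of_nat \<nu>) e" if M: "M \<ge> K m" for M
  proof -
    have "(\<Sum>\<nu>=1..M. y ^ \<nu> / of_nat \<nu>) = (\<Sum>\<nu><M. a \<nu>)"
      by (simp add: a_def sum.atLeast1_atMost_eq)
    moreover have "(\<Sum>\<nu><M. a \<nu>) - (\<Sum>\<nu><K m. a \<nu>) = (\<Sum>\<nu>\<in>{..<M} - {..<K m}. a \<nu>)"
      using M by (subst sum_diff) auto
    moreover have "rnorm p (\<Sum>\<nu>\<in>{..<M} - {..<K m}. a \<nu>) \<le> pe m"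
      by (intro rnorm_sum_le ak) auto
    moreover have "capx (qp_sumv p f UNIV) (\<Sum>\<nu><K m. a \<nu>) (pe m)"
      using S(2) S(3)[of m] fQ by simp
    ultimately show ?thesis using m
      by (auto intro!: capx_mono[where e = "pe m" and e' = e] intro: capx_shift simp: rnorm_minus_commute)
  qed
  then show ?thesis unfolding f_def by blast
qed

text \<open>The valuation of d is 0, so the definition gives log(d^(p-1)) / (p - 1) with y = 1 -
  d^(p-1) divisible by p. The normalised power ((1 - y)^(p^M) - 1) / p^M equals (p - 1)
  \<open>Lk M d\<close>, which links the series to \<open>Lk\<close>.\<close>

lemma capx_qp_log:
  assumes d: "coprime d (int p)" and e: "e > 0"
  shows "\<exists>M0. \<forall>M\<ge>M0. capx (qp_log p (qp_const p (of_int d))) (Lk M d) e"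
proof -
  define y where "y = (1 - of_int d ^ (p - 1) :: rat)"
  have "rnorm p (of_int (d ^ (p - 1) - 1)) \<le> pe 1"
    unfolding rnorm_of_int_le_iff using fermat_int[OF d] by simp
  then have y: "rnorm p y \<le> pe 1" by (simp add: y_def rnorm_minus_commute)
  define S where "S = qp_sumv p (\<lambda>\<nu>::nat. qp_mul p (qp_const p (1 / of_nat (Suc \<nu>))) (qp_pow p (qp_const p y) (Suc \<nu>))) UNIV"
  have log: "qp_log p (qp_const p (of_int d)) = qp_mul p (qp_const p (1 / of_nat (p - 1))) (qp_neg p S)"
    unfolding qp_log_def Let_def S_def
    by (simp add: qp_val_const_coprime[OF d] qp_mul_const qp_pow_const qp_one_def qp_neg_const qp_add_const y_def
        del: of_nat_Suc of_nat_diff)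
  obtain M1 where M1: "\<And>M. M \<ge> M1 \<Longrightarrow> capx S (\<Sum>\<nu>=1..M. y ^ \<nu> / of_nat \<nu>) e"
    using capx_sumv_log_series[OF y e] unfolding S_def by blast
  obtain M2 where M2: "\<forall>M\<ge>M2. \<forall>t. (\<forall>\<nu>. rnorm p (t \<nu>) \<le> pe \<nu>) \<longrightarrow>
    rnorm p (((\<Sum>j\<le>p ^ M. of_nat (p ^ M choose j) * (-1) ^ j * t j) - t 0) / of_nat (p ^ M)
      + (\<Sum>\<nu>=1..M. t \<nu> / of_nat \<nu>)) \<le> e"
    using normalised_binomial_sum_approx[OF e] by blast
  have yp: "\<forall>n. rnorm p (y ^ n) \<le> pe n"
    using power_mono[OF y] by (simp add: rnorm_power pe_def power_divide)
  have "capx (qp_log p (qp_const p (of_int d))) (Lk M d) e" if M: "M \<ge> max M1 M2" for M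
  proof -
    have "(1 - y) ^ (p ^ M) = (\<Sum>j\<le>p ^ M. of_nat (p ^ M choose j) * (-1) ^ j * y ^ j)"
      using binomial_ring[of "- y" 1 "p ^ M"] by (simp add: power_minus[of y] mult.assoc)
    then have "rnorm p (((1 - y) ^ (p ^ M) - 1) / of_nat (p ^ M) + (\<Sum>\<nu>=1..M. y ^ \<nu> / of_nat \<nu>)) \<le> e"
      using M2[rule_format, of M "\<lambda>j. y ^ j"] M yp by simp
    moreover have "of_nat (p - 1) * Lk M d = ((1 - y) ^ (p ^ M) - 1) / of_nat (p ^ M)"
    proof -
      have "(of_nat (p - 1) :: rat) \<noteq> 0" using rnorm_p1 by fastforce
      then show ?thesis
        unfolding Lk_def y_def of_nat_mult by (simp add: power_mult del: of_nat_diff)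
    qed
    ultimately have r: "rnorm p (- (\<Sum>\<nu>=1..M. y ^ \<nu> / of_nat \<nu>) - of_nat (p - 1) * Lk M d) \<le> e"
      by (metis add.commute diff_conv_add_uminus minus_add_distrib rnorm_minus)
    have "capx (qp_neg p S) (- (\<Sum>\<nu>=1..M. y ^ \<nu> / of_nat \<nu>)) e"
      using M1 M e by (intro capx_neg) auto
    then have "capx (qp_neg p S) (of_nat (p - 1) * Lk M d) e" using r by (rule capx_shift)
    then have "capx (qp_log p (qp_const p (of_int d))) (1 / of_nat (p - 1) * (of_nat (p - 1) * Lk M d)) e"
      unfolding log using e rnorm_p1 by (intro capx_cmul[of _ _ e]) (auto simp: rnorm_divide)
    moreover have "(of_nat (p - 1) :: rat) \<noteq> 0" using rnorm_p1 by fastforce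
    ultimately show ?thesis by (simp del: of_nat_diff)
  qed
  then show ?thesis by blast
qed

end

subsection \<open>Integral group rings\<close>

abbreviation "lookup \<equiv> Poly_Mapping.lookup"
abbreviation "keys \<equiv> Poly_Mapping.keys"

text \<open>In a group the second factor is determined by the first, so the double convolution
  becomes a single sum of the same shape as \<open>c0_mul\<close>. The superset \<open>F\<close>
  allows two products to be compared over one index set.\<close>

lemma lookup_mult_group:
  fixes \<alpha> \<beta> :: "'g::group_add \<Rightarrow>\<^sub>0 'b::semiring_0" and g :: 'g
  assumes "finite F" "keys \<alpha> \<subseteq> F"
  shows "lookup (\<alpha> * \<beta>) g = (\<Sum>d\<in>F. lookup \<alpha> d * lookup \<beta> (- d + g))"
proof -
  have eq: "g = l + q \<longleftrightarrow> q = - l + g" for l q :: 'g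
    by (metis add.assoc add.left_neutral left_minus right_minus)
  have "lookup (\<alpha> * \<beta>) g = (\<Sum>l. lookup \<alpha> l * lookup \<beta> (- l + g))"
    by (simp add: lookup_mult eq)
  also have "\<dots> = (\<Sum>d\<in>F. lookup \<alpha> d * lookup \<beta> (- d + g))"
    using assms by (intro Sum_any.expand_superset) (auto simp: in_keys_iff subset_iff dest!: mult_not_zero)
  finally show ?thesis .
qed

context padic
begin

definition zcong :: "nat \<Rightarrow> ('g \<Rightarrow>\<^sub>0 int) \<Rightarrow> ('g \<Rightarrow>\<^sub>0 int) \<Rightarrow> bool" where
  "zcong m \<alpha> \<beta> \<longleftrightarrow> (\<forall>g. int p ^ m dvd lookup \<alpha> g - lookup \<beta> g)"

lemma zcong_refl [simp]: "zcong m \<alpha> \<alpha>"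
  by (simp add: zcong_def)

lemma zcong_sym: "zcong m \<alpha> \<beta> \<Longrightarrow> zcong m \<beta> \<alpha>"
  unfolding zcong_def by (metis dvd_minus_iff minus_diff_eq)

lemma zcong_trans: "zcong m \<alpha> \<beta> \<Longrightarrow> zcong m \<beta> \<gamma> \<Longrightarrow> zcong m \<alpha> \<gamma>"
  unfolding zcong_def by (metis diff_add_cancel dvd_add add_diff_eq)

lemma zcong_mono: "zcong n \<alpha> \<beta> \<Longrightarrow> m \<le> n \<Longrightarrow> zcong m \<alpha> \<beta>"
  unfolding zcong_def by (meson dvd_trans le_imp_power_dvd)

lemma zcong_add: "zcong m \<alpha> \<beta> \<Longrightarrow> zcong m \<alpha>' \<beta>' \<Longrightarrow> zcong m (\<alpha> + \<alpha>') (\<beta> + \<beta>')"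
  unfolding zcong_def by (simp add: lookup_add add_diff_add)

lemma zcong_minus: "zcong m \<alpha> \<beta> \<Longrightarrow> zcong m (- \<alpha>) (- \<beta>)"
  using zcong_sym unfolding zcong_def by fastforce

lemma zcong_sum: "(\<And>x. x \<in> S \<Longrightarrow> zcong m (\<alpha> x) (\<beta> x)) \<Longrightarrow> zcong m (sum \<alpha> S) (sum \<beta> S)"
  by (induction S rule: infinite_finite_induct) (auto intro: zcong_add)

lemma zcong_mult:
  fixes \<alpha> \<beta> :: "'g::group_add \<Rightarrow>\<^sub>0 int"
  assumes "zcong m \<alpha> \<beta>" "zcong m \<alpha>' \<beta>'"
  shows "zcong m (\<alpha> * \<alpha>') (\<beta> * \<beta>')"
  unfolding zcong_def
proof
  fix g
  define F where "F = keys \<alpha> \<union> keys \<beta>"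
  have l: "lookup (\<alpha> * \<alpha>') g = (\<Sum>d\<in>F. lookup \<alpha> d * lookup \<alpha>' (- d + g))"
    "lookup (\<beta> * \<beta>') g = (\<Sum>d\<in>F. lookup \<beta> d * lookup \<beta>' (- d + g))"
    by (auto intro!: lookup_mult_group simp: F_def)
  have "[(\<Sum>d\<in>F. lookup \<alpha> d * lookup \<alpha>' (- d + g)) = (\<Sum>d\<in>F. lookup \<beta> d * lookup \<beta>' (- d + g))] (mod int p ^ m)"
    using assms by (intro cong_sum cong_mult) (auto simp: zcong_def cong_iff_dvd_diff)
  then show "int p ^ m dvd lookup (\<alpha> * \<alpha>') g - lookup (\<beta> * \<beta>') g"
    unfolding l by (simp add: cong_iff_dvd_diff)
qed

subsection \<open>Integral approximation of null sequences\<close>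

definition zapx :: "nat \<Rightarrow> 'g c0 \<Rightarrow> ('g \<Rightarrow>\<^sub>0 int) \<Rightarrow> bool" where
  "zapx m a \<alpha> \<longleftrightarrow> (\<forall>g. capx (a g) (of_int (lookup \<alpha> g)) (pe m))"

lemma capx_pe_of_int_unique:
  "capx A (of_int z) (pe m) \<Longrightarrow> capx A (of_int z') (pe m) \<Longrightarrow> int p ^ m dvd z - z'"
  using capx_close[of A "of_int z" "pe m" "of_int z'" "pe m"]
  by (simp add: rnorm_of_int_le_iff[symmetric])

lemma zapx_unique: "zapx m a \<alpha> \<Longrightarrow> zapx m a \<beta> \<Longrightarrow> zcong m \<alpha> \<beta>"
  unfolding zapx_def zcong_def by (blast intro: capx_pe_of_int_unique)

lemma zapx_cong: "zapx m a \<alpha> \<Longrightarrow> zcong m \<alpha> \<beta> \<Longrightarrow> zapx m a \<beta>"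
  unfolding zapx_def zcong_def
proof
  fix g assume a: "\<forall>g. capx (a g) (of_int (lookup \<alpha> g)) (pe m)"
    and "\<forall>g. int p ^ m dvd lookup \<alpha> g - lookup \<beta> g"
  then have "rnorm p (of_int (lookup \<alpha> g) - of_int (lookup \<beta> g)) \<le> pe m"
    by (metis of_int_diff rnorm_of_int_le_iff)
  with a show "capx (a g) (of_int (lookup \<beta> g)) (pe m)" by (blast intro: capx_shift)
qed

lemma zapx_mono: "zapx n a \<alpha> \<Longrightarrow> m \<le> n \<Longrightarrow> zapx m a \<alpha>"
  unfolding zapx_def by (meson capx_mono pe_antimono)

text \<open>Only finitely many coefficients have absolute value at least p^(-m); they are
  approximated by integers and all others by 0.\<close>

lemma c0Zp_zapx:
  assumes "a \<in> c0Zp p"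
  shows "\<exists>\<alpha>. zapx m a \<alpha>"
proof -
  define S where "S = {g. pe m \<le> qp_norm p (a g)}"
  have a: "\<And>g. a g \<in> Qp p" "\<And>g. qp_norm p (a g) \<le> 1" "finite S"
    using assms by (auto simp: c0Zp_def c0_set_def S_def)
  have "\<exists>z::int. capx (a g) (of_int z) (pe m)" for g using capx_int a by blast
  then obtain z where z: "\<And>g. capx (a g) (of_int (z g :: int)) (pe m)" by metis
  define \<alpha> where "\<alpha> = Abs_poly_mapping (\<lambda>g. if g \<in> S then z g else 0)"
  have "finite {g. (if g \<in> S then z g else 0) \<noteq> 0}"
    by (rule finite_subset[OF _ a(3)]) auto
  then have l: "lookup \<alpha> g = (if g \<in> S then z g else 0)" for g
    by (simp add: \<alpha>_def)
  have "capx (a g) (of_int (lookup \<alpha> g)) (pe m)" for g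
    using z a(1) qp_norm_le_iff[of "a g" "pe m"] by (auto simp: l S_def)
  then show ?thesis by (auto simp: zapx_def)
qed

text \<open>Outside the support of an approximant modulo p^m the coefficients have absolute value at
  most p^(-m), so finiteness of the supports is decay at infinity.\<close>

lemma c0ZpI:
  assumes "\<And>m. \<exists>\<alpha>. zapx m a \<alpha>"
  shows "a \<in> c0Zp p"
proof -
  have Q: "a g \<in> Qp p" for g using assms[of 0] capx_Qp by (auto simp: zapx_def)
  have le: "qp_norm p (a g) \<le> 1" for g
    using assms[of 0] by (auto simp: zapx_def intro: qp_norm_leI)
  have "finite {g. e \<le> qp_norm p (a g)}" if e: "e > 0" for e
  proof -
    obtain m where m: "pe m < e" using ex_pe_less[OF e] by blast
    obtain \<alpha> where \<alpha>: "zapx m a \<alpha>" using assms by blast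
    have "{g. e \<le> qp_norm p (a g)} \<subseteq> keys \<alpha>"
    proof
      fix g assume "g \<in> {g. e \<le> qp_norm p (a g)}"
      then have "\<not> qp_norm p (a g) \<le> pe m" using m by simp
      then have "\<not> capx (a g) 0 (pe m)" using qp_norm_leI[of "a g" 0 "pe m"] by auto
      then show "g \<in> keys \<alpha>" using \<alpha> by (auto simp: zapx_def in_keys_iff dest: spec[of _ g])
    qed
    then show ?thesis by (rule finite_subset) simp
  qed
  with Q le show ?thesis by (auto simp: c0Zp_def c0_set_def)
qed

lemma c0_eqI:
  assumes "\<And>m. \<exists>\<alpha>. zapx m a \<alpha> \<and> zapx m b \<alpha>"
  shows "a = b"
proof
  fix g show "a g = b g"
    by (rule Qp_eqI_pe) (use assms in \<open>unfold zapx_def, blast\<close>)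
qed

text \<open>Completeness of c_0(Gamma, Z_p): compatible group ring elements modulo all p^m define an
  element.\<close>

lemma zapx_limit:
  fixes \<alpha> :: "nat \<Rightarrow> ('g \<Rightarrow>\<^sub>0 int)"
  assumes "\<And>m n. m \<le> n \<Longrightarrow> zcong m (\<alpha> n) (\<alpha> m)"
  shows "\<exists>a\<in>c0Zp p. \<forall>m. zapx m a (\<alpha> m)"
proof -
  define q where "q = (\<lambda>g m. of_int (lookup (\<alpha> m) g) :: rat)"
  have le: "rnorm p (q g n - q g m) \<le> pe m" if "m \<le> n" for g m n
    using assms[OF that] by (simp add: q_def zcong_def rnorm_of_int_le_iff[symmetric])
  have c: "pcauchy p (q g)" for g by (rule pcauchyI[OF le pe_tendsto_0])
  have "zapx m (\<lambda>g. qp_of p (q g)) (\<alpha> m)" for m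
    unfolding zapx_def using capx_limit[OF c, of "pe m" m] le by (auto simp: q_def)
  then show ?thesis using c0ZpI[of "\<lambda>g. qp_of p (q g)"] by blast
qed

lemma zapx_zero: "zapx m (c0_zero p) 0"
  by (simp add: zapx_def c0_zero_def capx_zero)

lemma zapx_grp: "zapx m (c0_grp p h) (Poly_Mapping.single h 1)"
  by (simp add: zapx_def c0_grp_def lookup_single capx_zero capx_one when_def)

lemma zapx_one: "zapx m (c0_one p) 1"
  by (simp add: zapx_def c0_one_def lookup_one capx_zero capx_one when_def)

lemma zapx_add: "zapx m a \<alpha> \<Longrightarrow> zapx m b \<beta> \<Longrightarrow> zapx m (c0_add p a b) (\<alpha> + \<beta>)"
  by (simp add: zapx_def c0_add_def lookup_add capx_add)

lemma zapx_neg: "zapx m a \<alpha> \<Longrightarrow> zapx m (c0_neg p a) (- \<alpha>)"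
  by (simp add: zapx_def c0_neg_def) (metis capx_neg pe_pos of_int_minus)

text \<open>The infinite convolution must converge before it can be approximated, so approximants at
  all precisions are chosen and their products serve as the rationals required by
  \<open>qp_sumI\<close>. The given approximants agree with the chosen ones modulo p^m.\<close>

lemma zapx_mul:
  fixes a b :: "'g::group_add c0"
  assumes "a \<in> c0Zp p" "b \<in> c0Zp p" "zapx m a \<alpha>" "zapx m b \<beta>"
  shows "zapx m (c0_mul p a b) (\<alpha> * \<beta>)"
proof -
  obtain A B where A: "\<And>m. zapx m a (A m)" and B: "\<And>m. zapx m b (B m)"
    using c0Zp_zapx[OF assms(1)] c0Zp_zapx[OF assms(2)] by metis
  have "capx (c0_mul p a b g) (of_int (lookup (A m * B m) g)) (pe m)" for g m
  proof -
    define f where "f = (\<lambda>d. qp_mul p (a d) (b (- d + g)))"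
    define q where "q = (\<lambda>m. of_int (lookup (A m * B m) g) :: rat)"
    have "\<exists>F0. finite F0 \<and> F0 \<subseteq> UNIV \<and> (\<forall>F. finite F \<and> F0 \<subseteq> F \<and> F \<subseteq> UNIV \<longrightarrow>
        capx (qp_fsum p f F) (q m) (pe m))" for m
    \<comment> \<open>Beyond the support of \<open>A m\<close> the summands are approximated by 0,
      so enlarging the finite index set leaves the approximation unchanged.\<close>
    proof (intro exI[of _ "keys (A m)"] conjI allI impI)
      fix F assume F: "finite F \<and> keys (A m) \<subseteq> F \<and> F \<subseteq> UNIV"
      have "capx (qp_fsum p f F) (\<Sum>d\<in>F. of_int (lookup (A m) d) * of_int (lookup (B m) (- d + g))) (pe m)"
        using F A[of m] B[of m] by (intro capx_fsum) (auto simp: f_def zapx_def intro!: capx_mul_int)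
      also have "(\<Sum>d\<in>F. of_int (lookup (A m) d) * of_int (lookup (B m) (- d + g))) = q m"
        using F by (simp add: q_def lookup_mult_group[of F])
      finally show "capx (qp_fsum p f F) (q m) (pe m)" .
    qed auto
    note F0 = this
    have "f d \<in> Qp p" for d
      unfolding f_def using assms by (intro qp_mul_Qp) (auto simp: c0Zp_def c0_set_def)
    then have "qp_sumv p f UNIV = qp_of p q" "capx (qp_of p q) (q m) (pe m)"
      by (rule qp_sumI(2)[OF _ F0], rule qp_sumI(3)[OF _ F0])
    then show ?thesis by (simp add: c0_mul_def f_def q_def)
  qed
  then have "zapx m (c0_mul p a b) (A m * B m)" by (simp add: zapx_def)
  then show ?thesis
    by (rule zapx_cong) (intro zcong_mult zapx_unique[OF A] zapx_unique[OF B] assms)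
qed

lemma c0_zero_Zp [simp]: "c0_zero p \<in> c0Zp p"
  and c0_one_Zp [simp]: "c0_one p \<in> c0Zp p"
  and c0_grp_Zp [simp]: "c0_grp p h \<in> c0Zp p"
  by (meson c0ZpI zapx_zero zapx_one zapx_grp)+

lemma c0_add_Zp [simp]: "a \<in> c0Zp p \<Longrightarrow> b \<in> c0Zp p \<Longrightarrow> c0_add p a b \<in> c0Zp p"
  by (meson c0ZpI c0Zp_zapx zapx_add)

lemma c0_neg_Zp [simp]: "a \<in> c0Zp p \<Longrightarrow> c0_neg p a \<in> c0Zp p"
  by (meson c0ZpI c0Zp_zapx zapx_neg)

lemma c0_mul_Zp [simp]: "a \<in> c0Zp p \<Longrightarrow> b \<in> c0Zp p \<Longrightarrow> c0_mul p a b \<in> c0Zp p"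
  by (meson c0ZpI c0Zp_zapx zapx_mul)

lemma c0_units:
  fixes a :: "'g::group_add c0"
  assumes "a \<in> c0Zp p"
  shows "c0_add p a (c0_zero p) = a" "c0_add p (c0_zero p) a = a"
    "c0_mul p a (c0_zero p) = c0_zero p" "c0_mul p (c0_zero p) a = c0_zero p"
    "c0_mul p a (c0_one p) = a" "c0_mul p (c0_one p) a = a"
  using assms
  by (intro c0_eqI; metis c0Zp_zapx zapx_add zapx_mul zapx_zero zapx_one c0_zero_Zp c0_one_Zp
    add_0_left add_0_right mult_zero_left mult_zero_right mult_1_left mult_1_right)+

end

subsection \<open>Stable matrices over a unital ring structure\<close>

definition Mset :: "('a, 'b) rops_scheme \<Rightarrow> nat \<Rightarrow> (nat \<Rightarrow> nat \<Rightarrow> 'a) set" where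
  "Mset R s = {A. fin_id R s A \<and> (\<forall>i j. A i j \<in> rcar R)}"

lemma fin_id_mono: "fin_id R s A \<Longrightarrow> s \<le> t \<Longrightarrow> fin_id R t A"
  by (auto simp: fin_id_def)

lemma fin_id_idm [simp]: "fin_id R s (idm R)"
  by (simp add: fin_id_def)

lemma Mset_mono: "A \<in> Mset R s \<Longrightarrow> s \<le> t \<Longrightarrow> A \<in> Mset R t"
  by (auto simp: Mset_def intro: fin_id_mono)

text \<open>The zero and unit laws are what makes the product of stable matrices independent of the
  block size. Both c_0(Gamma, Z_p) and F_p Gamma are instances.\<close>

locale unital_rops =
  fixes R :: "('a, 'b) rops_scheme"
  assumes zero_closed: "rzero R \<in> rcar R" and one_closed: "rone R \<in> rcar R"
    and add_closed: "x \<in> rcar R \<Longrightarrow> y \<in> rcar R \<Longrightarrow> radd R x y \<in> rcar R"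
    and mul_closed: "x \<in> rcar R \<Longrightarrow> y \<in> rcar R \<Longrightarrow> rmul R x y \<in> rcar R"
    and add_0: "x \<in> rcar R \<Longrightarrow> radd R x (rzero R) = x" "x \<in> rcar R \<Longrightarrow> radd R (rzero R) x = x"
    and mul_0: "x \<in> rcar R \<Longrightarrow> rmul R x (rzero R) = rzero R" "x \<in> rcar R \<Longrightarrow> rmul R (rzero R) x = rzero R"
    and mul_1: "x \<in> rcar R \<Longrightarrow> rmul R x (rone R) = x" "x \<in> rcar R \<Longrightarrow> rmul R (rone R) x = x"
begin

lemma foldr_closed:
  "z \<in> rcar R \<Longrightarrow> (\<And>k. k \<in> set ks \<Longrightarrow> g k \<in> rcar R) \<Longrightarrow> foldr (\<lambda>k acc. radd R (g k) acc) ks z \<in> rcar R"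
  by (induction ks) (auto intro: add_closed)

lemma rsum_closed: "(\<And>k. k < s \<Longrightarrow> g k \<in> rcar R) \<Longrightarrow> rsum R g s \<in> rcar R"
  unfolding rsum_def by (intro foldr_closed zero_closed) auto

lemma foldr_zeros:
  "z \<in> rcar R \<Longrightarrow> (\<And>k. k \<in> set ks \<Longrightarrow> g k = rzero R) \<Longrightarrow> foldr (\<lambda>k acc. radd R (g k) acc) ks z = z"
  by (induction ks) (auto intro: add_0)

lemma rsum_extend:
  assumes "t \<le> s" "\<And>k. t \<le> k \<Longrightarrow> k < s \<Longrightarrow> g k = rzero R"
  shows "rsum R g s = rsum R g t"
proof -
  have "[0..<s] = [0..<t] @ [t..<s]" using assms(1) by (metis le0 upt_add_eq_append le_add_diff_inverse)
  then show ?thesis unfolding rsum_def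
    using foldr_zeros[OF zero_closed, of "[t..<s]" g] assms(2) by simp
qed

lemma rsum_single:
  assumes "i < s" "g i \<in> rcar R" "\<And>k. k < s \<Longrightarrow> k \<noteq> i \<Longrightarrow> g k = rzero R"
  shows "rsum R g s = g i"
proof -
  have "rsum R g s = rsum R g (Suc i)"
    using assms by (intro rsum_extend) auto
  also have "\<dots> = foldr (\<lambda>k acc. radd R (g k) acc) [0..<i] (g i)"
    using assms by (simp add: rsum_def add_0)
  also have "\<dots> = g i" using assms by (intro foldr_zeros) auto
  finally show ?thesis .
qed

lemma idm_closed: "idm R i j \<in> rcar R"
  by (simp add: idm_def zero_closed one_closed)

lemma idm_Mset [simp]: "idm R \<in> Mset R s"
  by (simp add: Mset_def idm_closed)

text \<open>\<open>mmul\<close> works in the least common block; any larger block gives the same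
  product. Inside the least block the additional summands vanish, and in a row or column beyond it
  the sum collapses to one product with the unit.\<close>

lemma mmul_block:
  assumes A: "A \<in> Mset R s" and B: "B \<in> Mset R s"
  shows "mmul R A B i j = (if i < s \<and> j < s then rsum R (\<lambda>k. rmul R (A i k) (B k j)) s else idm R i j)"
proof -
  define t where "t = (LEAST s. fin_id R s A \<and> fin_id R s B)"
  have s: "fin_id R s A \<and> fin_id R s B" using A B by (simp add: Mset_def)
  have "fin_id R t A \<and> fin_id R t B" unfolding t_def by (rule LeastI[where P = "\<lambda>s. fin_id R s A \<and> fin_id R s B", OF s])
  then have tA: "A i j = idm R i j" and tB: "B i j = idm R i j" if "t \<le> i \<or> t \<le> j" for i j
    using that by (auto simp: fin_id_def)
  have ts: "t \<le> s" unfolding t_def by (rule Least_le[where P = "\<lambda>s. fin_id R s A \<and> fin_id R s B", OF s])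
  have c: "A i j \<in> rcar R" "B i j \<in> rcar R" for i j using A B by (auto simp: Mset_def)
  have m: "mmul R A B i j = (if i < t \<and> j < t then rsum R (\<lambda>k. rmul R (A i k) (B k j)) t else idm R i j)"
    by (simp add: mmul_def t_def Let_def)
  consider "i < t" "j < t" | "t \<le> i" "i < s" "j < s" | "i < t" "t \<le> j" "j < s" | "\<not> (i < s \<and> j < s)"
    using ts by linarith
  then show ?thesis
  proof cases
    case 1
    have "rsum R (\<lambda>k. rmul R (A i k) (B k j)) s = rsum R (\<lambda>k. rmul R (A i k) (B k j)) t"
      using 1 tA c ts by (intro rsum_extend) (auto simp: idm_def mul_0)
    then show ?thesis using 1 ts by (simp add: m)
  next
    case 2
    have "rsum R (\<lambda>k. rmul R (A i k) (B k j)) s = rmul R (A i i) (B i j)"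
      using 2 tA c by (intro rsum_single) (auto simp: idm_def mul_0 mul_1 mul_closed)
    also have "\<dots> = idm R i j" using 2 tA[of i i] tB[of i j] c[of i j] by (simp add: idm_def[of R] mul_1 mul_0 one_closed zero_closed)
    finally show ?thesis using 2 by (simp add: m)
  next
    case 3
    have "rsum R (\<lambda>k. rmul R (A i k) (B k j)) s = rmul R (A i j) (B j j)"
      using 3 tB c by (intro rsum_single) (auto simp: idm_def mul_0 mul_1 mul_closed)
    also have "\<dots> = idm R i j" using 3 tA[of i j] tB[of j j] c[of i j] by (simp add: idm_def[of R] mul_1 mul_0 one_closed zero_closed)
    finally show ?thesis using 3 by (simp add: m)
  next
    case 4
    then show ?thesis using ts by (auto simp: m)
  qed
qed

lemma mmul_Mset: "A \<in> Mset R s \<Longrightarrow> B \<in> Mset R s \<Longrightarrow> mmul R A B \<in> Mset R s"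
  by (auto simp: Mset_def fin_id_def mmul_block[of _ s] idm_closed intro!: rsum_closed mul_closed)

end

subsection \<open>Square blocks of functions\<close>

text \<open>Entries outside the block are left unconstrained here, unlike for \<open>mmul\<close>;
  hence the bounds on the indices in the identities below.\<close>

definition tmul :: "nat \<Rightarrow> (nat \<Rightarrow> nat \<Rightarrow> 'b::semiring_0) \<Rightarrow> (nat \<Rightarrow> nat \<Rightarrow> 'b) \<Rightarrow> nat \<Rightarrow> nat \<Rightarrow> 'b" where
  "tmul s \<alpha> \<beta> = (\<lambda>i j. \<Sum>k<s. \<alpha> i k * \<beta> k j)"

definition tone :: "nat \<Rightarrow> nat \<Rightarrow> 'b::zero_neq_one" where
  "tone = (\<lambda>i j. if i = j then 1 else 0)"

definition tpow :: "nat \<Rightarrow> (nat \<Rightarrow> nat \<Rightarrow> 'b::semiring_1) \<Rightarrow> nat \<Rightarrow> nat \<Rightarrow> nat \<Rightarrow> 'b" where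
  "tpow s \<alpha> n = (tmul s \<alpha> ^^ n) tone"

lemma tpow_0 [simp]: "tpow s \<alpha> 0 = tone" and tpow_Suc: "tpow s \<alpha> (Suc n) = tmul s \<alpha> (tpow s \<alpha> n)"
  by (simp_all add: tpow_def)

lemma tmul_assoc: "tmul s (tmul s \<alpha> \<beta>) \<gamma> = tmul s \<alpha> (tmul s \<beta> \<gamma>)"
proof (intro ext)
  fix i j
  have "tmul s (tmul s \<alpha> \<beta>) \<gamma> i j = (\<Sum>k<s. \<Sum>l<s. \<alpha> i l * \<beta> l k * \<gamma> k j)"
    by (simp add: tmul_def sum_distrib_right)
  also have "\<dots> = (\<Sum>l<s. \<Sum>k<s. \<alpha> i l * \<beta> l k * \<gamma> k j)" by (rule sum.swap)
  also have "\<dots> = tmul s \<alpha> (tmul s \<beta> \<gamma>) i j"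
    by (simp add: tmul_def sum_distrib_left mult.assoc)
  finally show "tmul s (tmul s \<alpha> \<beta>) \<gamma> i j = tmul s \<alpha> (tmul s \<beta> \<gamma>) i j" .
qed

lemma tmul_tone:
  fixes \<alpha> :: "nat \<Rightarrow> nat \<Rightarrow> 'b::semiring_1"
  shows "i < s \<Longrightarrow> tmul s tone \<alpha> i j = \<alpha> i j" "j < s \<Longrightarrow> tmul s \<alpha> tone i j = \<alpha> i j"
proof -
  assume i: "i < s"
  have "tmul s tone \<alpha> i j = (\<Sum>k<s. if k = i then \<alpha> k j else 0)"
    unfolding tmul_def tone_def by (intro sum.cong) auto
  then show "tmul s tone \<alpha> i j = \<alpha> i j" using i by simp
next
  assume j: "j < s"
  have "tmul s \<alpha> tone i j = (\<Sum>k<s. if k = j then \<alpha> i k else 0)"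
    unfolding tmul_def tone_def by (intro sum.cong) auto
  then show "tmul s \<alpha> tone i j = \<alpha> i j" using j by simp
qed

lemma tpow_commute:
  fixes \<alpha> :: "nat \<Rightarrow> nat \<Rightarrow> 'b::semiring_1"
  shows "i < s \<Longrightarrow> j < s \<Longrightarrow> tmul s (tpow s \<alpha> n) \<alpha> i j = tmul s \<alpha> (tpow s \<alpha> n) i j"
proof (induction n arbitrary: i j)
  case (Suc n)
  have "tmul s (tpow s \<alpha> (Suc n)) \<alpha> i j = tmul s \<alpha> (tmul s (tpow s \<alpha> n) \<alpha>) i j"
    by (simp only: tpow_Suc tmul_assoc)
  also have "\<dots> = tmul s \<alpha> (tmul s \<alpha> (tpow s \<alpha> n)) i j"
    using Suc by (simp add: tmul_def[of s \<alpha> "tmul _ _ _"])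
  finally show ?case by (simp only: tpow_Suc)
qed (simp add: tmul_tone)

text \<open>The finite Neumann series, on both sides because the entries need not commute.\<close>

lemma geometric_sum_tpow:
  fixes \<alpha> :: "nat \<Rightarrow> nat \<Rightarrow> 'b::ring_1"
  assumes "i < s" "j < s"
  shows "tmul s (\<lambda>i j. tone i j - \<alpha> i j) (\<lambda>i j. \<Sum>\<nu><n. tpow s \<alpha> \<nu> i j) i j = tone i j - tpow s \<alpha> n i j"
    "tmul s (\<lambda>i j. \<Sum>\<nu><n. tpow s \<alpha> \<nu> i j) (\<lambda>i j. tone i j - \<alpha> i j) i j = tone i j - tpow s \<alpha> n i j"
proof -
  have l: "tmul s (\<lambda>i j. \<beta> i j - \<alpha> i j) \<gamma> i j = tmul s \<beta> \<gamma> i j - tmul s \<alpha> \<gamma> i j"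
    and r: "tmul s \<gamma> (\<lambda>i j. \<beta> i j - \<alpha> i j) i j = tmul s \<gamma> \<beta> i j - tmul s \<gamma> \<alpha> i j"
    for \<alpha> \<beta> \<gamma> :: "nat \<Rightarrow> nat \<Rightarrow> 'b"
    by (simp_all add: tmul_def algebra_simps sum_subtractf)
  have "tmul s \<alpha> (\<lambda>i j. \<Sum>\<nu><n. tpow s \<alpha> \<nu> i j) i j = (\<Sum>\<nu><n. tpow s \<alpha> (Suc \<nu>) i j)"
    unfolding tpow_Suc tmul_def sum_distrib_left by (rule sum.swap)
  moreover have "tmul s (\<lambda>i j. \<Sum>\<nu><n. tpow s \<alpha> \<nu> i j) \<alpha> i j = (\<Sum>\<nu><n. tmul s (tpow s \<alpha> \<nu>) \<alpha> i j)"
    unfolding tmul_def sum_distrib_right by (rule sum.swap)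
  then have "tmul s (\<lambda>i j. \<Sum>\<nu><n. tpow s \<alpha> \<nu> i j) \<alpha> i j = (\<Sum>\<nu><n. tpow s \<alpha> (Suc \<nu>) i j)"
    using assms by (simp add: tpow_commute tpow_Suc)
  moreover have "(\<Sum>\<nu><n. tpow s \<alpha> \<nu> i j) - (\<Sum>\<nu><n. tpow s \<alpha> (Suc \<nu>) i j) = tone i j - tpow s \<alpha> n i j"
    using sum_lessThan_telescope'[of "\<lambda>\<nu>. tpow s \<alpha> \<nu> i j" n] by (simp add: sum_subtractf)
  ultimately show "tmul s (\<lambda>i j. tone i j - \<alpha> i j) (\<lambda>i j. \<Sum>\<nu><n. tpow s \<alpha> \<nu> i j) i j = tone i j - tpow s \<alpha> n i j"
    "tmul s (\<lambda>i j. \<Sum>\<nu><n. tpow s \<alpha> \<nu> i j) (\<lambda>i j. tone i j - \<alpha> i j) i j = tone i j - tpow s \<alpha> n i j"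
    using assms by (simp_all add: l r tmul_tone)
qed

definition telem :: "nat \<Rightarrow> nat \<Rightarrow> 'b::ring_1 \<Rightarrow> nat \<Rightarrow> nat \<Rightarrow> 'b" where
  "telem i j a = (\<lambda>k l. if k = i \<and> l = j then a else tone k l)"

lemma tmul_telem:
  assumes "i \<noteq> j" "i < s" "j < s" "k < s" "l < s"
  shows "tmul s (telem i j a) (telem i j (- a)) k l = tone k l"
proof -
  have "tmul s (telem i j a) (telem i j (- a)) k l =
    (\<Sum>t<s. (if t = k then telem i j (- a) t l else 0) + (if t = j then if k = i then a * telem i j (- a) t l else 0 else 0))"
    unfolding tmul_def using assms by (intro sum.cong) (auto simp: telem_def tone_def)
  also have "\<dots> = tone k l"
    using assms by (auto simp: sum.distrib telem_def tone_def)
  finally show ?thesis .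
qed

definition tgmat :: "'b::ring_1 \<Rightarrow> nat \<Rightarrow> nat \<Rightarrow> 'b" where
  "tgmat a = (\<lambda>k l. if k = 0 \<and> l = 0 then a else tone k l)"

lemma tmul_tgmat:
  assumes "a * b = 1" "k < s" "l < s"
  shows "tmul s (tgmat a) (tgmat b) k l = tone k l"
proof -
  have "tmul s (tgmat a) (tgmat b) k l = (\<Sum>t<s. if t = k then tgmat a k k * tgmat b k l else 0)"
    unfolding tmul_def using assms by (intro sum.cong) (auto simp: tgmat_def tone_def)
  also have "\<dots> = tone k l"
    using assms by (auto simp: tgmat_def tone_def)
  finally show ?thesis .
qed

lemma single_inverse:
  fixes g :: "'g::group_add"
  shows "Poly_Mapping.single g (1::int) * Poly_Mapping.single (- g) 1 = 1"
    "Poly_Mapping.single (- g) (1::int) * Poly_Mapping.single g 1 = 1"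
  by (simp_all add: mult_single)

context padic
begin

subsection \<open>Matrices over the completed group ring\<close>

lemma c0_ring_simps [simp]:
  "rcar (c0_ring p) = c0Zp p" "rzero (c0_ring p) = c0_zero p" "rone (c0_ring p) = c0_one p"
  "radd (c0_ring p) = c0_add p" "rmul (c0_ring p) = c0_mul p"
  by (simp_all add: c0_ring_def)

sublocale c0: unital_rops "c0_ring p :: ('g::group_add c0) rops"
  by unfold_locales (simp_all add: c0_units)

abbreviation CR :: "('h::group_add c0) rops" where
  "CR \<equiv> c0_ring p"

definition mcong :: "nat \<Rightarrow> nat \<Rightarrow> (nat \<Rightarrow> nat \<Rightarrow> 'g \<Rightarrow>\<^sub>0 int) \<Rightarrow> (nat \<Rightarrow> nat \<Rightarrow> 'g \<Rightarrow>\<^sub>0 int) \<Rightarrow> bool" where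
  "mcong m s \<alpha> \<beta> \<longleftrightarrow> (\<forall>i<s. \<forall>j<s. zcong m (\<alpha> i j) (\<beta> i j))"

definition mapx :: "nat \<Rightarrow> nat \<Rightarrow> (nat \<Rightarrow> nat \<Rightarrow> 'g c0) \<Rightarrow> (nat \<Rightarrow> nat \<Rightarrow> 'g \<Rightarrow>\<^sub>0 int) \<Rightarrow> bool" where
  "mapx m s A \<alpha> \<longleftrightarrow> (\<forall>i<s. \<forall>j<s. zapx m (A i j) (\<alpha> i j))"

lemma mcong_refl [simp]: "mcong m s \<alpha> \<alpha>"
  by (simp add: mcong_def)

lemma mcong_sym: "mcong m s \<alpha> \<beta> \<Longrightarrow> mcong m s \<beta> \<alpha>"
  unfolding mcong_def using zcong_sym by blast

lemma mcong_trans: "mcong m s \<alpha> \<beta> \<Longrightarrow> mcong m s \<beta> \<gamma> \<Longrightarrow> mcong m s \<alpha> \<gamma>"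
  unfolding mcong_def using zcong_trans by blast

lemma mcong_mono: "mcong n s \<alpha> \<beta> \<Longrightarrow> m \<le> n \<Longrightarrow> mcong m s \<alpha> \<beta>"
  unfolding mcong_def using zcong_mono by blast

lemma mcong_tmul:
  fixes \<alpha> \<beta> :: "nat \<Rightarrow> nat \<Rightarrow> 'g::group_add \<Rightarrow>\<^sub>0 int"
  shows "mcong m s \<alpha> \<alpha>' \<Longrightarrow> mcong m s \<beta> \<beta>' \<Longrightarrow> mcong m s (tmul s \<alpha> \<beta>) (tmul s \<alpha>' \<beta>')"
  unfolding mcong_def tmul_def by (auto intro!: zcong_sum zcong_mult)

lemma mcong_eq: "(\<And>i j. i < s \<Longrightarrow> j < s \<Longrightarrow> \<alpha> i j = \<beta> i j) \<Longrightarrow> mcong m s \<alpha> \<beta>"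
  by (simp add: mcong_def)

lemma mcong_tpow:
  fixes \<alpha> \<beta> :: "nat \<Rightarrow> nat \<Rightarrow> 'g::group_add \<Rightarrow>\<^sub>0 int"
  shows "mcong m s \<alpha> \<beta> \<Longrightarrow> mcong m s (tpow s \<alpha> n) (tpow s \<beta> n)"
  by (induction n) (auto simp: tpow_Suc intro: mcong_tmul)

lemma mapx_unique: "mapx m s A \<alpha> \<Longrightarrow> mapx m s A \<beta> \<Longrightarrow> mcong m s \<alpha> \<beta>"
  unfolding mapx_def mcong_def using zapx_unique by blast

lemma mapx_cong: "mapx m s A \<alpha> \<Longrightarrow> mcong m s \<alpha> \<beta> \<Longrightarrow> mapx m s A \<beta>"
  unfolding mapx_def mcong_def using zapx_cong by blast

lemma mapx_mono: "mapx n s A \<alpha> \<Longrightarrow> m \<le> n \<Longrightarrow> mapx m s A \<alpha>"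
  unfolding mapx_def using zapx_mono by blast

lemma mapx_ex: "A \<in> Mset CR s \<Longrightarrow> \<exists>\<alpha>. mapx m s A \<alpha>"
proof -
  assume "A \<in> Mset CR s"
  then have "A i j \<in> c0Zp p" for i j by (simp add: Mset_def)
  then have "\<forall>i j. \<exists>x. zapx m (A i j) x" using c0Zp_zapx by blast
  then show ?thesis unfolding mapx_def by metis
qed

lemma Mset_eqI:
  assumes "A \<in> Mset CR s" "B \<in> Mset CR s" "\<And>m. \<exists>\<alpha>. mapx m s A \<alpha> \<and> mapx m s B \<alpha>"
  shows "A = B"
proof (rule ext, rule ext)
  fix i j
  show "A i j = B i j"
  proof (cases "i < s \<and> j < s")
    case True
    then show ?thesis using assms(3) by (intro c0_eqI) (meson mapx_def)
  next
    case False
    then show ?thesis using assms by (auto simp: Mset_def fin_id_def not_less)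
  qed
qed

lemma zapx_foldr:
  "(\<And>k. k \<in> set ks \<Longrightarrow> zapx m (g k) (\<gamma> k)) \<Longrightarrow> zapx m (foldr (\<lambda>k acc. c0_add p (g k) acc) ks (c0_zero p)) (\<Sum>k\<leftarrow>ks. \<gamma> k)"
  by (induction ks) (auto intro: zapx_add zapx_zero)

lemma zapx_rsum:
  fixes g :: "nat \<Rightarrow> 'g::group_add c0"
  shows "(\<And>k. k < s \<Longrightarrow> zapx m (g k) (\<gamma> k)) \<Longrightarrow> zapx m (rsum CR g s) (\<Sum>k<s. \<gamma> k)"
  using zapx_foldr[of "[0..<s]" m g \<gamma>]
  by (simp add: rsum_def interv_sum_list_conv_sum_set_nat atLeast0LessThan)

lemma mapx_mmul:
  fixes A B :: "nat \<Rightarrow> nat \<Rightarrow> 'g::group_add c0"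
  assumes A: "A \<in> Mset CR s" and B: "B \<in> Mset CR s"
    and "mapx m s A \<alpha>" "mapx m s B \<beta>"
  shows "mapx m s (mmul CR A B) (tmul s \<alpha> \<beta>)"
  using assms unfolding mapx_def tmul_def
  by (auto simp: c0.mmul_block[OF A B] Mset_def intro!: zapx_rsum zapx_mul)

lemma mapx_idm: "mapx m s (idm CR) tone"
  by (auto simp: mapx_def idm_def tone_def zapx_zero zapx_one)

text \<open>Associativity is inherited from the integral group ring modulo every p^m, so infinite
  p-adic convolutions are never rearranged.\<close>

lemma mmul_assoc:
  fixes A B C :: "nat \<Rightarrow> nat \<Rightarrow> 'g::group_add c0"
  assumes "A \<in> Mset CR s" "B \<in> Mset CR s" "C \<in> Mset CR s"
  shows "mmul CR (mmul CR A B) C = mmul CR A (mmul CR B C)"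
proof (rule Mset_eqI)
  fix m
  obtain \<alpha> \<beta> \<gamma> where "mapx m s A \<alpha>" "mapx m s B \<beta>" "mapx m s C \<gamma>"
    using mapx_ex assms by metis
  then have "mapx m s (mmul CR (mmul CR A B) C) (tmul s (tmul s \<alpha> \<beta>) \<gamma>)"
    "mapx m s (mmul CR A (mmul CR B C)) (tmul s \<alpha> (tmul s \<beta> \<gamma>))"
    using assms by (auto intro!: mapx_mmul c0.mmul_Mset)
  then show "\<exists>\<delta>. mapx m s (mmul CR (mmul CR A B) C) \<delta> \<and>
      mapx m s (mmul CR A (mmul CR B C)) \<delta>"
    by (auto simp: tmul_assoc)
qed (use assms in \<open>auto intro: c0.mmul_Mset\<close>)

lemma mmul_idm:
  fixes A :: "nat \<Rightarrow> nat \<Rightarrow> 'g::group_add c0"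
  assumes A: "A \<in> Mset CR s"
  shows "mmul CR (idm CR) A = A" "mmul CR A (idm CR) = A"
proof -
  have "\<exists>\<alpha>. mapx m s (mmul CR (idm CR) A) \<alpha> \<and> mapx m s A \<alpha>"
    "\<exists>\<alpha>. mapx m s (mmul CR A (idm CR)) \<alpha> \<and> mapx m s A \<alpha>" for m
  proof -
    obtain \<alpha> where \<alpha>: "mapx m s A \<alpha>" using mapx_ex A by metis
    have "mapx m s (mmul CR (idm CR) A) \<alpha>"
      by (rule mapx_cong[OF mapx_mmul[OF _ A mapx_idm \<alpha>]]) (auto intro!: mcong_eq simp: tmul_tone)
    moreover have "mapx m s (mmul CR A (idm CR)) \<alpha>"
      by (rule mapx_cong[OF mapx_mmul[OF A _ \<alpha> mapx_idm]]) (auto intro!: mcong_eq simp: tmul_tone)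
    ultimately show "\<exists>\<alpha>. mapx m s (mmul CR (idm CR) A) \<alpha> \<and> mapx m s A \<alpha>"
      "\<exists>\<alpha>. mapx m s (mmul CR A (idm CR)) \<alpha> \<and> mapx m s A \<alpha>" using \<alpha> by blast+
  qed
  then show "mmul CR (idm CR) A = A" "mmul CR A (idm CR) = A"
    by (auto intro!: Mset_eqI[of _ s] c0.mmul_Mset A)
qed

lemma GLn_iff:
  "A \<in> GLn CR s \<longleftrightarrow> A \<in> Mset CR s \<and>
    (\<exists>B\<in>Mset CR s. mmul CR A B = idm CR \<and> mmul CR B A = idm CR)"
  unfolding GLn_def Mset_def by auto

lemma GLn_mono: "A \<in> GLn CR s \<Longrightarrow> s \<le> t \<Longrightarrow> A \<in> GLn CR t"
  unfolding GLn_iff using Mset_mono by blast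

lemma GLn_mmul:
  fixes A B :: "nat \<Rightarrow> nat \<Rightarrow> 'g::group_add c0"
  assumes "A \<in> GLn CR s" "B \<in> GLn CR s"
  shows "mmul CR A B \<in> GLn CR s"
proof -
  let ?R = "CR :: 'g c0 rops"
  obtain A' B' where A: "A \<in> Mset ?R s" "A' \<in> Mset ?R s" "mmul ?R A A' = idm ?R" "mmul ?R A' A = idm ?R"
    and B: "B \<in> Mset ?R s" "B' \<in> Mset ?R s" "mmul ?R B B' = idm ?R" "mmul ?R B' B = idm ?R"
    using assms unfolding GLn_iff by auto
  have "mmul ?R B (mmul ?R B' A') = A'" "mmul ?R A' (mmul ?R A B) = B"
    using A B mmul_assoc[of B s B' A'] mmul_assoc[of A' s A B] mmul_idm(1)[of A' s] mmul_idm(1)[of B s] by auto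
  then have "mmul ?R (mmul ?R A B) (mmul ?R B' A') = idm ?R" "mmul ?R (mmul ?R B' A') (mmul ?R A B) = idm ?R"
    using A B mmul_assoc[of A s B "mmul ?R B' A'"] mmul_assoc[of B' s A' "mmul ?R A B"]
    by (auto simp: c0.mmul_Mset)
  then show ?thesis
    using A B unfolding GLn_iff by (blast intro: c0.mmul_Mset)
qed

lemma GL_inf_mmul:
  fixes A B :: "nat \<Rightarrow> nat \<Rightarrow> 'g::group_add c0"
  assumes "A \<in> GL_inf CR" "B \<in> GL_inf CR"
  shows "mmul CR A B \<in> GL_inf CR"
proof -
  obtain s t where "A \<in> GLn CR s" "B \<in> GLn CR t" using assms by (auto simp: GL_inf_def)
  then have "A \<in> GLn CR (max s t)" "B \<in> GLn CR (max s t)" by (auto intro: GLn_mono)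
  then show ?thesis unfolding GL_inf_def by (blast intro: GLn_mmul)
qed

lemma idm_GL_inf: "idm (CR :: ('g::group_add c0) rops) \<in> GL_inf CR"
proof -
  have "idm CR \<in> GLn CR 0"
    unfolding GLn_iff using mmul_idm[OF c0.idm_Mset[of 0]] c0.idm_Mset[of 0] by blast
  then show ?thesis unfolding GL_inf_def by blast
qed

lemma mpow_GL_inf:
  fixes A :: "nat \<Rightarrow> nat \<Rightarrow> 'g::group_add c0"
  shows "A \<in> GL_inf CR \<Longrightarrow> mpow CR A n \<in> GL_inf CR"
  by (induction n) (auto simp: mpow_def intro: idm_GL_inf GL_inf_mmul)

text \<open>Entries are determined by their approximants, so a two-sided inverse can be verified
  modulo each p^m separately.\<close>

lemma GLnI:
  fixes A B :: "nat \<Rightarrow> nat \<Rightarrow> 'g::group_add c0"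
  assumes A: "A \<in> Mset CR s" and B: "B \<in> Mset CR s"
    and ex: "\<And>m. \<exists>\<alpha> \<beta>. mapx m s A \<alpha> \<and> mapx m s B \<beta> \<and> mcong m s (tmul s \<alpha> \<beta>) tone \<and> mcong m s (tmul s \<beta> \<alpha>) tone"
  shows "A \<in> GLn CR s"
proof -
  have "\<exists>\<gamma>. mapx m s (mmul CR A B) \<gamma> \<and> mapx m s (idm CR) \<gamma>"
    "\<exists>\<gamma>. mapx m s (mmul CR B A) \<gamma> \<and> mapx m s (idm CR) \<gamma>" for m
    using ex[of m] mapx_mmul[OF A B] mapx_mmul[OF B A] mapx_idm mapx_cong by blast+
  then have "mmul CR A B = idm CR" "mmul CR B A = idm CR"
    using A B by (auto intro!: Mset_eqI[of _ s] c0.mmul_Mset)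
  then show ?thesis using A B by (auto simp: GLn_iff)
qed

lemma mapx_elem: "zapx m a \<alpha> \<Longrightarrow> mapx m s (Defs.elem CR i j a) (telem i j \<alpha>)"
  by (auto simp: mapx_def Defs.elem_def telem_def idm_def tone_def zapx_zero zapx_one)

lemma elem_Mset:
  assumes "a \<in> c0Zp p" "i < s" "j < s"
  shows "Defs.elem CR i j a \<in> Mset CR s"
  using assms by (auto simp: Mset_def fin_id_def Defs.elem_def idm_def)

lemma elem_GLn:
  fixes a :: "'g::group_add c0"
  assumes a: "a \<in> c0Zp p" and ij: "i \<noteq> j" "i < s" "j < s"
  shows "Defs.elem CR i j a \<in> GLn CR s"
proof (rule GLnI[of _ _ "Defs.elem CR i j (c0_neg p a)"])
  fix m
  obtain \<alpha> where \<alpha>: "zapx m a \<alpha>" using c0Zp_zapx[OF a] by blast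
  show "\<exists>\<alpha> \<beta>. mapx m s (Defs.elem CR i j a) \<alpha> \<and> mapx m s (Defs.elem CR i j (c0_neg p a)) \<beta> \<and>
      mcong m s (tmul s \<alpha> \<beta>) tone \<and> mcong m s (tmul s \<beta> \<alpha>) tone"
    using mapx_elem[OF \<alpha>] mapx_elem[OF zapx_neg[OF \<alpha>]] tmul_telem[OF ij, of _ _ \<alpha>] tmul_telem[OF ij, of _ _ "- \<alpha>"]
    by (intro exI[of _ "telem i j \<alpha>"] exI[of _ "telem i j (- \<alpha>)"]) (auto intro!: mcong_eq)
qed (use a ij in \<open>auto intro: elem_Mset\<close>)

lemma mapx_gmat: "zapx m a \<alpha> \<Longrightarrow> mapx m s (gmat CR a) (tgmat \<alpha>)"
  by (auto simp: mapx_def gmat_def tgmat_def idm_def tone_def zapx_zero zapx_one)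

lemma gmat_Mset: "a \<in> c0Zp p \<Longrightarrow> 0 < s \<Longrightarrow> gmat CR a \<in> Mset CR s"
  by (auto simp: Mset_def fin_id_def gmat_def idm_def)

lemma gmat_GLn:
  fixes g :: "'g::group_add"
  assumes "0 < s"
  shows "gmat CR (c0_grp p g) \<in> GLn CR s"
proof (rule GLnI[of _ _ "gmat CR (c0_grp p (- g))"])
  fix m
  show "\<exists>\<alpha> \<beta>. mapx m s (gmat CR (c0_grp p g)) \<alpha> \<and> mapx m s (gmat CR (c0_grp p (- g))) \<beta> \<and>
      mcong m s (tmul s \<alpha> \<beta>) tone \<and> mcong m s (tmul s \<beta> \<alpha>) tone"
    using mapx_gmat[OF zapx_grp] tmul_tgmat[OF single_inverse(1)] tmul_tgmat[OF single_inverse(2)]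
    by (intro exI[of _ "tgmat (Poly_Mapping.single g 1)"] exI[of _ "tgmat (Poly_Mapping.single (- g) 1)"])
      (auto intro!: mcong_eq)
qed (use assms in \<open>auto intro: gmat_Mset\<close>)

section \<open>Invertibility of the matrices in 1 + pM_s\<close>

lemma zcong_mult_zero:
  fixes \<alpha> \<beta> :: "'g::group_add \<Rightarrow>\<^sub>0 int"
  assumes "zcong m \<alpha> 0" "zcong n \<beta> 0"
  shows "zcong (m + n) (\<alpha> * \<beta>) 0"
  using assms unfolding zcong_def
  by (auto simp: lookup_mult_group[of "keys \<alpha>" \<alpha>] power_add intro!: dvd_sum mult_dvd_mono)

lemma zcong_tpow_zero:
  fixes \<alpha> :: "nat \<Rightarrow> nat \<Rightarrow> 'g::group_add \<Rightarrow>\<^sub>0 int"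
  assumes "mcong 1 s \<alpha> (\<lambda>_ _. 0)"
  shows "mcong n s (tpow s \<alpha> n) (\<lambda>_ _. 0)"
proof (induction n)
  case 0 then show ?case by (simp add: mcong_def zcong_def)
next
  case (Suc n)
  show ?case unfolding mcong_def
  proof (intro allI impI)
    fix i j assume ij: "i < s" "j < s"
    have "zcong (1 + n) (\<alpha> i k * tpow s \<alpha> n k j) 0" if "k < s" for k
      using assms Suc ij that by (intro zcong_mult_zero) (auto simp: mcong_def)
    then have "zcong (1 + n) (\<Sum>k<s. \<alpha> i k * tpow s \<alpha> n k j) (\<Sum>k<s. 0)"
      by (intro zcong_sum) auto
    then show "zcong (Suc n) (tpow s \<alpha> (Suc n) i j) 0" by (simp add: tpow_Suc tmul_def)
  qed
qed

lemma one_plus_pM_Mset: "u \<in> one_plus_pM p s \<Longrightarrow> u \<in> Mset CR s"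
  by (simp add: one_plus_pM_def Mset_def)

lemma one_plus_pM_mcong:
  fixes u :: "nat \<Rightarrow> nat \<Rightarrow> 'g::group_add c0"
  assumes u: "u \<in> one_plus_pM p s" and U: "mapx m s u \<alpha>" and m: "1 \<le> m"
  shows "mcong 1 s (\<lambda>i j. tone i j - \<alpha> i j) (\<lambda>_ _. 0)"
  unfolding mcong_def
proof (intro allI impI)
  fix i j assume ij: "i < s" "j < s"
  let ?d = "c0_add p (u i j) (c0_neg p (idm CR i j))"
  have "zapx 1 (u i j) (\<alpha> i j)" using U ij zapx_mono[OF _ m] by (auto simp: mapx_def)
  moreover have "zapx 1 (idm CR i j) (tone i j :: 'g \<Rightarrow>\<^sub>0 int)" using mapx_idm ij by (auto simp: mapx_def)
  ultimately have "zapx 1 ?d (\<alpha> i j + - tone i j)" by (intro zapx_add zapx_neg)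
  moreover have "capx (?d g) 0 (pe 1)" for g
  proof -
    have "?d g \<in> Qp p" using \<open>zapx 1 ?d _\<close> capx_Qp unfolding zapx_def by blast
    moreover have "qp_norm p (?d g) \<le> pe 1" using u by (simp add: one_plus_pM_def pe_def)
    ultimately show ?thesis using qp_norm_le_iff[of "?d g" "pe 1"] by simp
  qed
  then have "zapx 1 ?d 0" by (simp add: zapx_def)
  ultimately have "zcong 1 (\<alpha> i j + - tone i j) 0" by (rule zapx_unique)
  from zcong_minus[OF this] show "zcong 1 (tone i j - \<alpha> i j) 0" by simp
qed

text \<open>The inverse is the limit of the truncated Neumann series.\<close>
lemma one_plus_pM_GLn:
  fixes u :: "nat \<Rightarrow> nat \<Rightarrow> 'g::group_add c0"
  assumes u: "u \<in> one_plus_pM p s"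
  shows "u \<in> GLn CR s"
proof -
  note uM = one_plus_pM_Mset[OF u]
  obtain U where U: "\<And>m. mapx m s u (U m)" using mapx_ex[OF uM] by metis
  define X where "X = (\<lambda>m i j. tone i j - U m i j)"
  define V where "V = (\<lambda>m i j. \<Sum>\<nu><m. tpow s (X m) \<nu> i j)"
  have X0: "mcong m s (tpow s (X m) m) (\<lambda>_ _. 0)" for m
  proof (cases "m = 0")
    case True then show ?thesis by (simp add: mcong_def zcong_def)
  next
    case False
    then show ?thesis using one_plus_pM_mcong[OF u U, of m] unfolding X_def
      by (intro zcong_tpow_zero) simp
  qed
  have one: "mcong m s (\<lambda>i j. tone i j - tpow s (X m) m i j) tone" for m
    using X0[of m] unfolding mcong_def zcong_def by (auto simp: lookup_minus)
  have UX: "U m = (\<lambda>i j. tone i j - X m i j)" for m by (simp add: X_def)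
  have UV: "mcong m s (tmul s (U m) (V m)) tone" for m
    unfolding UX V_def
    by (rule mcong_trans[OF mcong_eq one]) (auto simp: geometric_sum_tpow)
  have VU: "mcong m s (tmul s (V m) (U m)) tone" for m
    unfolding UX V_def
    by (rule mcong_trans[OF mcong_eq one]) (auto simp: geometric_sum_tpow)
  \<comment> \<open>Both are inverses of the same matrix modulo p^m, and inverses are unique:
    \<open>V m\<close> times \<open>U m\<close> is inserted in front of \<open>V n\<close>.\<close>
  have V: "mcong m s (V n) (V m)" if mn: "m \<le> n" for m n
  proof -
    note [trans] = mcong_trans
    have "mcong m s (V n) (tmul s tone (V n))" by (auto intro!: mcong_eq simp: tmul_tone)
    also have "mcong m s (tmul s tone (V n)) (tmul s (tmul s (V m) (U m)) (V n))"
      by (intro mcong_tmul mcong_sym[OF VU]) auto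
    also have "tmul s (tmul s (V m) (U m)) (V n) = tmul s (V m) (tmul s (U m) (V n))" by (rule tmul_assoc)
    also have "mcong m s \<dots> (tmul s (V m) (tmul s (U n) (V n)))"
      using mapx_unique[OF U mapx_mono[OF U mn]] by (intro mcong_tmul) auto
    also have "mcong m s \<dots> (tmul s (V m) tone)"
      using mcong_mono[OF UV mn] by (intro mcong_tmul) auto
    also have "mcong m s \<dots> (V m)" by (auto intro!: mcong_eq simp: tmul_tone)
    finally show ?thesis .
  qed
  have "\<exists>b\<in>c0Zp p. \<forall>m. zapx m b (V m i j)" if "i < s" "j < s" for i j
    using V that by (intro zapx_limit) (auto simp: mcong_def)
  then obtain b where b: "\<And>i j. i < s \<Longrightarrow> j < s \<Longrightarrow> b i j \<in> c0Zp p \<and> (\<forall>m. zapx m (b i j) (V m i j))" by metis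
  define v where "v = (\<lambda>i j. if i < s \<and> j < s then b i j else idm CR i j)"
  have v: "v \<in> Mset CR s" using b c0.idm_closed by (auto simp: v_def Mset_def fin_id_def)
  have vV: "mapx m s v (V m)" for m using b by (auto simp: mapx_def v_def)
  show ?thesis by (rule GLnI[OF uM v]) (use U vV UV VU in blast)
qed

subsection \<open>Reduction modulo p\<close>

text \<open>The residues are read off an integral approximant modulo p; by \<open>red_eq\<close>
  every approximant gives the same ones. Taking them in the interval from 0 to p - 1 matches the
  carrier of \<open>fpG\<close>.\<close>

definition red :: "'g c0 \<Rightarrow> 'g \<Rightarrow> int" where
  "red a = (\<lambda>g. lookup (SOME \<alpha>. zapx 1 a \<alpha>) g mod int p)"

lemma red_eq: "zapx 1 a \<alpha> \<Longrightarrow> red a = (\<lambda>g. lookup \<alpha> g mod int p)"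
proof
  fix g assume a: "zapx 1 a \<alpha>"
  then have "zapx 1 a (SOME \<alpha>. zapx 1 a \<alpha>)" by (rule someI)
  then have "zcong 1 (SOME \<alpha>. zapx 1 a \<alpha>) \<alpha>" using a by (rule zapx_unique)
  then show "red a g = lookup \<alpha> g mod int p"
    by (simp add: red_def zcong_def mod_eq_dvd_iff)
qed

lemma fpG_simps [simp]:
  "rcar (fpG p :: ('g::group_add \<Rightarrow> int) rops) = {a. finite {g. a g \<noteq> 0} \<and> (\<forall>g. 0 \<le> a g \<and> a g < int p)}"
  "rzero (fpG p :: ('g \<Rightarrow> int) rops) = (\<lambda>_. 0)"
  "rone (fpG p :: ('g \<Rightarrow> int) rops) = (\<lambda>g. if g = 0 then 1 else 0)"
  "radd (fpG p :: ('g \<Rightarrow> int) rops) = (\<lambda>a b g. (a g + b g) mod int p)"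
  "rmul (fpG p :: ('g \<Rightarrow> int) rops) = (\<lambda>a b g. (\<Sum>d\<in>{d. a d \<noteq> 0}. a d * b (- d + g)) mod int p)"
  by (simp_all add: fpG_def)

lemma red_closed:
  assumes "a \<in> c0Zp p" shows "red a \<in> rcar (fpG p :: ('g::group_add \<Rightarrow> int) rops)"
proof -
  obtain \<alpha> where "zapx 1 a \<alpha>" using c0Zp_zapx[OF assms] by blast
  moreover have "finite {g. lookup \<alpha> g mod int p \<noteq> 0}"
    by (rule finite_subset[of _ "keys \<alpha>"]) (auto simp: in_keys_iff)
  ultimately show ?thesis using p_pos by (simp add: red_eq)
qed

lemma red_zero: "red (c0_zero p) = (\<lambda>_. 0)"
  by (simp add: red_eq[OF zapx_zero])

lemma red_grp: "red (c0_grp p h) = fp_grp p h"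
  using p_ge_2 by (auto simp: red_eq[OF zapx_grp] fp_grp_def lookup_single when_def)

lemma red_one: "red (c0_one p) = (\<lambda>g. if g = 0 then 1 else 0)"
  using p_ge_2 by (auto simp: red_eq[OF zapx_one] lookup_one when_def)

lemma red_add:
  assumes "a \<in> c0Zp p" "b \<in> c0Zp p"
  shows "red (c0_add p a b) = (\<lambda>g. (red a g + red b g) mod int p)"
proof -
  obtain \<alpha> \<beta> where ab: "zapx 1 a \<alpha>" "zapx 1 b \<beta>" using c0Zp_zapx assms by metis
  show ?thesis
    by (simp add: red_eq[OF zapx_add[OF ab]] red_eq[OF ab(1)] red_eq[OF ab(2)] lookup_add mod_add_eq)
qed

lemma red_mul:
  fixes a b :: "'g::group_add c0"
  assumes "a \<in> c0Zp p" "b \<in> c0Zp p"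
  shows "red (c0_mul p a b) = (\<lambda>g. (\<Sum>d\<in>{d. red a d \<noteq> 0}. red a d * red b (- d + g)) mod int p)"
proof
  fix g
  obtain \<alpha> \<beta> where ab: "zapx 1 a \<alpha>" "zapx 1 b \<beta>" using c0Zp_zapx assms by metis
  have "(\<Sum>d\<in>{d. red a d \<noteq> 0}. red a d * red b (- d + g)) = (\<Sum>d\<in>keys \<alpha>. red a d * red b (- d + g))"
    by (intro sum.mono_neutral_left) (auto simp: red_eq[OF ab(1)] in_keys_iff)
  also have "[\<dots> = (\<Sum>d\<in>keys \<alpha>. lookup \<alpha> d * lookup \<beta> (- d + g))] (mod int p)"
    by (intro cong_sum cong_mult) (auto simp: red_eq[OF ab(1)] red_eq[OF ab(2)] cong_def)
  also have "(\<Sum>d\<in>keys \<alpha>. lookup \<alpha> d * lookup \<beta> (- d + g)) = lookup (\<alpha> * \<beta>) g"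
    by (simp add: lookup_mult_group[of "keys \<alpha>"])
  finally show "red (c0_mul p a b) g = (\<Sum>d\<in>{d. red a d \<noteq> 0}. red a d * red b (- d + g)) mod int p"
    by (simp add: red_eq[OF zapx_mul[OF assms ab]] cong_def)
qed

lemma red_surj:
  assumes "x \<in> rcar (fpG p :: ('g::group_add \<Rightarrow> int) rops)"
  obtains a where "a \<in> c0Zp p" "red a = x"
proof -
  define \<alpha> where "\<alpha> = Abs_poly_mapping x"
  have l: "lookup \<alpha> g = x g" for g using assms by (simp add: \<alpha>_def)
  have z: "zapx m (\<lambda>g. qp_const p (of_int (x g))) \<alpha>" for m
    by (simp add: zapx_def l capx_const)
  show ?thesis
  proof (rule that)
    show "(\<lambda>g. qp_const p (of_int (x g))) \<in> c0Zp p" using z c0ZpI by blast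
    show "red (\<lambda>g. qp_const p (of_int (x g))) = x"
      using assms by (auto simp: red_eq[OF z] l)
  qed
qed

lemma red_hom:
  fixes a b :: "'g::group_add c0"
  assumes "a \<in> c0Zp p" "b \<in> c0Zp p"
  shows "red (c0_add p a b) = radd (fpG p) (red a) (red b)" "red (c0_mul p a b) = rmul (fpG p) (red a) (red b)"
  using assms by (simp_all add: red_add red_mul)

lemma red_hom01:
  "red (c0_zero p :: 'g::group_add c0) = rzero (fpG p)" "red (c0_one p :: 'g c0) = rone (fpG p)"
  by (simp_all add: red_zero red_one)

text \<open>Since \<open>red\<close> is surjective and respects both operations, the laws of F_p
  Gamma are images of those of c_0(Gamma, Z_p).\<close>

sublocale fp: unital_rops "fpG p :: ('g::group_add \<Rightarrow> int) rops"
proof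
  let ?F = "fpG p :: ('g \<Rightarrow> int) rops"
  show "rzero ?F \<in> rcar ?F" "rone ?F \<in> rcar ?F"
    using red_closed[OF c0_zero_Zp] red_closed[OF c0_one_Zp] by (simp_all only: red_hom01)
  fix x assume "x \<in> rcar ?F"
  then obtain a where a: "a \<in> c0Zp p" "x = red a" using red_surj by metis
  show "radd ?F x (rzero ?F) = x" "radd ?F (rzero ?F) x = x" "rmul ?F x (rzero ?F) = rzero ?F"
    "rmul ?F (rzero ?F) x = rzero ?F" "rmul ?F x (rone ?F) = x" "rmul ?F (rone ?F) x = x"
    using a(1) unfolding a(2) red_hom01[symmetric]
    by (simp_all only: red_hom[symmetric] c0_zero_Zp c0_one_Zp c0_units)
  fix y assume "y \<in> rcar ?F"
  then obtain b where b: "b \<in> c0Zp p" "y = red b" using red_surj by metis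
  show "radd ?F x y \<in> rcar ?F" "rmul ?F x y \<in> rcar ?F"
    using a(1) b(1) unfolding a(2) b(2)
    by (simp_all only: red_hom[symmetric] red_closed c0_add_Zp c0_mul_Zp)
qed

definition redm :: "(nat \<Rightarrow> nat \<Rightarrow> 'g c0) \<Rightarrow> nat \<Rightarrow> nat \<Rightarrow> 'g \<Rightarrow> int" where
  "redm A = (\<lambda>i j. red (A i j))"

lemma red_idm: "red (idm CR i j) = idm (fpG p) i (j :: nat)"
  by (simp add: idm_def red_zero red_one)

lemma redm_idm: "redm (idm (CR :: ('g::group_add c0) rops)) = idm (fpG p)"
  by (intro ext) (simp add: redm_def idm_def red_zero red_one)

lemma redm_Mset:
  fixes A :: "nat \<Rightarrow> nat \<Rightarrow> 'g::group_add c0"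
  assumes "A \<in> Mset CR s" shows "redm A \<in> Mset (fpG p) s"
proof -
  have "redm A i j \<in> rcar (fpG p)" for i j
    unfolding redm_def using assms by (intro red_closed) (simp add: Mset_def)
  moreover have "redm A i j = idm (fpG p) i j" if "s \<le> i \<or> s \<le> j" for i j
    using assms that by (auto simp: Mset_def fin_id_def redm_def red_idm simp del: fpG_simps)
  ultimately show ?thesis by (simp only: Mset_def fin_id_def mem_Collect_eq) blast
qed

lemma red_rsum:
  fixes g :: "nat \<Rightarrow> 'g::group_add c0"
  assumes "\<And>k. k < s \<Longrightarrow> g k \<in> c0Zp p"
  shows "red (rsum CR g s) = rsum (fpG p) (\<lambda>k. red (g k)) s"
proof -
  have "red (foldr (\<lambda>k acc. radd CR (g k) acc) ks (rzero CR))
      = foldr (\<lambda>k acc. radd (fpG p) (red (g k)) acc) ks (rzero (fpG p))"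
    if "\<And>k. k \<in> set ks \<Longrightarrow> g k \<in> c0Zp p" for ks
    using that
  proof (induction ks)
    case (Cons k ks)
    have "foldr (\<lambda>k acc. radd CR (g k) acc) ks (rzero CR) \<in> rcar CR"
      using Cons by (intro c0.foldr_closed) auto
    then show ?case using Cons by (simp add: red_add)
  qed (simp add: red_zero)
  from this[of "[0..<s]"] show ?thesis
    using assms unfolding rsum_def by (simp del: fpG_simps c0_ring_simps)
qed

lemma redm_mmul:
  fixes A B :: "nat \<Rightarrow> nat \<Rightarrow> 'g::group_add c0"
  assumes A: "A \<in> Mset CR s" and B: "B \<in> Mset CR s"
  shows "redm (mmul CR A B) = mmul (fpG p) (redm A) (redm B)"
proof (rule ext, rule ext)
  fix i j
  have c: "A i k \<in> c0Zp p" "B k j \<in> c0Zp p" for k using A B by (auto simp: Mset_def)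
  show "redm (mmul CR A B) i j = mmul (fpG p) (redm A) (redm B) i j"
  proof (cases "i < s \<and> j < s")
    case True
    have "redm (mmul CR A B) i j = red (rsum CR (\<lambda>k. c0_mul p (A i k) (B k j)) s)"
      using True by (simp add: redm_def c0.mmul_block[OF A B])
    also have "\<dots> = rsum (fpG p) (\<lambda>k. rmul (fpG p) (red (A i k)) (red (B k j))) s"
      using c by (simp only: red_rsum c0_mul_Zp red_hom)
    finally show ?thesis
      using True fp.mmul_block[OF redm_Mset[OF A] redm_Mset[OF B], of i j]
      by (simp add: redm_def del: fpG_simps)
  next
    case False
    then show ?thesis
      unfolding fp.mmul_block[OF redm_Mset[OF A] redm_Mset[OF B]] redm_def[of "mmul _ _ _"] c0.mmul_block[OF A B]
      by (simp only: False if_False red_idm)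
  qed
qed

lemma mpow_Mset:
  fixes A :: "nat \<Rightarrow> nat \<Rightarrow> 'g::group_add c0"
  shows "A \<in> Mset CR s \<Longrightarrow> mpow CR A n \<in> Mset CR s"
  by (induction n) (auto simp: mpow_def intro: c0.mmul_Mset)

lemma redm_mpow:
  fixes A :: "nat \<Rightarrow> nat \<Rightarrow> 'g::group_add c0"
  assumes A: "A \<in> Mset CR s"
  shows "redm (mpow CR A n) = mpow (fpG p) (redm A) n"
proof (induction n)
  case (Suc n)
  have "redm (mmul CR A (mpow CR A n)) = mmul (fpG p) (redm A) (redm (mpow CR A n))"
    by (rule redm_mmul[OF A mpow_Mset[OF A]])
  then show ?case using Suc by (simp add: mpow_def)
qed (simp add: mpow_def redm_idm)

lemma redm_GL_inf:
  fixes A :: "nat \<Rightarrow> nat \<Rightarrow> 'g::group_add c0"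
  assumes "A \<in> GL_inf CR"
  shows "redm A \<in> GL_inf (fpG p)"
proof -
  obtain s where "A \<in> GLn CR s" using assms by (auto simp: GL_inf_def)
  then obtain B where A: "A \<in> Mset CR s" and B: "B \<in> Mset CR s"
    and AB: "mmul CR A B = idm CR" "mmul CR B A = idm CR"
    unfolding GLn_iff by auto
  have "mmul (fpG p) (redm A) (redm B) = idm (fpG p)" "mmul (fpG p) (redm B) (redm A) = idm (fpG p)"
    using redm_mmul[OF A B] redm_mmul[OF B A] AB redm_idm[where 'g = 'g] by simp_all
  then have "redm A \<in> GLn (fpG p) s"
    using redm_Mset[OF A] redm_Mset[OF B] unfolding GLn_def Mset_def by blast
  then show ?thesis by (auto simp: GL_inf_def)
qed

section \<open>Lifting from F_p Gamma and the decomposition of a power\<close>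

lemma EG_gen_GL_inf:
  assumes "X \<in> EG_gen (CR :: ('g::group_add c0) rops) (range (c0_grp p))"
  shows "X \<in> GL_inf CR"
  using assms
proof induction
  case id then show ?case by (rule idm_GL_inf)
next
  case (el X i j a)
  have "Defs.elem CR i j a \<in> GLn CR (Suc (max i j))"
    using el by (intro elem_GLn) auto
  then show ?case using el by (intro GL_inf_mmul) (auto simp: GL_inf_def)
next
  case (gr X g)
  then obtain h where h: "g = c0_grp p h" by blast
  have "gmat CR (c0_grp p h) \<in> GLn CR 1" by (rule gmat_GLn) simp
  then show ?case using gr h by (intro GL_inf_mmul) (auto simp: GL_inf_def)
qed

lemma GL_inf_Mset:
  fixes A :: "nat \<Rightarrow> nat \<Rightarrow> 'g::group_add c0"
  shows "A \<in> GL_inf CR \<Longrightarrow> \<exists>s. A \<in> Mset CR s"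
  by (auto simp: GL_inf_def GLn_iff)

lemma Mset_common:
  assumes "A \<in> Mset R s" "B \<in> Mset R t"
  shows "A \<in> Mset R (max s t)" "B \<in> Mset R (max s t)"
  using assms by (auto intro: Mset_mono)

text \<open>Generators lift one by one: an elementary matrix by lifting its entry, a group element
  to itself. Reduction is multiplicative, so products lift as well.\<close>

lemma EG_gen_lift:
  assumes "X \<in> EG_gen (fpG p :: ('g::group_add \<Rightarrow> int) rops) (range (fp_grp p))"
  shows "\<exists>W \<in> EG_gen (CR :: ('g c0) rops) (range (c0_grp p)). redm W = X"
  using assms
proof induction
  case id
  show ?case using redm_idm EG_gen.id by blast
next
  case (el X i j a)
  then obtain W where W: "W \<in> EG_gen CR (range (c0_grp p))" "redm W = X" by blast
  obtain b where b: "b \<in> c0Zp p" "red b = a" using red_surj el(3) by blast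
  obtain s where s: "W \<in> Mset CR s" using GL_inf_Mset[OF EG_gen_GL_inf[OF W(1)]] by blast
  have e: "Defs.elem CR i j b \<in> Mset CR (Suc (max i j))"
    using b by (intro elem_Mset) auto
  have "redm (Defs.elem CR i j b) = Defs.elem (fpG p) i j a"
    using redm_idm[where 'g = 'g] b(2) by (auto simp: redm_def Defs.elem_def fun_eq_iff)
  then have "redm (mmul CR (Defs.elem CR i j b) W) = mmul (fpG p) (Defs.elem (fpG p) i j a) X"
    using redm_mmul[OF Mset_common[OF e s]] W(2) by simp
  moreover have "mmul CR (Defs.elem CR i j b) W \<in> EG_gen CR (range (c0_grp p))"
    using W(1) el(2) b(1) by (intro EG_gen.el) auto
  ultimately show ?case by blast
next
  case (gr X g)
  then obtain W where W: "W \<in> EG_gen CR (range (c0_grp p))" "redm W = X" by blast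
  obtain h where h: "g = fp_grp p h" using gr(2) by blast
  obtain s where s: "W \<in> Mset CR s" using GL_inf_Mset[OF EG_gen_GL_inf[OF W(1)]] by blast
  have e: "gmat CR (c0_grp p h) \<in> Mset CR 1"
    by (intro gmat_Mset) auto
  have "redm (gmat CR (c0_grp p h)) = gmat (fpG p) g"
    using redm_idm[where 'g = 'g] h by (auto simp: redm_def gmat_def fun_eq_iff red_grp)
  then have "redm (mmul CR (gmat CR (c0_grp p h)) W) = mmul (fpG p) (gmat (fpG p) g) X"
    using redm_mmul[OF Mset_common[OF e s]] W(2) by simp
  moreover have "mmul CR (gmat CR (c0_grp p h)) W \<in> EG_gen CR (range (c0_grp p))"
    using W(1) by (intro EG_gen.gr) auto
  ultimately show ?case by blast
qed

text \<open>The kernel of reduction modulo p consists of the matrices congruent to 1 modulo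
  p.\<close>

lemma one_plus_pM_of_redm:
  fixes u :: "nat \<Rightarrow> nat \<Rightarrow> 'g::group_add c0"
  assumes u: "u \<in> Mset CR s" and r: "redm u = idm (fpG p)"
  shows "u \<in> one_plus_pM p s"
proof -
  have "qp_norm p (c0_add p (u i j) (c0_neg p (idm CR i j)) g) \<le> pe 1" for i j and g :: 'g
  proof -
    have "u i j \<in> c0Zp p" "idm CR i j \<in> c0Zp p"
      using u c0.idm_closed[of i j] by (auto simp: Mset_def)
    then obtain \<alpha> \<beta> :: "'g \<Rightarrow>\<^sub>0 int" where ab: "zapx 1 (u i j) \<alpha>" "zapx 1 (idm CR i j) \<beta>" using c0Zp_zapx by metis
    have "red (u i j) = red (idm CR i j)"
      using r redm_idm[where 'g = 'g] unfolding redm_def by metis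
    then have "lookup \<alpha> g mod int p = lookup \<beta> g mod int p"
      unfolding red_eq[OF ab(1)] red_eq[OF ab(2)] by meson
    then have "int p ^ 1 dvd lookup \<alpha> g - lookup \<beta> g" by (simp add: mod_eq_dvd_iff)
    then have "rnorm p (of_int (lookup \<alpha> g) - of_int (lookup \<beta> g)) \<le> pe 1"
      by (simp only: rnorm_of_int_le_iff of_int_diff[symmetric])
    with ab(1)[unfolded zapx_def, rule_format] have "capx (u i j g) (of_int (lookup \<beta> g)) (pe 1)"
      by (rule capx_shift)
    moreover have "capx (idm CR i j g) (of_int (lookup \<beta> g)) (pe 1)"
      by (rule ab(2)[unfolded zapx_def, rule_format])
    ultimately have "qp_norm p (qp_add p (u i j g) (qp_neg p (idm CR i j g))) \<le> pe 1"
      by (rule qp_norm_diff_leI) (rule pe_pos)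
    then show ?thesis by (simp only: c0_add_def c0_neg_def)
  qed
  then show ?thesis using u by (simp add: one_plus_pM_def Mset_def pe_def)
qed

text \<open>A power of the reduction of A is a product of generators over F_p Gamma. If W lifts this
  product, the inverse of W times the same power of A reduces to the identity and is the factor
  u.\<close>

lemma Wh_torsion_decomposition:
  fixes A :: "nat \<Rightarrow> nat \<Rightarrow> 'g::group_add c0"
  assumes Wh: "Wh_torsion p TYPE('g)" and A: "A \<in> GL_inf CR"
  shows "\<exists>n>0. \<exists>W s u. W \<in> EG_gen CR (range (c0_grp p)) \<and> u \<in> one_plus_pM p s \<and>
    mpow CR A n = mmul CR W u"
proof -
  let ?R = "CR :: 'g c0 rops"
  obtain n where n: "n > 0" "mpow (fpG p) (redm A) n \<in> EG_gen (fpG p) (range (fp_grp p))"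
    using Wh redm_GL_inf[OF A] unfolding Wh_torsion_def by blast
  obtain W where W: "W \<in> EG_gen ?R (range (c0_grp p))" "redm W = mpow (fpG p) (redm A) n"
    using EG_gen_lift[OF n(2)] by blast
  obtain s0 where A0: "A \<in> Mset ?R s0" using GL_inf_Mset[OF A] by blast
  obtain t where Wt: "W \<in> GLn ?R t" using EG_gen_GL_inf[OF W(1)] by (auto simp: GL_inf_def)
  define s where "s = max s0 t"
  have As: "A \<in> Mset ?R s" using A0 by (auto simp: s_def intro: Mset_mono)
  obtain V where V: "W \<in> Mset ?R s" "V \<in> Mset ?R s" "mmul ?R W V = idm ?R" "mmul ?R V W = idm ?R"
    using GLn_mono[OF Wt, of s] by (auto simp: GLn_iff s_def)
  define B where "B = mpow ?R A n"
  have B: "B \<in> Mset ?R s" unfolding B_def by (rule mpow_Mset[OF As])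
  define u where "u = mmul ?R V B"
  have u: "u \<in> Mset ?R s" unfolding u_def by (rule c0.mmul_Mset[OF V(2) B])
  have "mmul ?R W u = B"
    unfolding u_def using mmul_assoc[OF V(1,2) B] V(3) mmul_idm(1)[OF B] by simp
  moreover have "redm B = redm W" using redm_mpow[OF As, of n] W(2) by (simp add: B_def)
  then have "redm u = redm (mmul ?R V W)"
    unfolding u_def redm_mmul[OF V(2) B] redm_mmul[OF V(2,1)] by simp
  then have "u \<in> one_plus_pM p s" using u V(4) redm_idm[where 'g = 'g] by (intro one_plus_pM_of_redm) auto
  ultimately have "W \<in> EG_gen ?R (range (c0_grp p)) \<and> u \<in> one_plus_pM p s \<and> mpow ?R A n = mmul ?R W u"
    using W(1) unfolding B_def by simp
  with n(1) show ?thesis by blast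
qed

end

subsection \<open>Determinants of function matrices\<close>

definition fdet :: "nat \<Rightarrow> (nat \<Rightarrow> nat \<Rightarrow> 'b::comm_ring_1) \<Rightarrow> 'b" where
  "fdet n \<alpha> = det (mat n n (\<lambda>(i, j). \<alpha> i j))"

lemma fdet_perm: "fdet n \<alpha> = (\<Sum>\<pi> | \<pi> permutes {0..<n}. signof \<pi> * (\<Prod>i = 0..<n. \<alpha> i (\<pi> i)))"
proof -
  have "(\<Prod>i = 0..<n. mat n n (\<lambda>(i, j). \<alpha> i j) $$ (i, \<pi> i)) = (\<Prod>i = 0..<n. \<alpha> i (\<pi> i))"
    if "\<pi> permutes {0..<n}" for \<pi>
    using permutes_in_image[OF that] by (intro prod.cong) auto
  then show ?thesis unfolding fdet_def by (subst det_def'[of _ n]) auto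
qed

lemma fdet_cong: "(\<And>i j. i < n \<Longrightarrow> j < n \<Longrightarrow> \<alpha> i j = \<beta> i j) \<Longrightarrow> fdet n \<alpha> = fdet n \<beta>"
  unfolding fdet_def by (intro arg_cong[where f = det] eq_matI) auto

lemma fdet_tmul: "fdet n (tmul n \<alpha> \<beta>) = fdet n \<alpha> * fdet n \<beta>"
proof -
  have "mat n n (\<lambda>(i, j). tmul n \<alpha> \<beta> i j) = mat n n (\<lambda>(i, j). \<alpha> i j) * mat n n (\<lambda>(i, j). \<beta> i j)"
    by (intro eq_matI) (auto simp: tmul_def scalar_prod_def atLeast0LessThan)
  then show ?thesis unfolding fdet_def by (simp add: det_mult[of _ n])
qed

lemma fdet_tone [simp]: "fdet n (tone :: nat \<Rightarrow> nat \<Rightarrow> 'b::comm_ring_1) = 1"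
proof -
  have "mat n n (\<lambda>(i, j). tone i j :: 'b) = 1\<^sub>m n"
    by (intro eq_matI) (auto simp: tone_def)
  then show ?thesis by (simp add: fdet_def)
qed

lemma fdet_tpow: "fdet n (tpow n \<alpha> k) = fdet n \<alpha> ^ k"
  by (induction k) (auto simp: tpow_Suc fdet_tmul)

lemma fdet_cong_mod:
  fixes \<alpha> \<beta> :: "nat \<Rightarrow> nat \<Rightarrow> int"
  assumes "\<And>i j. i < n \<Longrightarrow> j < n \<Longrightarrow> [\<alpha> i j = \<beta> i j] (mod k)"
  shows "[fdet n \<alpha> = fdet n \<beta>] (mod k)"
  unfolding fdet_perm
proof (intro cong_sum cong_mult cong_prod cong_refl)
  fix \<pi> i assume "\<pi> \<in> {\<pi>. \<pi> permutes {0..<n}}" "i \<in> {0..<n}"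
  then show "[\<alpha> i (\<pi> i) = \<beta> i (\<pi> i)] (mod k)"
    using assms permutes_in_image[of \<pi> "{0..<n}" i] by auto
qed

text \<open>A permutation that moves some i >= n meets an off-diagonal entry of an identity row and
  contributes 0, so only permutations of the first n indices remain.\<close>

lemma fdet_stable:
  fixes \<alpha> :: "nat \<Rightarrow> nat \<Rightarrow> 'b::comm_ring_1"
  assumes "n \<le> m" and one: "\<And>i j. i < m \<Longrightarrow> j < m \<Longrightarrow> n \<le> i \<or> n \<le> j \<Longrightarrow> \<alpha> i j = tone i j"
  shows "fdet m \<alpha> = fdet n \<alpha>"
proof -
  have sub: "{\<pi>. \<pi> permutes {0..<n}} \<subseteq> {\<pi>. \<pi> permutes {0..<m}}"
    using assms(1) by (auto intro: permutes_subset)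
  have "fdet m \<alpha> = (\<Sum>\<pi> | \<pi> permutes {0..<n}. signof \<pi> * (\<Prod>i = 0..<m. \<alpha> i (\<pi> i)))"
    unfolding fdet_perm
  proof (rule sum.mono_neutral_right[OF _ sub])
    show "finite {\<pi>. \<pi> permutes {0..<m}}" by (rule finite_permutations) simp
    show "\<forall>\<pi>\<in>{\<pi>. \<pi> permutes {0..<m}} - {\<pi>. \<pi> permutes {0..<n}}. signof \<pi> * (\<Prod>i = 0..<m. \<alpha> i (\<pi> i)) = 0"
    proof
      fix \<pi> assume \<pi>: "\<pi> \<in> {\<pi>. \<pi> permutes {0..<m}} - {\<pi>. \<pi> permutes {0..<n}}"
      then have pm: "\<pi> permutes {0..<m}" by simp
      have "\<exists>i\<in>{n..<m}. \<pi> i \<noteq> i"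
      proof (rule ccontr)
        assume "\<not> (\<exists>i\<in>{n..<m}. \<pi> i \<noteq> i)"
        then have "\<pi> permutes {0..<n}"
          using pm by (intro permutes_superset[OF pm]) auto
        then show False using \<pi> by simp
      qed
      then obtain i where i: "n \<le> i" "i < m" "\<pi> i \<noteq> i" by auto
      then have "\<alpha> i (\<pi> i) = 0"
        using one[of i "\<pi> i"] permutes_in_image[OF pm, of i] by (auto simp: tone_def)
      then have "(\<Prod>i = 0..<m. \<alpha> i (\<pi> i)) = 0" using i by (intro prod_zero) auto
      then show "signof \<pi> * (\<Prod>i = 0..<m. \<alpha> i (\<pi> i)) = 0" by simp
    qed
  qed
  also have "\<dots> = fdet n \<alpha>"
    unfolding fdet_perm
  proof (intro sum.cong refl arg_cong2[where f = "(*)"])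
    fix \<pi> assume "\<pi> \<in> {\<pi>. \<pi> permutes {0..<n}}"
    then have \<pi>: "\<pi> i = i" if "n \<le> i" for i using that by (simp add: permutes_def)
    show "(\<Prod>i = 0..<m. \<alpha> i (\<pi> i)) = (\<Prod>i = 0..<n. \<alpha> i (\<pi> i))"
      using assms(1) by (intro prod.mono_neutral_right) (auto simp: \<pi> one tone_def)
  qed
  finally show ?thesis .
qed

lemma prod_one_plus_mod:
  fixes q :: int
  shows "finite S \<Longrightarrow> [(\<Prod>i\<in>S. 1 + q * w i) = 1 + q * (\<Sum>i\<in>S. w i)] (mod q\<^sup>2)"
proof (induction S rule: finite_induct)
  case (insert x S)
  have "[(1 + q * w x) * (\<Prod>i\<in>S. 1 + q * w i) = (1 + q * w x) * (1 + q * (\<Sum>i\<in>S. w i))] (mod q\<^sup>2)"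
    using insert by (intro cong_mult) auto
  also have "(1 + q * w x) * (1 + q * (\<Sum>i\<in>S. w i)) = 1 + q * (w x + (\<Sum>i\<in>S. w i)) + q\<^sup>2 * (w x * (\<Sum>i\<in>S. w i))"
    by (simp add: algebra_simps power2_eq_square)
  also have "[\<dots> = 1 + q * (w x + (\<Sum>i\<in>S. w i))] (mod q\<^sup>2)"
    by (simp add: cong_iff_dvd_diff)
  finally show ?case using insert by simp
qed simp

text \<open>A non-identical permutation moves at least two points, so it contributes a multiple of q squared.\<close>
lemma fdet_one_plus:
  fixes w :: "nat \<Rightarrow> nat \<Rightarrow> int"
  shows "[fdet n (\<lambda>i j. tone i j + q * w i j) = 1 + q * (\<Sum>i<n. w i i)] (mod q\<^sup>2)"
proof -
  define f where "f = (\<lambda>\<pi>. signof \<pi> * (\<Prod>i = 0..<n. tone i (\<pi> i) + q * w i (\<pi> i)))"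
  have fin: "finite {\<pi>. \<pi> permutes {0..<n}}" by (rule finite_permutations) simp
  have "q\<^sup>2 dvd f \<pi>" if \<pi>: "\<pi> permutes {0..<n}" "\<pi> \<noteq> id" for \<pi>
  proof -
    obtain i where i: "\<pi> i \<noteq> i" using \<pi>(2) by (auto simp: fun_eq_iff)
    then have i2: "\<pi> (\<pi> i) \<noteq> \<pi> i" using permutes_inj[OF \<pi>(1)] by (auto simp: inj_def)
    have mem: "i \<in> {0..<n}" "\<pi> i \<in> {0..<n}"
      using i i2 \<pi>(1) unfolding permutes_def by metis+
    let ?g = "\<lambda>i. tone i (\<pi> i) + q * w i (\<pi> i)"
    have "(\<Prod>i = 0..<n. ?g i) = ?g i * (?g (\<pi> i) * prod ?g ({0..<n} - {i} - {\<pi> i}))"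
      using mem i by (subst prod.remove[of _ i], simp, simp, subst prod.remove[of _ "\<pi> i"]) auto
    also have "?g i = q * w i (\<pi> i)" using i by (simp add: tone_def)
    also have "?g (\<pi> i) = q * w (\<pi> i) (\<pi> (\<pi> i))" using i2 by (simp add: tone_def)
    finally obtain a b c where "(\<Prod>i = 0..<n. ?g i) = q * a * (q * b * c)" by blast
    then have "(\<Prod>i = 0..<n. ?g i) = q\<^sup>2 * (a * b * c)" by (simp add: power2_eq_square)
    then show ?thesis by (simp add: f_def)
  qed
  then have "q\<^sup>2 dvd (\<Sum>\<pi>\<in>{\<pi>. \<pi> permutes {0..<n}} - {id}. f \<pi>)"
    by (intro dvd_sum) auto
  then have "[(\<Sum>\<pi>\<in>{\<pi>. \<pi> permutes {0..<n}} - {id}. f \<pi>) = 0] (mod q\<^sup>2)" by (simp add: cong_0_iff)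
  moreover have "[f id = 1 + q * (\<Sum>i = 0..<n. w i i)] (mod q\<^sup>2)"
    using prod_one_plus_mod[of "{0..<n}" q "\<lambda>i. w i i"] by (simp add: f_def tone_def)
  ultimately have "[f id + (\<Sum>\<pi>\<in>{\<pi>. \<pi> permutes {0..<n}} - {id}. f \<pi>) = 1 + q * (\<Sum>i = 0..<n. w i i) + 0] (mod q\<^sup>2)"
    by (rule cong_add[rotated])
  then show ?thesis
    unfolding fdet_perm using sum.remove[OF fin, of id f] permutes_id[of "{0..<n}"]
    by (simp add: f_def atLeast0LessThan)
qed

lemma fdet_unit:
  fixes \<alpha> \<beta> :: "nat \<Rightarrow> nat \<Rightarrow> int"
  assumes "\<And>i j. i < n \<Longrightarrow> j < n \<Longrightarrow> tmul n \<alpha> \<beta> i j = tone i j"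
  shows "fdet n \<alpha> = 1 \<or> fdet n \<alpha> = -1"
proof -
  have "fdet n \<alpha> * fdet n \<beta> = 1"
    using fdet_tmul[of n \<alpha> \<beta>] fdet_cong[of n "tmul n \<alpha> \<beta>" tone] assms by simp
  then show ?thesis by (simp add: zmult_eq_1_iff) blast
qed

text \<open>The binomial theorem for powers of 1 - X. The additional factor X^a makes the induction
  work: one more factor 1 - X yields the cases a and a + 1, which Pascal's rule recombines.\<close>

lemma tpow_one_minus:
  fixes X :: "nat \<Rightarrow> nat \<Rightarrow> int"
  assumes "i < n" "j < n"
  shows "tmul n (tpow n X a) (tpow n (\<lambda>i j. tone i j - X i j) k) i j
    = (\<Sum>\<nu>\<le>k. of_nat (k choose \<nu>) * (-1) ^ \<nu> * tpow n X (a + \<nu>) i j)"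
  using assms
proof (induction k arbitrary: a)
  case 0 then show ?case by (simp add: tmul_tone)
next
  case (Suc k)
  let ?U = "\<lambda>i j. tone i j - X i j"
  let ?P = "tpow n ?U k"
  let ?t = "\<lambda>b. tpow n X b i j"
  have XX: "tmul n (tpow n X a) X i l = tpow n X (Suc a) i l" if "l < n" for l
    using tpow_commute[of i n l X a] Suc.prems that by (simp add: tpow_Suc)
  have aU: "tmul n (tpow n X a) ?U i l = tpow n X a i l - tpow n X (Suc a) i l" if "l < n" for l
  proof -
    have "tmul n (tpow n X a) ?U i l = tmul n (tpow n X a) tone i l - tmul n (tpow n X a) X i l"
      by (simp add: tmul_def algebra_simps sum_subtractf)
    then show ?thesis using XX that by (simp add: tmul_tone)
  qed
  have "tmul n (tpow n X a) (tpow n ?U (Suc k)) i j = tmul n (tmul n (tpow n X a) ?U) ?P i j"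
    by (simp only: tpow_Suc tmul_assoc)
  also have "\<dots> = (\<Sum>l<n. (tpow n X a i l - tpow n X (Suc a) i l) * ?P l j)"
    using aU by (simp add: tmul_def[of n "tmul n (tpow n X a) ?U"])
  also have "\<dots> = tmul n (tpow n X a) ?P i j - tmul n (tpow n X (Suc a)) ?P i j"
    by (simp add: tmul_def left_diff_distrib sum_subtractf)
  also have "\<dots> = (\<Sum>\<nu>\<le>k. of_nat (k choose \<nu>) * (-1) ^ \<nu> * ?t (a + \<nu>))
      - (\<Sum>\<nu>\<le>k. of_nat (k choose \<nu>) * (-1) ^ \<nu> * ?t (Suc a + \<nu>))"
    using Suc.IH[of a] Suc.IH[of "Suc a"] Suc.prems by simp
  also have "\<dots> = (\<Sum>\<nu>\<le>Suc k. of_nat (Suc k choose \<nu>) * (-1) ^ \<nu> * ?t (a + \<nu>))"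
  proof -
    have A: "(\<Sum>\<nu>\<le>k. of_nat (k choose \<nu>) * (-1) ^ \<nu> * ?t (a + \<nu>))
      = ?t a + (\<Sum>\<nu>\<le>k. of_nat (k choose Suc \<nu>) * (-1) ^ Suc \<nu> * ?t (Suc a + \<nu>))"
    proof -
      have "(\<Sum>\<nu>\<le>k. of_nat (k choose \<nu>) * (-1) ^ \<nu> * ?t (a + \<nu>)) = (\<Sum>\<nu>\<le>Suc k. of_nat (k choose \<nu>) * (-1) ^ \<nu> * ?t (a + \<nu>))"
        by simp
      then show ?thesis by (simp add: sum.atMost_Suc_shift del: sum.atMost_Suc)
    qed
    have B: "(\<Sum>\<nu>\<le>Suc k. of_nat (Suc k choose \<nu>) * (-1) ^ \<nu> * ?t (a + \<nu>))
      = ?t a + (\<Sum>\<nu>\<le>k. of_nat (Suc k choose Suc \<nu>) * (-1) ^ Suc \<nu> * ?t (Suc a + \<nu>))"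
      by (simp add: sum.atMost_Suc_shift del: sum.atMost_Suc binomial_Suc_Suc)
    show ?thesis unfolding A B by (simp add: algebra_simps sum.distrib sum_subtractf sum_negf)
  qed
  finally show ?case .
qed

section \<open>Logarithm of the determinant against trace of the logarithm for integral
  matrices\<close>

context padic
begin

text \<open>Absorption extracts p^M at the price of a division by j, which the assumed size p^(-j)
  of t pays for. Consequently (1 - X)^(p^M) is 1 modulo p^M when p divides X.\<close>

lemma rnorm_binomial_pk:
  assumes "rnorm p t \<le> pe j" "1 \<le> j"
  shows "rnorm p (of_nat (p ^ M choose j) * t) \<le> pe M"
proof -
  have "(of_nat (j * (p ^ M choose j)) :: rat) = of_nat (p ^ M * ((p ^ M - 1) choose (j - 1)))"
    using assms(2) by (simp only: times_binomial_minus1_eq)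
  then have "of_nat (p ^ M choose j) * t = of_nat (p ^ M) * (of_nat ((p ^ M - 1) choose (j - 1)) * (t / of_nat j))"
    using assms(2) by (simp add: field_simps)
  moreover have "rnorm p (of_nat ((p ^ M - 1) choose (j - 1))) * rnorm p (t / of_nat j) \<le> 1 * 1"
    using rnorm_div_nat_le(2)[OF assms(1)] by (intro mult_mono) auto
  then have "pe M * (rnorm p (of_nat ((p ^ M - 1) choose (j - 1))) * rnorm p (t / of_nat j)) \<le> pe M"
    by (intro mult_left_le) auto
  ultimately show ?thesis by (simp only: rnorm_mult rnorm_pk)
qed

lemma tpow_dvd:
  fixes X :: "nat \<Rightarrow> nat \<Rightarrow> int"
  assumes "\<And>i j. i < n \<Longrightarrow> j < n \<Longrightarrow> int p dvd X i j" "i < n" "j < n"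
  shows "int p ^ \<nu> dvd tpow n X \<nu> i j"
  using assms(2,3)
proof (induction \<nu> arbitrary: i j)
  case (Suc \<nu>)
  then show ?case using assms(1) by (auto simp: tpow_Suc tmul_def intro!: dvd_sum mult_dvd_mono)
qed simp

text \<open>Both log det U and tr log U are close to tr W for W = (U^(p^M) - 1) / p^M,
  because det (1 + p^M W) = 1 + p^M tr W up to p^(2 M).\<close>
lemma Lk_fdet_approx:
  assumes e: "e > 0"
  shows "\<exists>M0. \<forall>M\<ge>M0. \<forall>n (X :: nat \<Rightarrow> nat \<Rightarrow> int). (\<forall>i<n. \<forall>j<n. int p dvd X i j) \<longrightarrow>
    rnorm p (Lk M (fdet n (\<lambda>i j. tone i j - X i j)) + (\<Sum>\<nu>=1..M. of_int (\<Sum>i<n. tpow n X \<nu> i i) / of_nat \<nu>)) \<le> e"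
proof -
  obtain M1 where M1: "\<forall>M\<ge>M1. \<forall>t. (\<forall>\<nu>. rnorm p (t \<nu>) \<le> pe \<nu>) \<longrightarrow>
    rnorm p (((\<Sum>j\<le>p ^ M. of_nat (p ^ M choose j) * (-1) ^ j * t j) - t 0) / of_nat (p ^ M)
      + (\<Sum>\<nu>=1..M. t \<nu> / of_nat \<nu>)) \<le> e"
    using normalised_binomial_sum_approx[OF e] by blast
  obtain M2 where M2: "pe M2 < e" using ex_pe_less[OF e] by blast
  show ?thesis
  proof (intro exI[of _ "max M1 M2"] allI impI)
    fix M n and X :: "nat \<Rightarrow> nat \<Rightarrow> int"
    assume M: "max M1 M2 \<le> M" and "\<forall>i<n. \<forall>j<n. int p dvd X i j"
    then have X: "\<And>i j. i < n \<Longrightarrow> j < n \<Longrightarrow> int p dvd X i j" by blast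
    define U where "U = (\<lambda>i j. tone i j - X i j)"
    define q where "q = int (p ^ M)"
    have q0: "q \<noteq> 0" using p_pos by (simp add: q_def)
    have bin: "tpow n U (p ^ M) i j = (\<Sum>\<nu>\<le>p ^ M. of_nat (p ^ M choose \<nu>) * (-1) ^ \<nu> * tpow n X \<nu> i j)"
      if "i < n" "j < n" for i j
      using tpow_one_minus[OF that, of X 0 "p ^ M"] that by (simp add: tmul_tone U_def)
    have qd: "q dvd tpow n U (p ^ M) i j - tone i j" if ij: "i < n" "j < n" for i j
    proof -
      have "tpow n U (p ^ M) i j - tone i j = (\<Sum>\<nu>=1..p ^ M. of_nat (p ^ M choose \<nu>) * (-1) ^ \<nu> * tpow n X \<nu> i j)"
        unfolding bin[OF ij] by (simp add: sum.atMost_shift sum.atLeast1_atMost_eq del: binomial_Suc_Suc power_Suc)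
      also have "int p ^ M dvd \<dots>"
      proof (intro dvd_sum)
        fix \<nu> assume "\<nu> \<in> {1..p ^ M}"
        have "rnorm p (of_int ((-1) ^ \<nu> * tpow n X \<nu> i j)) \<le> pe \<nu>"
          unfolding rnorm_of_int_le_iff using tpow_dvd[OF X ij] by (rule dvd_mult)
        then have "rnorm p (of_int (of_nat (p ^ M choose \<nu>) * ((-1) ^ \<nu> * tpow n X \<nu> i j))) \<le> pe M"
          using rnorm_binomial_pk[of "of_int ((-1) ^ \<nu> * tpow n X \<nu> i j)" \<nu> M] \<open>\<nu> \<in> _\<close>
          by (simp only: of_int_mult of_int_of_nat_eq) auto
        then show "int p ^ M dvd of_nat (p ^ M choose \<nu>) * (-1) ^ \<nu> * tpow n X \<nu> i j"
          unfolding rnorm_of_int_le_iff by (simp only: mult.assoc)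
      qed
      finally show ?thesis by (simp add: q_def)
    qed
    define W where "W = (\<lambda>i j. (tpow n U (p ^ M) i j - tone i j) div q)"
    have W: "tpow n U (p ^ M) i j = tone i j + q * W i j" if "i < n" "j < n" for i j
      using qd[OF that] by (simp add: W_def)
    define d where "d = fdet n U"
    have "d ^ (p ^ M) = fdet n (\<lambda>i j. tone i j + q * W i j)"
      unfolding d_def fdet_tpow[symmetric] by (intro fdet_cong W)
    then have "[d ^ (p ^ M) = 1 + q * (\<Sum>i<n. W i i)] (mod q\<^sup>2)" using fdet_one_plus by simp
    then obtain z where z: "d ^ (p ^ M) - (1 + q * (\<Sum>i<n. W i i)) = q\<^sup>2 * z"
      by (auto simp: cong_iff_dvd_diff dvd_def)
    \<comment> \<open>As det U is 1 modulo p, the simpler expression without the factor p - 1 in the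
      exponent approximates its logarithm.\<close>
    have "[d = fdet n tone] (mod int p)"
      unfolding d_def U_def using X by (intro fdet_cong_mod) (auto simp: cong_iff_dvd_diff)
    then have d1: "int p dvd d - 1" by (simp add: cong_iff_dvd_diff)
    have "rnorm p (Lk M d - of_int (d ^ (p ^ M) - 1) / of_nat (p ^ M)) \<le> pe M"
      by (rule rnorm_Lk_one_plus[OF d1])
    moreover have "of_int (d ^ (p ^ M) - 1) / of_nat (p ^ M) - of_int (\<Sum>i<n. W i i) = (of_int (q * z) :: rat)"
    proof -
      have "d ^ (p ^ M) - 1 = q * ((\<Sum>i<n. W i i) + q * z)" using z by (simp add: algebra_simps power2_eq_square)
      moreover have "of_nat (p ^ M) = (of_int q :: rat)" by (simp add: q_def)
      ultimately have "of_int (d ^ (p ^ M) - 1) / of_nat (p ^ M) = (of_int ((\<Sum>i<n. W i i) + q * z) :: rat)"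
        using q0 by simp
      then show ?thesis by simp
    qed
    then have "rnorm p (of_int (d ^ (p ^ M) - 1) / of_nat (p ^ M) - of_int (\<Sum>i<n. W i i)) \<le> pe M"
      by (simp only: rnorm_of_int_le_iff) (simp add: q_def)
    ultimately have L: "rnorm p (Lk M d - of_int (\<Sum>i<n. W i i)) \<le> pe M" by (rule rnorm_triangle)
    define t where "t = (\<lambda>\<nu>. of_int (\<Sum>i<n. tpow n X \<nu> i i) :: rat)"
    have "rnorm p (t \<nu>) \<le> pe \<nu>" for \<nu>
      unfolding t_def rnorm_of_int_le_iff by (intro dvd_sum tpow_dvd X) auto
    then have "rnorm p (((\<Sum>j\<le>p ^ M. of_nat (p ^ M choose j) * (-1) ^ j * t j) - t 0) / of_nat (p ^ M)
      + (\<Sum>\<nu>=1..M. t \<nu> / of_nat \<nu>)) \<le> e" using M1 M by auto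
    \<comment> \<open>The alternating binomial sum of the traces is the trace of U^(p^M), and
      \<open>t 0\<close> is the trace of the identity; their difference is p^M times the trace of
      W.\<close>
    moreover have "(\<Sum>j\<le>p ^ M. of_nat (p ^ M choose j) * (-1) ^ j * t j) - t 0 = of_int (q * (\<Sum>i<n. W i i))"
    proof -
      have "(\<Sum>j\<le>p ^ M. of_nat (p ^ M choose j) * (-1) ^ j * t j)
          = of_int (\<Sum>j\<le>p ^ M. \<Sum>i<n. of_nat (p ^ M choose j) * (-1) ^ j * tpow n X j i i)"
        by (simp add: t_def sum_distrib_left)
      also have "(\<Sum>j\<le>p ^ M. \<Sum>i<n. of_nat (p ^ M choose j) * (-1) ^ j * tpow n X j i i)
          = (\<Sum>i<n. tone i i + q * W i i)"
        by (subst sum.swap) (simp add: bin[symmetric] W)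
      also have "\<dots> = (\<Sum>i<n. tpow n X 0 i i) + q * (\<Sum>i<n. W i i)"
        by (simp add: sum.distrib sum_distrib_left)
      finally show ?thesis by (simp add: t_def)
    qed
    then have "((\<Sum>j\<le>p ^ M. of_nat (p ^ M choose j) * (-1) ^ j * t j) - t 0) / of_nat (p ^ M) = of_int (\<Sum>i<n. W i i)"
      using q0 by (simp add: q_def)
    ultimately have "rnorm p (of_int (\<Sum>i<n. W i i) + (\<Sum>\<nu>=1..M. t \<nu> / of_nat \<nu>)) \<le> e" by simp
    moreover have "rnorm p (Lk M d - of_int (\<Sum>i<n. W i i)) \<le> e"
      using L pe_antimono[of M2 M] M M2 by simp
    ultimately have "rnorm p ((Lk M d - of_int (\<Sum>i<n. W i i)) + (of_int (\<Sum>i<n. W i i) + (\<Sum>\<nu>=1..M. t \<nu> / of_nat \<nu>))) \<le> e"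
      by (rule rnorm_add_le[rotated])
    then show "rnorm p (Lk M (fdet n (\<lambda>i j. tone i j - X i j)) + (\<Sum>\<nu>=1..M. of_int (\<Sum>i<n. tpow n X \<nu> i i) / of_nat \<nu>)) \<le> e"
      by (simp add: d_def U_def t_def)
  qed
qed

end

subsection \<open>The action on a finite quotient\<close>

lemma normal_fi_cosets_eq_iff:
  fixes N :: "'g::group_add set"
  assumes "normal_fi N"
  shows "(\<lambda>n. x + n) ` N = (\<lambda>n. y + n) ` N \<longleftrightarrow> - x + y \<in> N"
proof
  assume "(\<lambda>n. x + n) ` N = (\<lambda>n. y + n) ` N"
  moreover have "y + 0 \<in> (\<lambda>n. y + n) ` N" using assms unfolding normal_fi_def by (intro imageI) blast
  ultimately obtain n where n: "n \<in> N" "y = x + n" by auto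
  have "- x + y = n" unfolding n(2) by (simp add: add.assoc[symmetric])
  then show "- x + y \<in> N" using n(1) by simp
next
  have sub: "(\<lambda>n. y + n) ` N \<subseteq> (\<lambda>n. x + n) ` N" if "- x + y \<in> N" for x y :: 'g
  proof
    fix z assume "z \<in> (\<lambda>n. y + n) ` N"
    then obtain n where n: "n \<in> N" "z = y + n" by blast
    have "(- x + y) + n \<in> N" using that n(1) assms unfolding normal_fi_def by blast
    moreover have "z = x + ((- x + y) + n)" unfolding n(2) by (simp add: add.assoc[symmetric])
    ultimately show "z \<in> (\<lambda>n. x + n) ` N" by blast
  qed
  assume a: "- x + y \<in> N"
  then have "- (- x + y) \<in> N" using assms unfolding normal_fi_def by blast
  then have "- y + x \<in> N" by (simp add: minus_add)
  with a show "(\<lambda>n. x + n) ` N = (\<lambda>n. y + n) ` N" using sub by blast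
qed

text \<open>The quotient by N, encoded by the number of the coset of an element in an enumeration of the cosets.\<close>
locale fin_quot =
  fixes \<kappa> :: "'g::group_add \<Rightarrow> nat" and q :: nat and N :: "'g set"
  assumes range_\<kappa>: "range \<kappa> = {..<q}"
    and \<kappa>_iff: "\<kappa> x = \<kappa> y \<longleftrightarrow> - x + y \<in> N"
    and normal: "normal_fi N"

lemma ex_fin_quot:
  fixes N :: "'g::group_add set"
  assumes N: "normal_fi N"
  shows "\<exists>\<kappa>. fin_quot \<kappa> (grp_index N) N"
proof -
  let ?C = "(\<lambda>x. (\<lambda>n. x + n) ` N) ` (UNIV :: 'g set)"
  have "finite ?C" using N by (simp add: normal_fi_def)
  then obtain h where h: "bij_betw h ?C {0..<card ?C}" using ex_bij_betw_finite_nat by blast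
  have "fin_quot (\<lambda>x. h ((\<lambda>n. x + n) ` N)) (grp_index N) N"
  proof
    have "range (\<lambda>x. h ((\<lambda>n. x + n) ` N)) = h ` ?C" by (simp add: image_image)
    then show "range (\<lambda>x. h ((\<lambda>n. x + n) ` N)) = {..<grp_index N}"
      using h by (simp add: bij_betw_def grp_index_def atLeast0LessThan)
    have "inj_on h ?C" using h by (simp add: bij_betw_def)
    then have "h ((\<lambda>n. x + n) ` N) = h ((\<lambda>n. y + n) ` N) \<longleftrightarrow> (\<lambda>n. x + n) ` N = (\<lambda>n. y + n) ` N" for x y
      by (intro inj_on_eq_iff) auto
    then show "h ((\<lambda>n. x + n) ` N) = h ((\<lambda>n. y + n) ` N) \<longleftrightarrow> - x + y \<in> N" for x y
      using normal_fi_cosets_eq_iff[OF N] by simp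
  qed (rule N)
  then show ?thesis by blast
qed

lemma sum_div_mod:
  fixes f :: "nat \<Rightarrow> nat \<Rightarrow> 'a::comm_monoid_add"
  assumes "0 < q"
  shows "(\<Sum>a<s * q. f (a div q) (a mod q)) = (\<Sum>i<s. \<Sum>c<q. f i c)"
proof -
  have "(\<Sum>a\<in>{i * q..<i * q + q}. f (a div q) (a mod q)) = (\<Sum>c<q. f i c)" for i
    using assms sum.shift_bounds_nat_ivl[of "\<lambda>a. f (a div q) (a mod q)" 0 "i * q" q]
    by (simp add: atLeast0LessThan add.commute)
  then show ?thesis
    using sum.nat_group[of "\<lambda>a. f (a div q) (a mod q)" q s] by simp
qed

lemma div_mod_lt: "a < s * q \<Longrightarrow> a div q < s \<and> a mod q < (q::nat)"
  by (metis less_mult_imp_div_less mod_less_divisor mult_0_right neq0_conv not_less0)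

context fin_quot
begin

lemma q_pos: "0 < q"
  using range_\<kappa> by (metis UNIV_I gr0I image_eqI lessThan_0 empty_iff)

lemma \<kappa>_less: "\<kappa> x < q"
  using range_\<kappa> by auto

definition crep :: "nat \<Rightarrow> 'g" where
  "crep c = (SOME x. \<kappa> x = c)"

lemma \<kappa>_crep: "c < q \<Longrightarrow> \<kappa> (crep c) = c"
  unfolding crep_def by (rule someI_ex) (use range_\<kappa> in \<open>metis imageE lessThan_iff\<close>)

text \<open>Right translation acts on the cosets x + N because N is stable under
  conjugation.\<close>

lemma \<kappa>_add_cong: "\<kappa> x = \<kappa> y \<Longrightarrow> \<kappa> (x + g) = \<kappa> (y + g)"
proof -
  assume "\<kappa> x = \<kappa> y"
  then have "- g + (- x + y) - (- g) \<in> N" using normal unfolding normal_fi_def \<kappa>_iff by blast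
  then show ?thesis
    unfolding \<kappa>_iff by (simp only: minus_add diff_conv_add_uminus minus_minus add.assoc)
qed

lemma \<kappa>_add_eq_iff: "\<kappa> (x + g) = \<kappa> x \<longleftrightarrow> g \<in> N"
proof -
  have "\<kappa> x = \<kappa> (x + g) \<longleftrightarrow> g \<in> N" unfolding \<kappa>_iff by (simp add: add.assoc[symmetric])
  then show ?thesis by (simp add: eq_commute)
qed

lemma \<kappa>_crep_add: "\<kappa> (crep (\<kappa> x) + g) = \<kappa> (x + g)"
  by (rule \<kappa>_add_cong) (simp add: \<kappa>_crep \<kappa>_less)

text \<open>The matrix of right multiplication by \<alpha> on the group ring of the quotient, for
  row vectors in the basis of cosets.\<close>

definition Rc :: "('g \<Rightarrow>\<^sub>0 int) \<Rightarrow> nat \<Rightarrow> nat \<Rightarrow> int" where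
  "Rc \<alpha> c c' = (\<Sum>g\<in>keys \<alpha>. if \<kappa> (crep c + g) = c' then lookup \<alpha> g else 0)"

lemma Rc_superset:
  "finite F \<Longrightarrow> keys \<alpha> \<subseteq> F \<Longrightarrow> Rc \<alpha> c c' = (\<Sum>g\<in>F. if \<kappa> (crep c + g) = c' then lookup \<alpha> g else 0)"
  unfolding Rc_def by (intro sum.mono_neutral_left) (auto simp: in_keys_iff)

lemma Rc_zero [simp]: "Rc 0 c c' = 0"
  by (simp add: Rc_def)

lemma Rc_add: "Rc (\<alpha> + \<beta>) c c' = Rc \<alpha> c c' + Rc \<beta> c c'"
proof -
  let ?F = "keys \<alpha> \<union> keys \<beta> \<union> keys (\<alpha> + \<beta>)"
  show ?thesis
    by (subst (1 2 3) Rc_superset[of ?F]) (auto simp: lookup_add sum.distrib[symmetric] intro!: sum.cong)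
qed

lemma Rc_uminus: "Rc (- \<alpha>) c c' = - Rc \<alpha> c c'"
  using Rc_add[of \<alpha> "- \<alpha>" c c'] by simp

lemma Rc_diff: "Rc (\<alpha> - \<beta>) c c' = Rc \<alpha> c c' - Rc \<beta> c c'"
  using Rc_add[of \<alpha> "- \<beta>" c c'] by (simp add: Rc_uminus)

lemma Rc_sum: "Rc (sum f S) c c' = (\<Sum>x\<in>S. Rc (f x) c c')"
  by (induction S rule: infinite_finite_induct) (auto simp: Rc_add)

lemma Rc_single: "Rc (Poly_Mapping.single g x) c c' = (if \<kappa> (crep c + g) = c' then x else 0)"
  by (subst Rc_superset[of "{g}"]) auto

lemma sum_single_lookup: "(\<Sum>g\<in>keys \<alpha>. Poly_Mapping.single g (lookup \<alpha> g)) = \<alpha>"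
  by (rule poly_mapping_eqI) (auto simp: lookup_sum lookup_single when_def in_keys_iff)

lemma Rc_one: "c < q \<Longrightarrow> Rc 1 c c' = (if c = c' then 1 else 0)"
  using Rc_single[of 0 1 c c'] by (simp add: \<kappa>_crep)

text \<open>For group elements translation by g + h is translation by g followed by translation by
  h; the general case follows by expanding both factors into multiples of group elements.\<close>

lemma Rc_mult: "Rc (\<alpha> * \<beta>) c c' = (\<Sum>c''<q. Rc \<alpha> c c'' * Rc \<beta> c'' c')"
proof -
  have "\<alpha> * \<beta> = (\<Sum>g\<in>keys \<alpha>. Poly_Mapping.single g (lookup \<alpha> g)) * (\<Sum>h\<in>keys \<beta>. Poly_Mapping.single h (lookup \<beta> h))"
    by (simp add: sum_single_lookup)
  also have "\<dots> = (\<Sum>g\<in>keys \<alpha>. \<Sum>h\<in>keys \<beta>. Poly_Mapping.single (g + h) (lookup \<alpha> g * lookup \<beta> h))"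
    by (simp add: sum_product mult_single)
  finally have "Rc (\<alpha> * \<beta>) c c' = (\<Sum>g\<in>keys \<alpha>. \<Sum>h\<in>keys \<beta>. if \<kappa> (crep c + (g + h)) = c' then lookup \<alpha> g * lookup \<beta> h else 0)"
    by (simp add: Rc_sum Rc_single)
  also have "\<dots> = (\<Sum>g\<in>keys \<alpha>. lookup \<alpha> g * Rc \<beta> (\<kappa> (crep c + g)) c')"
    by (simp add: Rc_def \<kappa>_crep_add sum_distrib_left add.assoc if_distrib[of "\<lambda>x. _ * x"] cong: if_cong)
  also have "\<dots> = (\<Sum>g\<in>keys \<alpha>. \<Sum>c''<q. (if \<kappa> (crep c + g) = c'' then lookup \<alpha> g else 0) * Rc \<beta> c'' c')"
  proof (intro sum.cong refl)
    fix g
    have "(\<Sum>c''<q. (if \<kappa> (crep c + g) = c'' then lookup \<alpha> g else 0) * Rc \<beta> c'' c')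
      = (\<Sum>c''<q. if \<kappa> (crep c + g) = c'' then lookup \<alpha> g * Rc \<beta> c'' c' else 0)"
      by (intro sum.cong) auto
    then show "lookup \<alpha> g * Rc \<beta> (\<kappa> (crep c + g)) c' = (\<Sum>c''<q. (if \<kappa> (crep c + g) = c'' then lookup \<alpha> g else 0) * Rc \<beta> c'' c')"
      by (simp add: \<kappa>_less)
  qed
  also have "\<dots> = (\<Sum>c''<q. Rc \<alpha> c c'' * Rc \<beta> c'' c')"
    by (subst sum.swap) (simp add: Rc_def sum_distrib_right)
  finally show ?thesis .
qed

lemma Rc_dvd:
  assumes "\<And>g. k dvd lookup \<alpha> g - lookup \<beta> g"
  shows "k dvd Rc \<alpha> c c' - Rc \<beta> c c'"
  unfolding Rc_diff[symmetric] Rc_def[of "\<alpha> - \<beta>"]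
  by (intro dvd_sum) (auto simp: lookup_minus assms)

text \<open>The coefficient at the identity of the image of \<alpha> in the group ring of the
  quotient.\<close>

definition coefN :: "('g \<Rightarrow>\<^sub>0 int) \<Rightarrow> int" where
  "coefN \<alpha> = (\<Sum>g\<in>keys \<alpha>. if g \<in> N then lookup \<alpha> g else 0)"

text \<open>A coset is fixed by right translation by g exactly when g lies in N, so all q diagonal
  entries agree. This exact factor q cancels the index later.\<close>

lemma Rc_trace: "(\<Sum>c<q. Rc \<alpha> c c) = int q * coefN \<alpha>"
proof -
  have "\<kappa> (crep c + g) = c \<longleftrightarrow> g \<in> N" if "c < q" for c g
    using \<kappa>_add_eq_iff[of "crep c" g] \<kappa>_crep[OF that] by simp
  then show ?thesis by (simp add: Rc_def coefN_def)
qed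

text \<open>The index i * q + c stands for the pair of block index i and coset c.\<close>

definition bigM :: "(nat \<Rightarrow> nat \<Rightarrow> 'g \<Rightarrow>\<^sub>0 int) \<Rightarrow> nat \<Rightarrow> nat \<Rightarrow> int" where
  "bigM \<alpha> = (\<lambda>a b. Rc (\<alpha> (a div q) (b div q)) (a mod q) (b mod q))"

lemma bigM_tmul: "tmul (s * q) (bigM \<alpha>) (bigM \<beta>) a b = bigM (tmul s \<alpha> \<beta>) a b"
proof -
  have "tmul (s * q) (bigM \<alpha>) (bigM \<beta>) a b
    = (\<Sum>k<s. \<Sum>c<q. Rc (\<alpha> (a div q) k) (a mod q) c * Rc (\<beta> k (b div q)) c (b mod q))"
    unfolding tmul_def bigM_def by (rule sum_div_mod[OF q_pos])
  then show ?thesis by (simp add: bigM_def tmul_def Rc_sum Rc_mult)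
qed

lemma bigM_tone: "bigM tone = tone"
proof (rule ext, rule ext)
  fix a b
  have "a mod q < q" using q_pos by simp
  then show "bigM tone a b = tone a b"
    by (auto simp: bigM_def tone_def Rc_one) (metis div_mult_mod_eq)
qed

lemma bigM_tpow: "bigM (tpow s \<alpha> \<nu>) a b = tpow (s * q) (bigM \<alpha>) \<nu> a b"
proof (induction \<nu> arbitrary: a b)
  case (Suc \<nu>)
  have "bigM (tpow s \<alpha> \<nu>) = tpow (s * q) (bigM \<alpha>) \<nu>" using Suc by (intro ext)
  then show ?case using bigM_tmul[of s \<alpha> "tpow s \<alpha> \<nu>"] by (simp add: tpow_Suc)
qed (simp add: bigM_tone)

lemma bigM_diff: "bigM (\<lambda>i j. \<alpha> i j - \<beta> i j) a b = bigM \<alpha> a b - bigM \<beta> a b"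
  by (simp add: bigM_def Rc_diff)

lemma bigM_trace: "(\<Sum>a<s * q. bigM \<alpha> a a) = int q * (\<Sum>i<s. coefN (\<alpha> i i))"
proof -
  have "(\<Sum>a<s * q. bigM \<alpha> a a) = (\<Sum>i<s. \<Sum>c<q. Rc (\<alpha> i i) c c)"
    unfolding bigM_def by (rule sum_div_mod[OF q_pos])
  then show ?thesis by (simp add: Rc_trace sum_distrib_left)
qed

definition qdet :: "nat \<Rightarrow> (nat \<Rightarrow> nat \<Rightarrow> 'g \<Rightarrow>\<^sub>0 int) \<Rightarrow> int" where
  "qdet s \<alpha> = fdet (s * q) (bigM \<alpha>)"

lemma qdet_tmul: "qdet s (tmul s \<alpha> \<beta>) = qdet s \<alpha> * qdet s \<beta>"
  unfolding qdet_def fdet_tmul[symmetric] by (rule fdet_cong) (simp add: bigM_tmul)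

lemma qdet_tone [simp]: "qdet s tone = 1"
  by (simp add: qdet_def bigM_tone)

lemma qdet_cong: "(\<And>i j. i < s \<Longrightarrow> j < s \<Longrightarrow> \<alpha> i j = \<beta> i j) \<Longrightarrow> qdet s \<alpha> = qdet s \<beta>"
  unfolding qdet_def bigM_def by (rule fdet_cong) (simp add: div_mod_lt)

lemma qdet_unit:
  assumes "\<And>i j. i < s \<Longrightarrow> j < s \<Longrightarrow> tmul s \<alpha> \<beta> i j = tone i j"
  shows "qdet s \<alpha> = 1 \<or> qdet s \<alpha> = -1"
proof -
  have "qdet s \<alpha> * qdet s \<beta> = 1"
    using qdet_tmul[of s \<alpha> \<beta>] qdet_cong[of s "tmul s \<alpha> \<beta>" tone] assms by simp
  then show ?thesis by (simp add: zmult_eq_1_iff) blast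
qed

lemma qdet_stable:
  assumes "s \<le> t" "\<And>i j. s \<le> i \<or> s \<le> j \<Longrightarrow> \<alpha> i j = tone i j"
  shows "qdet t \<alpha> = qdet s \<alpha>"
  unfolding qdet_def
proof (rule fdet_stable)
  show "s * q \<le> t * q" using assms(1) by simp
  fix a b assume "s * q \<le> a \<or> s * q \<le> b"
  then have "s \<le> a div q \<or> s \<le> b div q"
    using q_pos by (auto simp: less_eq_div_iff_mult_less_eq)
  then have "bigM \<alpha> a b = bigM tone a b" using assms(2) by (simp add: bigM_def)
  then show "bigM \<alpha> a b = tone a b" by (simp add: bigM_tone)
qed

end

section \<open>Determinants over a finite quotient under congruences\<close>

context padic
begin

lemma coefN_cong:
  fixes \<alpha> \<beta> :: "'g::group_add \<Rightarrow>\<^sub>0 int"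
  assumes "fin_quot \<kappa> q N" "zcong m \<alpha> \<beta>"
  shows "int p ^ m dvd fin_quot.coefN N \<alpha> - fin_quot.coefN N \<beta>"
proof -
  interpret fin_quot \<kappa> q N by fact
  have sup: "coefN \<gamma> = (\<Sum>g\<in>keys \<alpha> \<union> keys \<beta>. if g \<in> N then lookup \<gamma> g else 0)"
    if "keys \<gamma> \<subseteq> keys \<alpha> \<union> keys \<beta>" for \<gamma>
    unfolding coefN_def using that by (intro sum.mono_neutral_left) (auto simp: in_keys_iff)
  have "coefN \<alpha> - coefN \<beta> = (\<Sum>g\<in>keys \<alpha> \<union> keys \<beta>. if g \<in> N then lookup \<alpha> g - lookup \<beta> g else 0)"
    by (simp add: sup sum_subtractf[symmetric] if_distrib[of "\<lambda>x. x - _"] cong: if_cong)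
  then show ?thesis using assms(2) by (auto simp: zcong_def intro!: dvd_sum)
qed

lemma qdet_dvd:
  fixes \<alpha> \<beta> :: "nat \<Rightarrow> nat \<Rightarrow> 'g::group_add \<Rightarrow>\<^sub>0 int"
  assumes "fin_quot \<kappa> q N" "mcong m s \<alpha> \<beta>"
  shows "int p ^ m dvd fin_quot.qdet \<kappa> q s \<alpha> - fin_quot.qdet \<kappa> q s \<beta>"
proof -
  interpret fin_quot \<kappa> q N by fact
  have "[qdet s \<alpha> = qdet s \<beta>] (mod int p ^ m)"
    unfolding qdet_def
  proof (rule fdet_cong_mod)
    fix a b assume "a < s * q" "b < s * q"
    then have "zcong m (\<alpha> (a div q) (b div q)) (\<beta> (a div q) (b div q))"
      using assms(2) div_mod_lt unfolding mcong_def by blast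
    then show "[bigM \<alpha> a b = bigM \<beta> a b] (mod int p ^ m)"
      unfolding bigM_def cong_iff_dvd_diff zcong_def by (intro Rc_dvd) blast
  qed
  then show ?thesis by (simp add: cong_iff_dvd_diff)
qed

text \<open>Modulo p the determinants of \<alpha> and of its approximate inverse multiply to
  1.\<close>

lemma qdet_coprime:
  fixes \<alpha> \<beta> :: "nat \<Rightarrow> nat \<Rightarrow> 'g::group_add \<Rightarrow>\<^sub>0 int"
  assumes "fin_quot \<kappa> q N" "mcong m s (tmul s \<alpha> \<beta>) tone" "1 \<le> m"
  shows "coprime (fin_quot.qdet \<kappa> q s \<alpha>) (int p)"
proof -
  interpret fin_quot \<kappa> q N by fact
  have "int p ^ 1 dvd qdet s \<alpha> * qdet s \<beta> - 1"
    using qdet_dvd[OF assms(1) mcong_mono[OF assms(2,3)]] by (simp add: qdet_tmul)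
  then have "\<not> int p dvd qdet s \<alpha>"
    using prime_int_p by (metis dvd_diff_right_iff dvd_mult2 not_prime_unit power_one_right)
  then show ?thesis by (simp add: coprime_p_iff)
qed

text \<open>The trace of each power is q times a sum of values of \<open>coefN\<close>, so division
  by q acts exactly on the series. The estimate for integral matrices is used with precision e times
  the absolute value of q, which is why the threshold for M depends on the quotient.\<close>

lemma Lk_qdet_approx:
  fixes \<alpha> :: "nat \<Rightarrow> nat \<Rightarrow> 'g::group_add \<Rightarrow>\<^sub>0 int"
  assumes "fin_quot \<kappa> q N" and e: "e > 0"
  shows "\<exists>M0. \<forall>M\<ge>M0. \<forall>X :: nat \<Rightarrow> nat \<Rightarrow> 'g \<Rightarrow>\<^sub>0 int. mcong 1 s X (\<lambda>_ _. 0) \<longrightarrow>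
    rnorm p (Lk M (fin_quot.qdet \<kappa> q s (\<lambda>i j. tone i j - X i j)) / of_nat q
      + (\<Sum>\<nu>=1..M. of_int (\<Sum>i<s. fin_quot.coefN N (tpow s X \<nu> i i)) / of_nat \<nu>)) \<le> e"
proof -
  interpret fin_quot \<kappa> q N by fact
  define c where "c = rnorm p (of_nat q)"
  have q0: "(of_nat q :: rat) \<noteq> 0" using q_pos by simp
  then have "c \<noteq> 0" unfolding c_def rnorm_eq_0_iff .
  moreover have "c \<ge> 0" unfolding c_def by (rule rnorm_nonneg)
  ultimately have c: "c > 0" by simp
  have ec: "0 < e * c" using e c by simp
  obtain M0 where M0: "\<forall>M\<ge>M0. \<forall>n (X :: nat \<Rightarrow> nat \<Rightarrow> int). (\<forall>i<n. \<forall>j<n. int p dvd X i j) \<longrightarrow>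
    rnorm p (Lk M (fdet n (\<lambda>i j. tone i j - X i j)) + (\<Sum>\<nu>=1..M. of_int (\<Sum>i<n. tpow n X \<nu> i i) / of_nat \<nu>)) \<le> e * c"
    using Lk_fdet_approx[OF ec] ..
  show ?thesis
  proof (intro exI[of _ M0] allI impI)
    fix M and X :: "nat \<Rightarrow> nat \<Rightarrow> 'g \<Rightarrow>\<^sub>0 int"
    assume M: "M0 \<le> M" and X: "mcong 1 s X (\<lambda>_ _. 0)"
    have "int p dvd bigM X a b" if "a < s * q" "b < s * q" for a b
    proof -
      have "zcong 1 (X (a div q) (b div q)) 0" using X that div_mod_lt unfolding mcong_def by blast
      then have "int p dvd Rc (X (a div q) (b div q)) (a mod q) (b mod q) - Rc 0 (a mod q) (b mod q)"
        unfolding zcong_def power_one_right by (intro Rc_dvd) blast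
      then show ?thesis by (simp add: bigM_def)
    qed
    then have "rnorm p (Lk M (fdet (s * q) (\<lambda>i j. tone i j - bigM X i j))
      + (\<Sum>\<nu>=1..M. of_int (\<Sum>i<s * q. tpow (s * q) (bigM X) \<nu> i i) / of_nat \<nu>)) \<le> e * c"
      using M0[rule_format, OF M, of "s * q" "bigM X"] by blast
    moreover have "fdet (s * q) (\<lambda>i j. tone i j - bigM X i j) = qdet s (\<lambda>i j. tone i j - X i j)"
      unfolding qdet_def by (rule fdet_cong) (simp add: bigM_diff bigM_tone)
    moreover have "(\<Sum>i<s * q. tpow (s * q) (bigM X) \<nu> i i) = int q * (\<Sum>i<s. coefN (tpow s X \<nu> i i))" for \<nu>
      unfolding bigM_tpow[symmetric] by (rule bigM_trace)
    ultimately have "rnorm p (Lk M (qdet s (\<lambda>i j. tone i j - X i j))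
      + (\<Sum>\<nu>=1..M. of_int (int q * (\<Sum>i<s. coefN (tpow s X \<nu> i i))) / of_nat \<nu>)) \<le> e * c" by simp
    also have "Lk M (qdet s (\<lambda>i j. tone i j - X i j))
      + (\<Sum>\<nu>=1..M. of_int (int q * (\<Sum>i<s. coefN (tpow s X \<nu> i i))) / of_nat \<nu>)
      = of_nat q * (Lk M (qdet s (\<lambda>i j. tone i j - X i j)) / of_nat q
      + (\<Sum>\<nu>=1..M. of_int (\<Sum>i<s. coefN (tpow s X \<nu> i i)) / of_nat \<nu>))"
      using q0 by (simp add: distrib_left sum_distrib_left mult.assoc)
    finally show "rnorm p (Lk M (qdet s (\<lambda>i j. tone i j - X i j)) / of_nat q
      + (\<Sum>\<nu>=1..M. of_int (\<Sum>i<s. coefN (tpow s X \<nu> i i)) / of_nat \<nu>)) \<le> e"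
      using c unfolding rnorm_mult c_def[symmetric] by (simp add: mult.commute)
  qed
qed

subsection \<open>The matrix logarithm\<close>

lemma qp_limI:
  assumes "\<And>k. \<forall>\<^sub>F n in sequentially. capx (X n) (q k) (pe k)"
  shows "pcauchy p q" "capx (qp_of p q) (q k) (pe k)"
proof -
  have le: "rnorm p (q l - q k) \<le> pe k" if "k \<le> l" for k l
  proof -
    have "\<forall>\<^sub>F n in sequentially. rnorm p (q l - q k) \<le> pe k"
      using assms[of k] assms[of l]
    proof eventually_elim
      case (elim n)
      then show ?case using capx_close[OF elim(2,1)] pe_antimono[OF that] by simp
    qed
    then show ?thesis by simp
  qed
  show c: "pcauchy p q" by (rule pcauchyI[OF le pe_tendsto_0])
  show "capx (qp_of p q) (q k) (pe k)" using le by (intro capx_limit[OF c]) auto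
qed

lemma idm_Zp [simp]: "idm (CR :: ('g::group_add c0) rops) i j \<in> c0Zp p"
  by (simp add: idm_def)

lemma one_minus_Zp: "u \<in> Mset CR s \<Longrightarrow> one_minus p s u i j \<in> c0Zp p"
  for u :: "nat \<Rightarrow> nat \<Rightarrow> 'g::group_add c0"
  by (auto simp: one_minus_def Mset_def)

lemma bpow_Zp:
  fixes x :: "nat \<Rightarrow> nat \<Rightarrow> 'g::group_add c0"
  assumes "\<And>i j. x i j \<in> c0Zp p"
  shows "bpow CR s x \<nu> i j \<in> c0Zp p"
proof (induction \<nu> arbitrary: i j)
  case 0
  show ?case by (simp add: bpow_def bid_def)
next
  case (Suc \<nu>)
  have "rsum CR (\<lambda>k. c0_mul p (x i k) (bpow CR s x \<nu> k j)) s \<in> rcar CR"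
    using assms Suc by (intro c0.rsum_closed) simp
  then show ?case by (simp add: bpow_def bmul_def)
qed

lemma mapx_one_minus:
  "mapx m s u \<alpha> \<Longrightarrow> mapx m s (one_minus p s u) (\<lambda>i j. tone i j - \<alpha> i j)"
  for u :: "nat \<Rightarrow> nat \<Rightarrow> 'g::group_add c0"
  unfolding mapx_def one_minus_def
  using zapx_add[OF _ zapx_neg] mapx_idm[of m s] unfolding mapx_def by fastforce

lemma mapx_bpow:
  fixes x :: "nat \<Rightarrow> nat \<Rightarrow> 'g::group_add c0"
  assumes x: "\<And>i j. x i j \<in> c0Zp p" and X: "mapx m s x \<alpha>"
  shows "mapx m s (bpow CR s x \<nu>) (tpow s \<alpha> \<nu>)"
proof (induction \<nu>)
  case 0
  show ?case using mapx_idm[of m s] by (simp add: bpow_def bid_def mapx_def)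
next
  case (Suc \<nu>)
  have "zapx m (bpow CR s x (Suc \<nu>) i j) (tpow s \<alpha> (Suc \<nu>) i j)" if ij: "i < s" "j < s" for i j
  proof -
    have "zapx m (rsum CR (\<lambda>k. c0_mul p (x i k) (bpow CR s x \<nu> k j)) s)
        (\<Sum>k<s. \<alpha> i k * tpow s \<alpha> \<nu> k j)"
      using Suc X ij by (intro zapx_rsum zapx_mul x bpow_Zp) (auto simp: mapx_def)
    then show ?thesis using ij by (simp add: bpow_def bmul_def tpow_Suc tmul_def)
  qed
  then show ?case by (simp add: mapx_def)
qed

text \<open>The n-th partial sum divides by numbers up to n, which enlarges an error p^(-m) at most
  n times.\<close>

lemma log_part_capx_gen:
  assumes "\<And>\<nu>. 1 \<le> \<nu> \<Longrightarrow> \<nu> \<le> n \<Longrightarrow> capx (bpow CR s (one_minus p s u) \<nu> i j g) (b \<nu>) (pe m)"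
    and "real n * pe m \<le> e" "0 < e"
  shows "capx (log_part p s u n i j g) (- (\<Sum>\<nu>=1..n. b \<nu> / of_nat \<nu>)) e"
proof -
  have "capx (foldr (\<lambda>\<nu> acc. c0_add p (c0_smul p (qp_const p (1 / of_nat \<nu>)) (bpow CR s (one_minus p s u) \<nu> i j)) acc)
       ks (c0_zero p) g) (\<Sum>\<nu>\<leftarrow>ks. 1 / of_nat \<nu> * b \<nu>) e" if "set ks \<subseteq> {1..n}" for ks
    using that
  proof (induction ks)
    case Nil
    then show ?case using assms by (simp add: c0_zero_def capx_zero)
  next
    case (Cons \<nu> ks)
    then have \<nu>: "1 \<le> \<nu>" "\<nu> \<le> n" by auto
    have "rnorm p (1 / of_nat \<nu>) * pe m \<le> real n * pe m"
      using rnorm_inverse_of_nat_le[of \<nu>] \<nu> by (intro mult_right_mono) auto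
    then have "rnorm p (1 / of_nat \<nu>) * pe m \<le> e" using assms(2) by linarith
    then have "capx (qp_mul p (qp_const p (1 / of_nat \<nu>)) (bpow CR s (one_minus p s u) \<nu> i j g)) (1 / of_nat \<nu> * b \<nu>) e"
      using assms \<nu> by (intro capx_cmul[of _ _ "pe m"]) auto
    then show ?case using Cons assms by (simp add: c0_add_def c0_smul_def capx_add)
  qed
  from this[of "[1..<Suc n]"]
  have "capx (foldr (\<lambda>\<nu> acc. c0_add p (c0_smul p (qp_const p (1 / of_nat \<nu>)) (bpow CR s (one_minus p s u) \<nu> i j)) acc)
       [1..<Suc n] (c0_zero p) g) (\<Sum>\<nu>=1..n. b \<nu> / of_nat \<nu>) e"
    by (auto simp: interv_sum_list_conv_sum_set_nat atLeastLessThanSuc_atLeastAtMost simp del: upt_Suc)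
  from capx_neg[OF this assms(3)] show ?thesis by (simp add: log_part_def c0_neg_def del: upt_Suc)
qed

lemma log_part_capx:
  fixes u :: "nat \<Rightarrow> nat \<Rightarrow> 'g::group_add c0"
  assumes u: "u \<in> Mset CR s" and U: "mapx m s u \<alpha>" and e: "real n * pe m \<le> e" "0 < e"
    and ij: "i < s" "j < s"
  shows "capx (log_part p s u n i j g)
    (- (\<Sum>\<nu>=1..n. of_int (lookup (tpow s (\<lambda>i j. tone i j - \<alpha> i j) \<nu> i j) g) / of_nat \<nu>)) e"
proof (rule log_part_capx_gen[OF _ e])
  fix \<nu>
  have "mapx m s (bpow CR s (one_minus p s u) \<nu>) (tpow s (\<lambda>i j. tone i j - \<alpha> i j) \<nu>)"
    by (intro mapx_bpow one_minus_Zp[OF u] mapx_one_minus U)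
  then show "capx (bpow CR s (one_minus p s u) \<nu> i j g)
      (of_int (lookup (tpow s (\<lambda>i j. tone i j - \<alpha> i j) \<nu> i j) g)) (pe m)"
    using ij unfolding mapx_def zapx_def by blast
qed

text \<open>Terms beyond K are small by their own size; the first K terms agree modulo p^m, and
  division by \<nu> \<le> K costs at most the factor K. A long partial sum is thereby compared with
  a short one that is built from a coarser approximant.\<close>

lemma tail_approx:
  assumes a: "\<And>\<nu>. 1 \<le> \<nu> \<Longrightarrow> \<nu> \<le> n \<Longrightarrow> rnorm p (a \<nu>) \<le> pe \<nu>"
    and ab: "\<And>\<nu>. 1 \<le> \<nu> \<Longrightarrow> \<nu> \<le> K \<Longrightarrow> rnorm p (a \<nu> - b \<nu>) \<le> pe m"
    and K: "\<And>\<nu>. K \<le> \<nu> \<Longrightarrow> real \<nu> * pe \<nu> \<le> e" and m: "real K * pe m \<le> e" and n: "K \<le> n"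
  shows "rnorm p ((\<Sum>\<nu>=1..n. a \<nu> / of_nat \<nu>) - (\<Sum>\<nu>=1..K. b \<nu> / of_nat \<nu>)) \<le> e"
proof -
  have e: "0 \<le> e" by (rule order_trans[OF _ m]) simp
  have "{1..n} = {1..K} \<union> {Suc K..n}" "{1..K} \<inter> {Suc K..n} = {}" using n by auto
  then have "(\<Sum>\<nu>=1..n. a \<nu> / of_nat \<nu>) = (\<Sum>\<nu>=1..K. a \<nu> / of_nat \<nu>) + (\<Sum>\<nu>=Suc K..n. a \<nu> / of_nat \<nu>)"
    by (simp add: sum.union_disjoint)
  then have eq: "(\<Sum>\<nu>=1..n. a \<nu> / of_nat \<nu>) - (\<Sum>\<nu>=1..K. b \<nu> / of_nat \<nu>)
    = (\<Sum>\<nu>=1..K. (a \<nu> - b \<nu>) / of_nat \<nu>) + (\<Sum>\<nu>=Suc K..n. a \<nu> / of_nat \<nu>)"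
    by (simp add: diff_divide_distrib sum_subtractf)
  have "rnorm p (\<Sum>\<nu>=Suc K..n. a \<nu> / of_nat \<nu>) \<le> e"
  proof (intro rnorm_sum_le e)
    fix \<nu> assume "\<nu> \<in> {Suc K..n}"
    then show "rnorm p (a \<nu> / of_nat \<nu>) \<le> e"
      using rnorm_div_nat_le(1)[OF a[of \<nu>]] K[of \<nu>] by auto
  qed
  moreover have "rnorm p (\<Sum>\<nu>=1..K. (a \<nu> - b \<nu>) / of_nat \<nu>) \<le> e"
  proof (intro rnorm_sum_le e)
    fix \<nu> assume \<nu>: "\<nu> \<in> {1..K}"
    have "rnorm p ((a \<nu> - b \<nu>) * (1 / of_nat \<nu>)) \<le> pe m * real \<nu>"
      using ab[of \<nu>] \<nu> unfolding rnorm_mult by (intro mult_mono rnorm_inverse_of_nat_le) auto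
    also have "\<dots> \<le> real K * pe m" using \<nu> by (simp add: mult.commute mult_right_mono)
    finally show "rnorm p ((a \<nu> - b \<nu>) / of_nat \<nu>) \<le> e" using m by simp
  qed
  ultimately show ?thesis unfolding eq by (intro rnorm_add_le)
qed

text \<open>The cutoff K comes first and the precision m after it. Moreover m >= 1 is arranged so
  that approximants of a matrix in 1 + pM_s are congruent to 1 modulo p.\<close>

lemma ex_tail_bound: "0 < e \<Longrightarrow> \<exists>K m. (\<forall>\<nu>\<ge>K. real \<nu> * pe \<nu> \<le> e) \<and> real K * pe m \<le> e \<and> 1 \<le> m"
proof -
  assume e: "0 < e"
  obtain K where K: "\<forall>\<nu>\<ge>K. real \<nu> * pe \<nu> < e" using ex_pe_times_less[OF e] by blast
  obtain m where m: "pe m < e / (real K + 1)"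
    using ex_pe_less[of "e / (real K + 1)"] e by auto
  have "pe (Suc m) \<le> pe m" by (rule pe_antimono) simp
  then have "(real K + 1) * pe (Suc m) \<le> (real K + 1) * pe m" by (intro mult_left_mono) auto
  moreover have "(real K + 1) * pe m \<le> e" using m by (simp add: field_simps)
  moreover have "real K * pe (Suc m) \<le> (real K + 1) * pe (Suc m)" by (intro mult_right_mono) auto
  ultimately have "real K * pe (Suc m) \<le> e" by linarith
  then show ?thesis using K less_imp_le by (intro exI[of _ K] exI[of _ "Suc m"]) auto
qed

lemma rnorm_lookup_tpow:
  fixes X :: "nat \<Rightarrow> nat \<Rightarrow> 'g::group_add \<Rightarrow>\<^sub>0 int"
  assumes "mcong 1 s X (\<lambda>_ _. 0)" "i < s" "j < s"
  shows "rnorm p (of_int (lookup (tpow s X \<nu> i j) g)) \<le> pe \<nu>"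
  using zcong_tpow_zero[OF assms(1), of \<nu>] assms(2,3)
  by (simp add: rnorm_of_int_le_iff mcong_def zcong_def)

lemma c0_norm_le:
  assumes "\<And>g. a g \<in> Qp p" "\<And>g. qp_norm p (a g) \<le> e"
  shows "0 \<le> c0_norm p a" "c0_norm p a \<le> e"
proof -
  have b: "bdd_above (range (\<lambda>g. qp_norm p (a g)))" using assms(2) by (intro bdd_aboveI2)
  have "0 \<le> qp_norm p (a undefined)" by (intro qp_norm_nonneg assms(1))
  also have "\<dots> \<le> c0_norm p a" unfolding c0_norm_def by (rule cSUP_upper[OF UNIV_I b])
  finally show "0 \<le> c0_norm p a" .
  show "c0_norm p a \<le> e" unfolding c0_norm_def by (rule cSUP_least) (use assms in auto)
qed

lemma c0_norm_ge:
  assumes "\<And>g. qp_norm p (a g) \<le> B"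
  shows "qp_norm p (a g) \<le> c0_norm p a"
  unfolding c0_norm_def using assms by (intro cSUP_upper bdd_aboveI2) auto

lemma c0_set_bounded:
  assumes "a \<in> c0_set p"
  shows "\<exists>B\<ge>1. \<forall>g. qp_norm p (a g) \<le> B"
proof -
  have fin: "finite {g. 1 \<le> qp_norm p (a g)}" using assms by (auto simp: c0_set_def)
  define B where "B = Max (insert 1 ((\<lambda>g. qp_norm p (a g)) ` {g. 1 \<le> qp_norm p (a g)}))"
  have "1 \<le> B" unfolding B_def using fin by (intro Max_ge) auto
  moreover have "qp_norm p (a g) \<le> B" for g
  proof (cases "1 \<le> qp_norm p (a g)")
    case True then show ?thesis unfolding B_def using fin by (intro Max_ge) auto
  qed (use \<open>1 \<le> B\<close> in simp)
  ultimately show ?thesis by blast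
qed

definition is_mlog :: "nat \<Rightarrow> (nat \<Rightarrow> nat \<Rightarrow> 'g::group_add c0) \<Rightarrow> (nat \<Rightarrow> nat \<Rightarrow> 'g c0) \<Rightarrow> bool" where
  "is_mlog s u L \<longleftrightarrow> (\<forall>i j. \<not> (i < s \<and> j < s) \<longrightarrow> L i j = c0_zero p) \<and> (\<forall>i j. L i j \<in> c0_set p) \<and>
      (\<lambda>n. \<Sum>i<s. \<Sum>j<s. c0_norm p (c0_add p (log_part p s u n i j) (c0_neg p (L i j)))) \<longlonglongrightarrow> 0"

text \<open>The second clause is what later arguments use: K and m depend on e only, so one finite
  sum of integral matrix powers describes every coefficient of the logarithm, and of all partial
  sums from K on, up to e.\<close>

lemma mlog_exists:
  fixes u :: "nat \<Rightarrow> nat \<Rightarrow> 'g::group_add c0"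
  assumes u: "u \<in> one_plus_pM p s"
  shows "\<exists>L. is_mlog s u L \<and>
    (\<forall>e K m \<alpha> i j g. 0 < e \<and> (\<forall>\<nu>\<ge>K. real \<nu> * pe \<nu> \<le> e) \<and> real K * pe m \<le> e \<and> 1 \<le> m \<and> mapx m s u \<alpha> \<and> i < s \<and> j < s \<longrightarrow>
      capx (L i j g) (- (\<Sum>\<nu>=1..K. of_int (lookup (tpow s (\<lambda>i j. tone i j - \<alpha> i j) \<nu> i j) g) / of_nat \<nu>)) e \<and>
      (\<forall>n\<ge>K. capx (log_part p s u n i j g) (- (\<Sum>\<nu>=1..K. of_int (lookup (tpow s (\<lambda>i j. tone i j - \<alpha> i j) \<nu> i j) g) / of_nat \<nu>)) e))"
proof -
  note uM = one_plus_pM_Mset[OF u]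
  obtain U where U: "\<And>m. mapx m s u (U m)" using mapx_ex[OF uM] by metis
  define S where "S = (\<lambda>\<alpha> i j (g::'g) n. - (\<Sum>\<nu>=1..n. of_int (lookup (tpow s (\<lambda>i j. tone i j - \<alpha> i j) \<nu> i j) g) / of_nat \<nu>) :: rat)"
  have part: "capx (log_part p s u n i j g) (S \<alpha> i j g K) e"
    if e: "0 < e" "\<forall>\<nu>\<ge>K. real \<nu> * pe \<nu> \<le> e" "real K * pe m \<le> e" "1 \<le> m"
      and \<alpha>: "mapx m s u \<alpha>" and ij: "i < s" "j < s" and n: "K \<le> n" for e K m n \<alpha> i j g
  proof -
    \<comment> \<open>To evaluate the n-th partial sum directly a precision depending on n is
      needed; \<open>tail_approx\<close> then returns to the given approximant \<alpha> and the
      cutoff K.\<close>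
    obtain m1 where m1: "pe m1 < e / (real n + 1)" using ex_pe_less[of "e / (real n + 1)"] e by auto
    define m' where "m' = max m m1"
    have "pe m' \<le> pe m1" by (rule pe_antimono) (simp add: m'_def)
    then have "(real n + 1) * pe m' \<le> (real n + 1) * pe m1" by (intro mult_left_mono) auto
    moreover have "(real n + 1) * pe m1 \<le> e" using m1 by (simp add: field_simps)
    moreover have "real n * pe m' \<le> (real n + 1) * pe m'" by (intro mult_right_mono) auto
    ultimately have m': "real n * pe m' \<le> e" by linarith
    have "capx (log_part p s u n i j g) (S (U m') i j g n) e"
      unfolding S_def by (rule log_part_capx[OF uM U m' e(1) ij])
    moreover have "rnorm p (S (U m') i j g n - S \<alpha> i j g K) \<le> e"
    proof -
      let ?X = "\<lambda>\<alpha> i j. tone i j - \<alpha> i j"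
      have 1: "1 \<le> m'" using e(4) by (simp add: m'_def)
      have "mcong m s (U m') \<alpha>" using mapx_unique[OF mapx_mono[OF U[of m']] \<alpha>] by (simp add: m'_def)
      then have "mcong m s (?X (U m')) (?X \<alpha>)"
        unfolding mcong_def zcong_def
        by (auto simp: lookup_minus) (metis dvd_minus_iff minus_diff_eq)
      then have c: "mcong m s (tpow s (?X (U m')) \<nu>) (tpow s (?X \<alpha>) \<nu>)" for \<nu> by (rule mcong_tpow)
      have "rnorm p ((\<Sum>\<nu>=1..n. of_int (lookup (tpow s (?X (U m')) \<nu> i j) g) / of_nat \<nu>)
        - (\<Sum>\<nu>=1..K. of_int (lookup (tpow s (?X \<alpha>) \<nu> i j) g) / of_nat \<nu>)) \<le> e"
      proof (rule tail_approx[OF _ _ _ e(3) n])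
        show "rnorm p (of_int (lookup (tpow s (?X (U m')) \<nu> i j) g)) \<le> pe \<nu>" for \<nu>
          by (rule rnorm_lookup_tpow[OF one_plus_pM_mcong[OF u U 1] ij])
        show "rnorm p (of_int (lookup (tpow s (?X (U m')) \<nu> i j) g) - of_int (lookup (tpow s (?X \<alpha>) \<nu> i j) g)) \<le> pe m" for \<nu>
          using c[of \<nu>] ij unfolding mcong_def zcong_def by (simp only: rnorm_of_int_le_iff of_int_diff[symmetric])
      qed (use e(2) in blast)
      then show ?thesis unfolding S_def by (simp add: rnorm_minus_commute)
    qed
    ultimately show ?thesis by (rule capx_shift)
  qed
  have "\<forall>k. \<exists>K m. (\<forall>\<nu>\<ge>K. real \<nu> * pe \<nu> \<le> pe k) \<and> real K * pe m \<le> pe k \<and> 1 \<le> m"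
    using ex_tail_bound pe_pos by blast
  then obtain K m where Km: "\<And>k. (\<forall>\<nu>\<ge>K k. real \<nu> * pe \<nu> \<le> pe k) \<and> real (K k) * pe (m k) \<le> pe k \<and> 1 \<le> m k" by metis
  define lam where "lam = (\<lambda>i j g k. S (U (m k)) i j g (K k))"
  have lp: "capx (log_part p s u n i j g) (lam i j g k) (pe k)" if "i < s" "j < s" "K k \<le> n" for i j g k n
    unfolding lam_def by (rule part[OF pe_pos _ _ _ U]) (use Km[of k] that in auto)
  define L where "L = (\<lambda>i j. if i < s \<and> j < s then (\<lambda>g. qp_of p (lam i j g)) else c0_zero p)"
  have ev: "\<forall>\<^sub>F n in sequentially. capx (log_part p s u n i j g) (lam i j g k) (pe k)" if "i < s" "j < s" for i j g k
    using lp[OF that] by (intro eventually_sequentiallyI[of "K k"])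
  have Lc: "capx (L i j g) (lam i j g k) (pe k)" if "i < s" "j < s" for i j g k
    using qp_limI(2)[OF ev[OF that]] that by (simp add: L_def)
  have L0: "L i j \<in> c0_set p" for i j
  proof (cases "i < s \<and> j < s")
    case True
    have Q: "L i j g \<in> Qp p" for g using Lc[of i j g 0] True capx_Qp by blast
    have "finite {g. e \<le> qp_norm p (L i j g)}" if e: "0 < e" for e
    proof -
      obtain k where k: "pe k < e" using ex_pe_less[OF e] by blast
      \<comment> \<open>Outside this finite union of supports the approximating sum is 0, so the
        coefficients of L are at most p^(-k) there.\<close>
      let ?F = "\<Union>\<nu>\<in>{1..K k}. keys (tpow s (\<lambda>i j. tone i j - U (m k) i j) \<nu> i j)"
      have "{g. e \<le> qp_norm p (L i j g)} \<subseteq> ?F"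
      proof (rule ccontr)
        assume "\<not> {g. e \<le> qp_norm p (L i j g)} \<subseteq> ?F"
        then obtain g where g: "e \<le> qp_norm p (L i j g)" "g \<notin> ?F" by blast
        then have "lam i j g k = 0" by (auto simp: lam_def S_def in_keys_iff intro!: sum.neutral)
        then have "qp_norm p (L i j g) \<le> pe k" using qp_norm_leI[OF Lc[of i j g k]] True by simp
        then show False using g(1) k by simp
      qed
      then show ?thesis by (rule finite_subset) auto
    qed
    then show ?thesis using Q by (simp add: c0_set_def)
  next
    case False
    then have "L i j = c0_zero p" unfolding L_def by (rule if_not_P)
    moreover have "(c0_zero p :: 'g c0) \<in> c0Zp p" by simp
    ultimately show ?thesis by (simp add: c0Zp_def)
  qed
  have conv: "(\<lambda>n. \<Sum>i<s. \<Sum>j<s. c0_norm p (c0_add p (log_part p s u n i j) (c0_neg p (L i j)))) \<longlonglongrightarrow> 0"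
  proof (intro tendsto_null_sum)
    fix i j assume "i \<in> {..<s}" "j \<in> {..<s}"
    then have ij: "i < s" "j < s" by auto
    let ?c = "\<lambda>n. c0_norm p (c0_add p (log_part p s u n i j) (c0_neg p (L i j)))"
    show "?c \<longlonglongrightarrow> 0"
    proof (rule tendstoI)
      fix e :: real assume e: "0 < e"
      obtain k where k: "pe k < e" using ex_pe_less[OF e] by blast
      \<comment> \<open>The threshold \<open>K k\<close> does not depend on the group element, so
        the coefficientwise bound passes to the supremum norm.\<close>
      have "0 \<le> ?c n \<and> ?c n \<le> pe k" if n: "K k \<le> n" for n
      proof -
        have "qp_norm p (c0_add p (log_part p s u n i j) (c0_neg p (L i j)) g) \<le> pe k" for g
          unfolding c0_add_def c0_neg_def using lp[OF ij n] Lc[OF ij] by (rule qp_norm_diff_leI) simp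
        moreover have "c0_add p (log_part p s u n i j) (c0_neg p (L i j)) g \<in> Qp p" for g
          using capx_Qp[OF lp[OF ij n, of g]] capx_Qp[OF Lc[OF ij, of g 0]] by (simp add: c0_add_def c0_neg_def)
        ultimately show ?thesis by (intro conjI c0_norm_le) auto
      qed
      then show "\<forall>\<^sub>F n in sequentially. dist (?c n) 0 < e"
        using k by (intro eventually_sequentiallyI[of "K k"]) (force simp: dist_real_def)
    qed
  qed
  have "is_mlog s u L" unfolding is_mlog_def using L0 conv by (auto simp: L_def)
  moreover have "capx (L i j g) (S \<alpha> i j g K') e"
    if e: "0 < e" "\<forall>\<nu>\<ge>K'. real \<nu> * pe \<nu> \<le> e" "real K' * pe m' \<le> e" "1 \<le> m'"
      and \<alpha>: "mapx m' s u \<alpha>" and ij: "i < s" "j < s" for e K' m' \<alpha> i j g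
  proof -
    obtain k where k: "pe k < e" using ex_pe_less[OF e(1)] by blast
    have "capx (log_part p s u (max K' (K k)) i j g) (S \<alpha> i j g K') e"
      by (rule part[OF e \<alpha> ij]) simp
    moreover have "capx (log_part p s u (max K' (K k)) i j g) (lam i j g k) (pe k)"
      by (rule lp[OF ij]) simp
    ultimately have "rnorm p (lam i j g k - S \<alpha> i j g K') \<le> e"
      using capx_close[of _ "lam i j g k" "pe k" "S \<alpha> i j g K'" e] k by auto
    moreover have "capx (L i j g) (lam i j g k) e" using capx_mono[OF Lc[OF ij]] k less_imp_le by blast
    ultimately show ?thesis by (rule capx_shift[rotated])
  qed
  ultimately show ?thesis
    using part unfolding S_def by (intro exI[of _ L] conjI allI impI; blast)
qed

text \<open>\<open>c0_norm\<close> is a supremum, from which bounds on coefficients can be read off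
  only for bounded families. The known logarithm \<open>L0\<close> supplies boundedness: by
  assumption late partial sums are within 1 of it, and both \<open>L0\<close> and the competitor are
  bounded.\<close>

lemma is_mlog_unique:
  fixes u :: "nat \<Rightarrow> nat \<Rightarrow> 'g::group_add c0"
  assumes bound: "\<And>i j n. i < s \<Longrightarrow> j < s \<Longrightarrow> K \<le> n \<Longrightarrow> \<exists>b. \<forall>g. capx (log_part p s u n i j g) (b g) 1 \<and> capx (L0 i j g) (b g) 1"
    and L0: "is_mlog s u L0" and L: "is_mlog s u L" and L': "is_mlog s u L'"
  shows "L = L'"
proof (rule ext, rule ext)
  fix i j
  show "L i j = L' i j"
  proof (cases "i < s \<and> j < s")
    case False
    then show ?thesis using L L' by (auto simp: is_mlog_def)
  next
    case True
    let ?c = "\<lambda>L n i j. c0_norm p (c0_add p (log_part p s u n i j) (c0_neg p (L i j)))"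
    let ?d = "\<lambda>L n i j g. c0_add p (log_part p s u n i j) (c0_neg p (L i j)) g"
    have key: "\<forall>\<^sub>F n in sequentially. \<forall>g. qp_norm p (?d L n i j g) \<le> e \<and> L i j g \<in> Qp p \<and> log_part p s u n i j g \<in> Qp p"
      if L: "is_mlog s u L" and e: "0 < e" for L e
    proof -
      have bdd: "\<exists>B. \<forall>g. qp_norm p (?d L n i j g) \<le> B \<and> ?d L n i j g \<in> Qp p \<and> L i j g \<in> Qp p \<and> log_part p s u n i j g \<in> Qp p"
        if ij: "i < s" "j < s" and n: "K \<le> n" for n i j
      proof -
        have c0: "L i j \<in> c0_set p" "L0 i j \<in> c0_set p" using L L0 by (auto simp: is_mlog_def)
        obtain B where B: "1 \<le> B" "\<And>g. qp_norm p (L i j g) \<le> B" using c0_set_bounded[OF c0(1)] by blast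
        obtain B' where B': "1 \<le> B'" "\<And>g. qp_norm p (L0 i j g) \<le> B'" using c0_set_bounded[OF c0(2)] by blast
        obtain b where b: "\<And>g. capx (log_part p s u n i j g) (b g) 1 \<and> capx (L0 i j g) (b g) 1" using bound[OF ij n] by blast
        have "qp_norm p (?d L n i j g) \<le> max B B'" for g
        proof -
          have l1: "capx (L i j g) 0 (max B B')"
            using B(1) B(2)[of g] c0(1) by (subst qp_norm_le_iff[symmetric]) (auto simp: c0_set_def)
          have l0: "capx (L0 i j g) 0 (max B B')"
            using B'(1) B'(2)[of g] c0(2) by (subst qp_norm_le_iff[symmetric]) (auto simp: c0_set_def)
          have "capx (log_part p s u n i j g) (b g) (max B B')" "capx (L0 i j g) (b g) (max B B')"
            using b[of g] B(1) capx_mono by (auto simp: le_max_iff_disj)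
          moreover have "rnorm p (b g - 0) \<le> max B B'"
            using capx_close[OF \<open>capx (L0 i j g) (b g) _\<close> l0] by simp
          ultimately have "capx (log_part p s u n i j g) 0 (max B B')"
            by (blast intro: capx_shift)
          with l1 show ?thesis
            unfolding c0_add_def c0_neg_def using B(1) by (intro qp_norm_diff_leI) auto
        qed
        moreover have "L i j g \<in> Qp p \<and> log_part p s u n i j g \<in> Qp p" for g
          using c0(1) b[of g] capx_Qp by (auto simp: c0_set_def)
        ultimately show ?thesis by (intro exI[of _ "max B B'"]) (auto simp: c0_add_def c0_neg_def)
      qed
      have "(\<lambda>n. \<Sum>i<s. \<Sum>j<s. ?c L n i j) \<longlonglongrightarrow> 0" using L by (simp add: is_mlog_def)
      from order_tendstoD(2)[OF this e]
      have "\<forall>\<^sub>F n in sequentially. (\<Sum>i<s. \<Sum>j<s. ?c L n i j) < e" .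
      then show ?thesis using eventually_ge_at_top[of K]
      proof eventually_elim
        case (elim n)
        \<comment> \<open>All entries must be nonnegative before a single entry can be bounded by
          the double sum.\<close>
        have nn: "0 \<le> ?c L n i' j'" if ij': "i' < s" "j' < s" for i' j'
        proof -
          obtain B where B: "\<forall>g. qp_norm p (?d L n i' j' g) \<le> B \<and> ?d L n i' j' g \<in> Qp p \<and> L i' j' g \<in> Qp p \<and> log_part p s u n i' j' g \<in> Qp p"
            using bdd[OF ij' elim(2)] ..
          show ?thesis by (rule c0_norm_le(1)[of _ B]) (simp_all add: B)
        qed
        have "?c L n i j \<le> (\<Sum>j<s. ?c L n i j)"
          using True nn by (intro member_le_sum) auto
        also have "\<dots> \<le> (\<Sum>i<s. \<Sum>j<s. ?c L n i j)"
          using True nn by (intro member_le_sum[of i "{..<s}" "\<lambda>i. \<Sum>j<s. ?c L n i j"] sum_nonneg) auto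
        finally have "?c L n i j \<le> e" using elim(1) by simp
        moreover obtain B where B: "\<forall>g. qp_norm p (?d L n i j g) \<le> B \<and> ?d L n i j g \<in> Qp p \<and> L i j g \<in> Qp p \<and> log_part p s u n i j g \<in> Qp p"
          using bdd[OF _ _ elim(2), of i j] True by blast
        moreover have "qp_norm p (?d L n i j g) \<le> ?c L n i j" for g
          by (rule c0_norm_ge[of _ B]) (simp add: B)
        ultimately show ?case using order_trans by meson
      qed
    qed
    show ?thesis
    proof
      fix g
      show "L i j g = L' i j g"
      proof (rule Qp_eqI)
        show Lq: "L i j g \<in> Qp p" "L' i j g \<in> Qp p" using L L' by (auto simp: is_mlog_def c0_set_def)
        fix e :: real assume e: "0 < e"
        have "\<forall>\<^sub>F n in sequentially. \<exists>q. capx (L i j g) q e \<and> capx (L' i j g) q e"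
          using key[OF L e] key[OF L' e]
        proof eventually_elim
          case (elim n)
          then have Q: "log_part p s u n i j g \<in> Qp p"
            and d: "qp_norm p (qp_add p (log_part p s u n i j g) (qp_neg p (L i j g))) \<le> e"
              "qp_norm p (qp_add p (log_part p s u n i j g) (qp_neg p (L' i j g))) \<le> e"
            unfolding c0_add_def c0_neg_def by simp_all
          obtain q where q: "capx (L i j g) q e" using capx_ex[OF Lq(1) e] ..
          obtain q' where q': "capx (L' i j g) q' e" using capx_ex[OF Lq(2) e] ..
          have "capx (log_part p s u n i j g) q e" "capx (log_part p s u n i j g) q' e"
            using capx_of_norm_diff[OF Q q e d(1)] capx_of_norm_diff[OF Q q' e d(2)] .
          then have "rnorm p (q' - q) \<le> e" using capx_close[of _ q' e q e] by simp
          with q' have "capx (L' i j g) q e" by (rule capx_shift)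
          with q show ?case by blast
        qed
        then show "\<exists>q. capx (L i j g) q e \<and> capx (L' i j g) q e" by simp
      qed
    qed
  qed
qed

text \<open>The choice operator in \<open>mlog\<close> is resolved by existence and uniqueness; the
  trace is then a sum of diagonal coefficients at the identity, described by the finite sums of
  \<open>mlog_exists\<close>.\<close>

lemma capx_trlog:
  fixes u :: "nat \<Rightarrow> nat \<Rightarrow> 'g::group_add c0"
  assumes u: "u \<in> one_plus_pM p s"
    and e: "0 < e" "\<forall>\<nu>\<ge>K. real \<nu> * pe \<nu> \<le> e" "real K * pe m \<le> e" "1 \<le> m" and \<alpha>: "mapx m s u \<alpha>"
  shows "capx (trlog p s u)
    (- (\<Sum>\<nu>=1..K. of_int (\<Sum>i<s. lookup (tpow s (\<lambda>i j. tone i j - \<alpha> i j) \<nu> i i) 0) / of_nat \<nu>)) e"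
proof -
  obtain L where L: "is_mlog s u L" and
    LL: "\<forall>e K m \<alpha> i j g. 0 < e \<and> (\<forall>\<nu>\<ge>K. real \<nu> * pe \<nu> \<le> e) \<and> real K * pe m \<le> e \<and> 1 \<le> m \<and> mapx m s u \<alpha> \<and> i < s \<and> j < s \<longrightarrow>
      capx (L i j g) (- (\<Sum>\<nu>=1..K. of_int (lookup (tpow s (\<lambda>i j. tone i j - \<alpha> i j) \<nu> i j) g) / of_nat \<nu>)) e \<and>
      (\<forall>n\<ge>K. capx (log_part p s u n i j g) (- (\<Sum>\<nu>=1..K. of_int (lookup (tpow s (\<lambda>i j. tone i j - \<alpha> i j) \<nu> i j) g) / of_nat \<nu>)) e)"
    using mlog_exists[OF u] by blast
  \<comment> \<open>Precision 1 is enough here, as only boundedness is wanted.\<close>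
  obtain K1 m1 where K1: "\<forall>\<nu>\<ge>K1. real \<nu> * pe \<nu> \<le> 1" "real K1 * pe m1 \<le> 1" "1 \<le> m1"
    using ex_tail_bound[of 1] by auto
  obtain \<alpha>1 where \<alpha>1: "mapx m1 s u \<alpha>1" using mapx_ex[OF one_plus_pM_Mset[OF u]] by blast
  have bound: "\<exists>b. \<forall>g. capx (log_part p s u n i j g) (b g) 1 \<and> capx (L i j g) (b g) 1"
    if "i < s" "j < s" "K1 \<le> n" for i j n
    using LL[rule_format, of 1 K1 m1 \<alpha>1 i j] K1 \<alpha>1 that
    by (intro exI[of _ "\<lambda>g. - (\<Sum>\<nu>=1..K1. of_int (lookup (tpow s (\<lambda>i j. tone i j - \<alpha>1 i j) \<nu> i j) g) / of_nat \<nu>)"]) auto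
  have "mlog p s u = L"
    unfolding mlog_def is_mlog_def[symmetric]
  proof (rule the_equality)
    show "L' = L" if "is_mlog s u L'" for L'
      using bound L that L by (rule is_mlog_unique)
  qed (rule L)
  then have "trlog p s u = qp_fsum p (\<lambda>i. L i i 0) {..<s}" by (simp add: trlog_def)
  moreover have "capx (qp_fsum p (\<lambda>i. L i i 0) {..<s})
      (\<Sum>i<s. - (\<Sum>\<nu>=1..K. of_int (lookup (tpow s (\<lambda>i j. tone i j - \<alpha> i j) \<nu> i i) 0) / of_nat \<nu>)) e"
    using LL[rule_format, of e K m \<alpha>] e \<alpha> by (intro capx_fsum) auto
  moreover have "(\<Sum>i<s. - (\<Sum>\<nu>=1..K. of_int (lookup (tpow s (\<lambda>i j. tone i j - \<alpha> i j) \<nu> i i) 0) / of_nat \<nu>))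
    = - (\<Sum>\<nu>=1..K. of_int (\<Sum>i<s. lookup (tpow s (\<lambda>i j. tone i j - \<alpha> i j) \<nu> i i) 0) / (of_nat \<nu> :: rat))"
    by (simp add: sum_negf sum_divide_distrib) (rule sum.swap)
  ultimately show ?thesis by simp
qed

end

subsection \<open>The logarithmic determinant as a limit over finite quotients\<close>

locale padic_quotients = padic +
  fixes Gs :: "nat \<Rightarrow> 'g::group_add set" and \<kappa> :: "nat \<Rightarrow> 'g \<Rightarrow> nat"
  assumes tends: "tends_to_e Gs"
    and fin_quot: "fin_quot (\<kappa> n) (grp_index (Gs n)) (Gs n)"
begin

abbreviation qi :: "nat \<Rightarrow> nat" where
  "qi n \<equiv> grp_index (Gs n)"

abbreviation dt :: "nat \<Rightarrow> nat \<Rightarrow> (nat \<Rightarrow> nat \<Rightarrow> 'g \<Rightarrow>\<^sub>0 int) \<Rightarrow> int" where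
  "dt n \<equiv> fin_quot.qdet (\<kappa> n) (qi n)"

lemma qi_nz: "(of_nat (qi n) :: rat) \<noteq> 0"
  using fin_quot.q_pos[OF fin_quot, of n] by simp

lemma rnorm_div_qi:
  assumes "0 < e"
  shows "\<exists>M1\<ge>1. \<forall>M\<ge>M1. \<forall>x. rnorm p x \<le> pe M \<longrightarrow> rnorm p (x / of_nat (qi n)) \<le> e"
proof -
  have "rnorm p (of_nat (qi n)) \<noteq> 0" unfolding rnorm_eq_0_iff by (rule qi_nz)
  then have c: "rnorm p (of_nat (qi n)) > 0" using rnorm_nonneg[of "of_nat (qi n)"] by linarith
  then obtain M1 where M1: "pe M1 < e * rnorm p (of_nat (qi n))" using ex_pe_less assms by fastforce
  have "rnorm p (x / of_nat (qi n)) \<le> e" if "Suc M1 \<le> M" "rnorm p x \<le> pe M" for M x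
  proof -
    have "rnorm p x \<le> e * rnorm p (of_nat (qi n))" using that pe_antimono[of M1 M] M1 by simp
    then show ?thesis using c by (simp add: rnorm_divide pos_divide_le_eq)
  qed
  then show ?thesis by (intro exI[of _ "Suc M1"]) auto
qed

lemma rnorm_div_qi_uniform:
  assumes "0 < e"
  obtains M1 where "\<And>n. 1 \<le> M1 n"
    "\<And>n M x. M1 n \<le> M \<Longrightarrow> rnorm p x \<le> pe M \<Longrightarrow> rnorm p (x / of_nat (qi n)) \<le> e"
proof -
  have "\<forall>n. \<exists>M1\<ge>1. \<forall>M\<ge>M1. \<forall>x. rnorm p x \<le> pe M \<longrightarrow> rnorm p (x / of_nat (qi n)) \<le> e"
    using rnorm_div_qi[OF assms] by blast
  then obtain M1 where "\<forall>n. M1 n \<ge> 1 \<and> (\<forall>M\<ge>M1 n. \<forall>x. rnorm p x \<le> pe M \<longrightarrow> rnorm p (x / of_nat (qi n)) \<le> e)"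
    by metis
  then show ?thesis using that[of M1] by blast
qed

text \<open>L is the limit of log det / index over the quotients. The threshold for M may depend on
  n, because division by the index costs as many digits as its valuation. Every approximant \<alpha>
  is allowed, so that the relation concerns A alone.\<close>

definition Rel :: "nat \<Rightarrow> (nat \<Rightarrow> nat \<Rightarrow> 'g c0) \<Rightarrow> qp \<Rightarrow> bool" where
  "Rel s A L \<longleftrightarrow> L \<in> Qp p \<and> (\<forall>e>0. \<exists>n0. \<forall>n\<ge>n0. \<exists>M0. \<forall>M\<ge>M0. \<forall>\<alpha>. mapx M s A \<alpha> \<longrightarrow>
     capx L (Lk M (dt n s \<alpha>) / of_nat (qi n)) e)"

lemma RelD:
  assumes "Rel s A L" "0 < e"
  obtains n0 M0 where "\<And>n M \<alpha>. n \<ge> n0 \<Longrightarrow> M \<ge> M0 n \<Longrightarrow> mapx M s A \<alpha> \<Longrightarrow> capx L (Lk M (dt n s \<alpha>) / of_nat (qi n)) e"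
proof -
  obtain n0 where "\<forall>n\<ge>n0. \<exists>M0. \<forall>M\<ge>M0. \<forall>\<alpha>. mapx M s A \<alpha> \<longrightarrow> capx L (Lk M (dt n s \<alpha>) / of_nat (qi n)) e"
    using assms unfolding Rel_def by blast
  then have "\<forall>n. \<exists>M0. n \<ge> n0 \<longrightarrow> (\<forall>M\<ge>M0. \<forall>\<alpha>. mapx M s A \<alpha> \<longrightarrow> capx L (Lk M (dt n s \<alpha>) / of_nat (qi n)) e)"
    by blast
  then obtain M0 where "\<forall>n. n \<ge> n0 \<longrightarrow> (\<forall>M\<ge>M0 n. \<forall>\<alpha>. mapx M s A \<alpha> \<longrightarrow> capx L (Lk M (dt n s \<alpha>) / of_nat (qi n)) e)"
    by metis
  then show ?thesis using that by blast
qed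

lemma RelI:
  assumes "L \<in> Qp p"
    and "\<And>e. 0 < e \<Longrightarrow> \<exists>n0 M0. \<forall>n\<ge>n0. \<forall>M\<ge>M0 n. \<forall>\<alpha>. mapx M s A \<alpha> \<longrightarrow> capx L (Lk M (dt n s \<alpha>) / of_nat (qi n)) e"
  shows "Rel s A L"
  unfolding Rel_def using assms by meson

lemma GLn_mapx_inverse:
  fixes A :: "nat \<Rightarrow> nat \<Rightarrow> 'h::group_add c0"
  assumes A: "A \<in> GLn CR s" and \<alpha>: "mapx M s A \<alpha>"
  shows "\<exists>\<beta>. mcong M s (tmul s \<alpha> \<beta>) tone"
proof -
  obtain B where AM: "A \<in> Mset CR s" and B: "B \<in> Mset CR s"
    and AB: "mmul CR A B = idm CR" using A unfolding GLn_iff by blast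
  obtain \<beta> where "mapx M s B \<beta>" using mapx_ex[OF B] by blast
  from mapx_mmul[OF AM B \<alpha> this] have "mapx M s (idm CR) (tmul s \<alpha> \<beta>)" unfolding AB .
  then show ?thesis using mapx_unique[OF _ mapx_idm] by blast
qed

lemma dt_coprime:
  assumes "A \<in> GLn CR s" "mapx M s A \<alpha>" "1 \<le> M"
  shows "coprime (dt n s \<alpha>) (int p)"
  using GLn_mapx_inverse[OF assms(1,2)] qdet_coprime[OF fin_quot _ assms(3)] by blast

lemma rnorm_Lk_dt_cong:
  assumes "mcong M s \<alpha> \<beta>" "1 \<le> M"
  shows "rnorm p (Lk M (dt n s \<alpha>) - Lk M (dt n s \<beta>)) \<le> pe M"
  by (rule rnorm_Lk_diff[OF assms(2) qdet_dvd[OF fin_quot assms(1)]])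

lemma dt_extend:
  assumes "s \<le> t"
  shows "dt n t (\<lambda>i j. if i < s \<and> j < s then \<alpha> i j else tone i j) = dt n s \<alpha>"
proof -
  interpret fin_quot "\<kappa> n" "qi n" "Gs n" by (rule fin_quot)
  have "dt n t (\<lambda>i j. if i < s \<and> j < s then \<alpha> i j else tone i j)
    = dt n s (\<lambda>i j. if i < s \<and> j < s then \<alpha> i j else tone i j)"
    by (rule qdet_stable[OF assms]) auto
  also have "\<dots> = dt n s \<alpha>" by (rule qdet_cong) simp
  finally show ?thesis .
qed

lemma mapx_extend:
  fixes A :: "nat \<Rightarrow> nat \<Rightarrow> 'g c0"
  assumes A: "A \<in> Mset CR s" and "mapx M s A \<alpha>"
  shows "mapx M t A (\<lambda>i j. if i < s \<and> j < s then \<alpha> i j else tone i j)"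
  unfolding mapx_def
proof (intro allI impI)
  fix i j
  have "zapx M (idm (CR :: ('g c0) rops) i j) (tone i j :: 'g \<Rightarrow>\<^sub>0 int)"
    by (simp add: idm_def tone_def zapx_zero zapx_one)
  moreover have "A i j = idm CR i j" if "\<not> (i < s \<and> j < s)"
    using A that by (auto simp: Mset_def fin_id_def not_less)
  ultimately show "zapx M (A i j) (if i < s \<and> j < s then \<alpha> i j else tone i j)"
    using assms(2) by (auto simp: mapx_def)
qed

text \<open>Extending by the identity does not change the determinants. An approximant of the larger
  block is congruent modulo p^M to the extension of its restriction, so the logarithms differ by at
  most p^(-M), which a large M makes harmless after division by the index.\<close>

lemma Rel_block_iff:
  assumes A: "A \<in> Mset CR s" and st: "s \<le> t"
  shows "Rel s A L \<longleftrightarrow> Rel t A L"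
proof
  assume R: "Rel s A L"
  show "Rel t A L"
  proof (rule RelI)
    show "L \<in> Qp p" using R by (simp add: Rel_def)
    fix e :: real assume e: "0 < e"
    obtain n0 M0 where M0: "\<And>n M \<alpha>. n \<ge> n0 \<Longrightarrow> M \<ge> M0 n \<Longrightarrow> mapx M s A \<alpha> \<Longrightarrow> capx L (Lk M (dt n s \<alpha>) / of_nat (qi n)) e"
      using RelD[OF R e] by metis
    obtain M1 where M1a: "\<And>n. 1 \<le> M1 n"
      and M1: "\<And>n M x. M1 n \<le> M \<Longrightarrow> rnorm p x \<le> pe M \<Longrightarrow> rnorm p (x / of_nat (qi n)) \<le> e"
      using rnorm_div_qi_uniform[OF e] by blast
    have "capx L (Lk M (dt n t \<alpha>) / of_nat (qi n)) e" if n: "n \<ge> n0" and M: "M \<ge> max (M0 n) (M1 n)" and \<alpha>: "mapx M t A \<alpha>" for n M \<alpha>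
    proof -
      have \<alpha>s: "mapx M s A \<alpha>" using \<alpha> st by (auto simp: mapx_def)
      have "mcong M t (\<lambda>i j. if i < s \<and> j < s then \<alpha> i j else tone i j) \<alpha>"
        by (rule mapx_unique[OF mapx_extend[OF A \<alpha>s] \<alpha>])
      moreover have "1 \<le> M" using M1a[of n] M by auto
      ultimately have "rnorm p (Lk M (dt n s \<alpha>) - Lk M (dt n t \<alpha>)) \<le> pe M"
        unfolding dt_extend[OF st, of n \<alpha>, symmetric] by (rule rnorm_Lk_dt_cong)
      then have "rnorm p (Lk M (dt n s \<alpha>) / of_nat (qi n) - Lk M (dt n t \<alpha>) / of_nat (qi n)) \<le> e"
        using M1[of n M] M by (simp add: diff_divide_distrib[symmetric])
      moreover have "capx L (Lk M (dt n s \<alpha>) / of_nat (qi n)) e" using M0[OF n _ \<alpha>s] M by simp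
      ultimately show ?thesis by (blast intro: capx_shift)
    qed
    then show "\<exists>n0 M0. \<forall>n\<ge>n0. \<forall>M\<ge>M0 n. \<forall>\<alpha>. mapx M t A \<alpha> \<longrightarrow> capx L (Lk M (dt n t \<alpha>) / of_nat (qi n)) e"
      by (intro exI[of _ n0] exI[of _ "\<lambda>n. max (M0 n) (M1 n)"]) blast
  qed
next
  assume R: "Rel t A L"
  show "Rel s A L"
  proof (rule RelI)
    show "L \<in> Qp p" using R by (simp add: Rel_def)
    fix e :: real assume e: "0 < e"
    obtain n0 M0 where M0: "\<And>n M \<alpha>. n \<ge> n0 \<Longrightarrow> M \<ge> M0 n \<Longrightarrow> mapx M t A \<alpha> \<Longrightarrow> capx L (Lk M (dt n t \<alpha>) / of_nat (qi n)) e"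
      using RelD[OF R e] by metis
    have "capx L (Lk M (dt n s \<alpha>) / of_nat (qi n)) e" if "n \<ge> n0" "M \<ge> M0 n" "mapx M s A \<alpha>" for n M \<alpha>
      using M0[OF that(1,2) mapx_extend[OF A that(3)]] by (simp add: dt_extend[OF st])
    then show "\<exists>n0 M0. \<forall>n\<ge>n0. \<forall>M\<ge>M0 n. \<forall>\<alpha>. mapx M s A \<alpha> \<longrightarrow> capx L (Lk M (dt n s \<alpha>) / of_nat (qi n)) e"
      by blast
  qed
qed

lemma Rel_unique:
  assumes A: "A \<in> Mset CR s" and R: "Rel s A L" and R': "Rel s A L'"
  shows "L = L'"
proof (rule Qp_eqI)
  show "L \<in> Qp p" "L' \<in> Qp p" using R R' by (auto simp: Rel_def)
  fix e :: real assume e: "0 < e"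
  obtain n0 M0 where M0: "\<And>n M \<alpha>. n \<ge> n0 \<Longrightarrow> M \<ge> M0 n \<Longrightarrow> mapx M s A \<alpha> \<Longrightarrow> capx L (Lk M (dt n s \<alpha>) / of_nat (qi n)) e"
    using RelD[OF R e] by metis
  obtain n1 M1 where M1: "\<And>n M \<alpha>. n \<ge> n1 \<Longrightarrow> M \<ge> M1 n \<Longrightarrow> mapx M s A \<alpha> \<Longrightarrow> capx L' (Lk M (dt n s \<alpha>) / of_nat (qi n)) e"
    using RelD[OF R' e] by metis
  define n where "n = max n0 n1"
  define M where "M = max (M0 n) (M1 n)"
  obtain \<alpha> where "mapx M s A \<alpha>" using mapx_ex[OF A] by blast
  then have "capx L (Lk M (dt n s \<alpha>) / of_nat (qi n)) e" "capx L' (Lk M (dt n s \<alpha>) / of_nat (qi n)) e"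
    using M0[of n M \<alpha>] M1[of n M \<alpha>] by (auto simp: n_def M_def)
  then show "\<exists>q. capx L q e \<and> capx L' q e" by blast
qed

text \<open>Determinants multiply exactly and \<open>Lk M\<close> is additive up to p^(-M). Since M
  is chosen after n, this error stays below e when divided by the index.\<close>

lemma Rel_mmul:
  assumes A: "A \<in> GLn CR s" and B: "B \<in> GLn CR s"
    and RA: "Rel s A L" and RB: "Rel s B L'"
  shows "Rel s (mmul CR A B) (qp_add p L L')"
proof (rule RelI)
  have Q: "L \<in> Qp p" "L' \<in> Qp p" using RA RB by (auto simp: Rel_def)
  then show "qp_add p L L' \<in> Qp p" by simp
  have AM: "A \<in> Mset CR s" and BM: "B \<in> Mset CR s" using A B by (auto simp: GLn_iff)
  fix e :: real assume e: "0 < e"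
  obtain n0 M0 where M0: "\<And>n M \<alpha>. n \<ge> n0 \<Longrightarrow> M \<ge> M0 n \<Longrightarrow> mapx M s A \<alpha> \<Longrightarrow> capx L (Lk M (dt n s \<alpha>) / of_nat (qi n)) e"
    using RelD[OF RA e] by metis
  obtain n1 M1 where M1: "\<And>n M \<alpha>. n \<ge> n1 \<Longrightarrow> M \<ge> M1 n \<Longrightarrow> mapx M s B \<alpha> \<Longrightarrow> capx L' (Lk M (dt n s \<alpha>) / of_nat (qi n)) e"
    using RelD[OF RB e] by metis
  obtain M2 where M2a: "\<And>n. 1 \<le> M2 n"
    and M2: "\<And>n M x. M2 n \<le> M \<Longrightarrow> rnorm p x \<le> pe M \<Longrightarrow> rnorm p (x / of_nat (qi n)) \<le> e"
    using rnorm_div_qi_uniform[OF e] by blast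
  have "capx (qp_add p L L') (Lk M (dt n s \<gamma>) / of_nat (qi n)) e"
    if n: "n \<ge> max n0 n1" and M: "M \<ge> max (M2 n) (max (M0 n) (M1 n))"
      and \<gamma>: "mapx M s (mmul CR A B) \<gamma>" for n M \<gamma>
  proof -
    obtain \<alpha> where \<alpha>: "mapx M s A \<alpha>" using mapx_ex[OF AM] by blast
    obtain \<beta> where \<beta>: "mapx M s B \<beta>" using mapx_ex[OF BM] by blast
    have M': "1 \<le> M" using M2a[of n] M by auto
    have "mcong M s (tmul s \<alpha> \<beta>) \<gamma>" by (rule mapx_unique[OF mapx_mmul[OF AM BM \<alpha> \<beta>] \<gamma>])
    then have "rnorm p (Lk M (dt n s (tmul s \<alpha> \<beta>)) - Lk M (dt n s \<gamma>)) \<le> pe M"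
      using M' by (rule rnorm_Lk_dt_cong)
    moreover have "rnorm p ((Lk M (dt n s \<alpha>) + Lk M (dt n s \<beta>)) - Lk M (dt n s (tmul s \<alpha> \<beta>))) \<le> pe M"
      unfolding fin_quot.qdet_tmul[OF fin_quot]
      by (subst rnorm_minus_commute) (intro rnorm_Lk_mult dt_coprime[OF A \<alpha> M'] dt_coprime[OF B \<beta> M'])
    ultimately have "rnorm p ((Lk M (dt n s \<alpha>) + Lk M (dt n s \<beta>)) - Lk M (dt n s \<gamma>)) \<le> pe M"
      using rnorm_triangle by blast
    then have "rnorm p (((Lk M (dt n s \<alpha>) + Lk M (dt n s \<beta>)) - Lk M (dt n s \<gamma>)) / of_nat (qi n)) \<le> e"
      using M2[of n M] M by simp
    then have "rnorm p ((Lk M (dt n s \<alpha>) / of_nat (qi n) + Lk M (dt n s \<beta>) / of_nat (qi n)) - Lk M (dt n s \<gamma>) / of_nat (qi n)) \<le> e"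
      by (simp add: diff_divide_distrib add_divide_distrib)
    moreover have "capx (qp_add p L L') (Lk M (dt n s \<alpha>) / of_nat (qi n) + Lk M (dt n s \<beta>) / of_nat (qi n)) e"
      using n M by (intro capx_add e M0 M1 \<alpha> \<beta>) auto
    ultimately show ?thesis by (blast intro: capx_shift)
  qed
  then show "\<exists>n0 M0. \<forall>n\<ge>n0. \<forall>M\<ge>M0 n. \<forall>\<alpha>. mapx M s (mmul CR A B) \<alpha> \<longrightarrow>
      capx (qp_add p L L') (Lk M (dt n s \<alpha>) / of_nat (qi n)) e"
    by (intro exI[of _ "max n0 n1"] exI[of _ "\<lambda>n. max (M2 n) (max (M0 n) (M1 n))"]) blast
qed

text \<open>An integral approximant with an exact integral inverse has determinant 1 or -1 on every
  quotient, and \<open>Lk\<close> vanishes at both for M >= 1.\<close>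

lemma Rel_unit:
  assumes "\<And>M. \<exists>\<alpha> \<beta>. mapx M s A \<alpha> \<and> (\<forall>i<s. \<forall>j<s. tmul s \<alpha> \<beta> i j = tone i j)"
  shows "Rel s A (qp_zero p)"
proof (rule RelI)
  fix e :: real assume e: "0 < e"
  obtain M1 where M1a: "\<And>n. 1 \<le> M1 n"
    and M1: "\<And>n M x. M1 n \<le> M \<Longrightarrow> rnorm p x \<le> pe M \<Longrightarrow> rnorm p (x / of_nat (qi n)) \<le> e"
    using rnorm_div_qi_uniform[OF e] by blast
  have "capx (qp_zero p) (Lk M (dt n s \<gamma>) / of_nat (qi n)) e" if M: "M \<ge> M1 n" and \<gamma>: "mapx M s A \<gamma>" for n M \<gamma>
  proof -
    interpret fin_quot "\<kappa> n" "qi n" "Gs n" by (rule fin_quot)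
    obtain \<alpha> \<beta> where \<alpha>: "mapx M s A \<alpha>" and \<beta>: "\<And>i j. i < s \<Longrightarrow> j < s \<Longrightarrow> tmul s \<alpha> \<beta> i j = tone i j"
      using assms by blast
    have M': "1 \<le> M" using M1a[of n] M by auto
    have "dt n s \<alpha> = 1 \<or> dt n s \<alpha> = -1" by (rule qdet_unit[OF \<beta>])
    then have "Lk M (dt n s \<alpha>) = 0" using Lk_minus_one[OF M'] by auto
    moreover have "rnorm p (Lk M (dt n s \<alpha>) - Lk M (dt n s \<gamma>)) \<le> pe M"
      by (rule rnorm_Lk_dt_cong[OF mapx_unique[OF \<alpha> \<gamma>] M'])
    ultimately have "rnorm p (Lk M (dt n s \<gamma>)) \<le> pe M" by simp
    then have "rnorm p (Lk M (dt n s \<gamma>) / of_nat (qi n)) \<le> e" using M1[of n M] M by simp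
    then show ?thesis using capx_shift[OF capx_zero[OF e], of "Lk M (dt n s \<gamma>) / of_nat (qi n)"] by simp
  qed
  then show "\<exists>n0 M0. \<forall>n\<ge>n0. \<forall>M\<ge>M0 n. \<forall>\<alpha>. mapx M s A \<alpha> \<longrightarrow> capx (qp_zero p) (Lk M (dt n s \<alpha>) / of_nat (qi n)) e"
    by (intro exI[of _ 0] exI[of _ M1]) blast
qed simp

lemma Rel_elem:
  assumes "i \<noteq> j" "i < s" "j < s" "a \<in> c0Zp p"
  shows "Rel s (Defs.elem CR i j a) (qp_zero p)"
proof (rule Rel_unit)
  fix M
  obtain \<alpha> where "zapx M a \<alpha>" using c0Zp_zapx[OF assms(4)] by blast
  then show "\<exists>\<alpha> \<beta>. mapx M s (Defs.elem CR i j a) \<alpha> \<and> (\<forall>i<s. \<forall>j<s. tmul s \<alpha> \<beta> i j = tone i j)"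
    using mapx_elem[of M a \<alpha> s i j] tmul_telem[OF assms(1-3), of _ _ \<alpha>] by blast
qed

lemma Rel_gmat: "Rel s (gmat CR (c0_grp p g)) (qp_zero p)"
proof (rule Rel_unit)
  fix M
  show "\<exists>\<alpha> \<beta>. mapx M s (gmat CR (c0_grp p g)) \<alpha> \<and> (\<forall>i<s. \<forall>j<s. tmul s \<alpha> \<beta> i j = tone i j)"
    using mapx_gmat[OF zapx_grp] tmul_tgmat[OF single_inverse(1)] by blast
qed

lemma mapx_mpow:
  assumes A: "A \<in> Mset CR s" and \<alpha>: "mapx M s A \<alpha>"
  shows "mapx M s (mpow CR A N) (tpow s \<alpha> N)"
proof (induction N)
  case 0
  then show ?case using mapx_idm by (simp add: mpow_def)
next
  case (Suc N)
  have "mapx M s (mmul CR A (mpow CR A N)) (tmul s \<alpha> (tpow s \<alpha> N))"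
    by (rule mapx_mmul[OF A mpow_Mset[OF A] \<alpha> Suc])
  then show ?case by (simp add: mpow_def tpow_Suc)
qed

lemma qdet_tpow: "dt n s (tpow s \<alpha> N) = dt n s \<alpha> ^ N"
proof -
  interpret fin_quot "\<kappa> n" "qi n" "Gs n" by (rule fin_quot)
  show ?thesis by (induction N) (simp_all add: tpow_Suc qdet_tmul)
qed

text \<open>Division by N may lose digits when p divides N, hence the precision e times the absolute
  value of N for the power.\<close>

lemma Rel_root:
  assumes A: "A \<in> GLn CR s" and N: "0 < N" and R: "Rel s (mpow CR A N) L"
  shows "Rel s A (qp_mul p (qp_const p (1 / of_nat N)) L)"
proof (rule RelI)
  have Q: "L \<in> Qp p" using R by (auto simp: Rel_def)
  then show "qp_mul p (qp_const p (1 / of_nat N)) L \<in> Qp p" by simp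
  have AM: "A \<in> Mset CR s" using A by (auto simp: GLn_iff)
  define c where "c = rnorm p (of_nat N)"
  have "c \<noteq> 0" unfolding c_def rnorm_eq_0_iff using N by simp
  then have c: "0 < c" using rnorm_nonneg[of "of_nat N"] unfolding c_def by linarith
  fix e :: real assume e: "0 < e"
  then have ec: "0 < e * c" using c by simp
  obtain n0 M0 where M0: "\<And>n M \<alpha>. n \<ge> n0 \<Longrightarrow> M \<ge> M0 n \<Longrightarrow> mapx M s (mpow CR A N) \<alpha> \<Longrightarrow>
      capx L (Lk M (dt n s \<alpha>) / of_nat (qi n)) (e * c)"
    using RelD[OF R ec] by metis
  obtain M1 where M1a: "\<And>n. 1 \<le> M1 n"
    and M1: "\<And>n M x. M1 n \<le> M \<Longrightarrow> rnorm p x \<le> pe M \<Longrightarrow> rnorm p (x / of_nat (qi n)) \<le> e * c"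
    using rnorm_div_qi_uniform[OF ec] by blast
  have "capx (qp_mul p (qp_const p (1 / of_nat N)) L) (Lk M (dt n s \<alpha>) / of_nat (qi n)) e"
    if n: "n \<ge> n0" and M: "M \<ge> max (M0 n) (M1 n)" and \<alpha>: "mapx M s A \<alpha>" for n M \<alpha>
  proof -
    have M': "1 \<le> M" using M1a[of n] M by auto
    have "capx L (Lk M (dt n s \<alpha> ^ N) / of_nat (qi n)) (e * c)"
      using M0[OF n _ mapx_mpow[OF AM \<alpha>]] M by (simp add: qdet_tpow)
    moreover have "rnorm p (Lk M (dt n s \<alpha> ^ N) - of_nat N * Lk M (dt n s \<alpha>)) \<le> pe M"
      by (rule rnorm_Lk_power[OF dt_coprime[OF A \<alpha> M']])
    then have "rnorm p ((Lk M (dt n s \<alpha> ^ N) - of_nat N * Lk M (dt n s \<alpha>)) / of_nat (qi n)) \<le> e * c"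
      using M1[of n M] M by simp
    then have "rnorm p (Lk M (dt n s \<alpha> ^ N) / of_nat (qi n) - of_nat N * Lk M (dt n s \<alpha>) / of_nat (qi n)) \<le> e * c"
      by (simp add: diff_divide_distrib)
    ultimately have "capx L (of_nat N * Lk M (dt n s \<alpha>) / of_nat (qi n)) (e * c)" by (rule capx_shift)
    then have "capx (qp_mul p (qp_const p (1 / of_nat N)) L) (1 / of_nat N * (of_nat N * Lk M (dt n s \<alpha>) / of_nat (qi n))) e"
      using ec e by (rule capx_cmul) (use c in \<open>simp add: rnorm_divide c_def[symmetric]\<close>)
    then show ?thesis using N by simp
  qed
  then show "\<exists>n0 M0. \<forall>n\<ge>n0. \<forall>M\<ge>M0 n. \<forall>\<alpha>. mapx M s A \<alpha> \<longrightarrow>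
      capx (qp_mul p (qp_const p (1 / of_nat N)) L) (Lk M (dt n s \<alpha>) / of_nat (qi n)) e"
    by (intro exI[of _ n0] exI[of _ "\<lambda>n. max (M0 n) (M1 n)"]) blast
qed

text \<open>Each of the finitely many non-identity elements of F lies in finitely many subgroups
  only, so from some n on the subgroup meets F in at most the identity.\<close>

lemma coefN_eventually:
  assumes "finite F"
  shows "\<exists>n0. \<forall>n\<ge>n0. \<forall>\<alpha> :: 'g \<Rightarrow>\<^sub>0 int. keys \<alpha> \<subseteq> F \<longrightarrow> fin_quot.coefN (Gs n) \<alpha> = lookup \<alpha> 0"
proof -
  have "finite (\<Union>g\<in>F - {0}. {n. g \<in> Gs n})"
    using tends assms by (auto simp: tends_to_e_def)
  then obtain n0 where "\<forall>n\<in>(\<Union>g\<in>F - {0}. {n. g \<in> Gs n}). n < n0"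
    unfolding finite_nat_set_iff_bounded ..
  then have n0: "n \<in> (\<Union>g\<in>F - {0}. {n. g \<in> Gs n}) \<Longrightarrow> n < n0" for n by (rule bspec)
  have "fin_quot.coefN (Gs n) \<alpha> = lookup \<alpha> 0" if n: "n \<ge> n0" and F: "keys \<alpha> \<subseteq> F" for n and \<alpha> :: "'g \<Rightarrow>\<^sub>0 int"
  proof -
    interpret fin_quot "\<kappa> n" "qi n" "Gs n" by (rule fin_quot)
    have "0 \<in> Gs n" using tends by (auto simp: tends_to_e_def normal_fi_def)
    moreover have "g \<notin> Gs n" if "g \<in> keys \<alpha>" "g \<noteq> 0" for g
      using n0[of n] n F that by force
    ultimately have "coefN \<alpha> = (\<Sum>g\<in>keys \<alpha>. if g = 0 then lookup \<alpha> 0 else 0)"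
      unfolding coefN_def by (intro sum.cong) auto
    then show ?thesis by (simp add: in_keys_iff)
  qed
  then show ?thesis by blast
qed

text \<open>The order of choices matters: cutoff K, precision m and approximant
  \<open>\<alpha>0\<close> depend on e only; they determine a finite set of group elements and hence
  n0; only then comes the precision M for the individual quotient.\<close>

lemma Rel_trlog:
  assumes u: "u \<in> one_plus_pM p s"
  shows "Rel s u (trlog p s u)"
proof (rule RelI)
  note uM = one_plus_pM_Mset[OF u]
  let ?X = "\<lambda>\<alpha> i j. tone i j - \<alpha> i j :: 'g \<Rightarrow>\<^sub>0 int"
  have tr: "capx (trlog p s u) (- (\<Sum>\<nu>=1..K. of_int (\<Sum>i<s. lookup (tpow s (?X \<alpha>) \<nu> i i) 0) / of_nat \<nu>)) e"
    if "0 < e" "\<forall>\<nu>\<ge>K. real \<nu> * pe \<nu> \<le> e" "real K * pe m \<le> e" "1 \<le> m" "mapx m s u \<alpha>" for e K m \<alpha>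
    using that by (rule capx_trlog[OF u])
  show "trlog p s u \<in> Qp p"
  proof -
    obtain K m where K: "\<forall>\<nu>\<ge>K. real \<nu> * pe \<nu> \<le> 1" and m: "real K * pe m \<le> 1" "1 \<le> m"
      using ex_tail_bound[of 1] by auto
    obtain \<alpha>0 where "mapx m s u \<alpha>0" using mapx_ex[OF uM] by blast
    then show ?thesis using tr[OF _ K m] capx_Qp by fastforce
  qed
  fix e :: real assume e: "0 < e"
  obtain K m where K: "\<forall>\<nu>\<ge>K. real \<nu> * pe \<nu> \<le> e" and m: "real K * pe m \<le> e" "1 \<le> m"
    using ex_tail_bound[OF e] by blast
  obtain \<alpha>0 where \<alpha>0: "mapx m s u \<alpha>0" using mapx_ex[OF uM] by blast
  let ?B = "\<lambda>\<nu>. of_int (\<Sum>i<s. lookup (tpow s (?X \<alpha>0) \<nu> i i) 0) :: rat"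
  note L = tr[OF e K m \<alpha>0]
  \<comment> \<open>All group elements that occur in the truncated series of the fixed approximant;
    on them the trace over the quotient is eventually the coefficient at the identity.\<close>
  let ?F = "\<Union>\<nu>\<in>{1..K}. \<Union>i\<in>{..<s}. keys (tpow s (?X \<alpha>0) \<nu> i i)"
  have "finite ?F" by auto
  from coefN_eventually[OF this] obtain n0 where
    n0: "\<forall>n\<ge>n0. \<forall>\<alpha> :: 'g \<Rightarrow>\<^sub>0 int. keys \<alpha> \<subseteq> ?F \<longrightarrow> fin_quot.coefN (Gs n) \<alpha> = lookup \<alpha> 0" ..
  have "\<forall>n. \<exists>M0. \<forall>M\<ge>M0. \<forall>X :: nat \<Rightarrow> nat \<Rightarrow> 'g \<Rightarrow>\<^sub>0 int. mcong 1 s X (\<lambda>_ _. 0) \<longrightarrow>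
    rnorm p (Lk M (dt n s (\<lambda>i j. tone i j - X i j)) / of_nat (qi n)
    + (\<Sum>\<nu>=1..M. of_int (\<Sum>i<s. fin_quot.coefN (Gs n) (tpow s X \<nu> i i)) / of_nat \<nu>)) \<le> e"
    by (rule allI) (rule Lk_qdet_approx[OF fin_quot e])
  from choice[OF this] obtain M1 where M1: "\<forall>n. \<forall>M\<ge>M1 n. \<forall>X :: nat \<Rightarrow> nat \<Rightarrow> 'g \<Rightarrow>\<^sub>0 int. mcong 1 s X (\<lambda>_ _. 0) \<longrightarrow>
    rnorm p (Lk M (dt n s (\<lambda>i j. tone i j - X i j)) / of_nat (qi n)
    + (\<Sum>\<nu>=1..M. of_int (\<Sum>i<s. fin_quot.coefN (Gs n) (tpow s X \<nu> i i)) / of_nat \<nu>)) \<le> e" ..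
  have "capx (trlog p s u) (Lk M (dt n s \<alpha>) / of_nat (qi n)) e"
    if n: "n \<ge> n0" and M: "M \<ge> max (max m K) (M1 n)" and \<alpha>: "mapx M s u \<alpha>" for n M \<alpha>
  proof -
    interpret fin_quot "\<kappa> n" "qi n" "Gs n" by (rule fin_quot)
    have M': "1 \<le> M" using M m by simp
    have X1: "mcong 1 s (?X \<alpha>) (\<lambda>_ _. 0)" by (rule one_plus_pM_mcong[OF u \<alpha> M'])
    have mM: "m \<le> M" using M by simp
    have "mcong m s \<alpha> \<alpha>0" by (rule mapx_unique[OF mapx_mono[OF \<alpha> mM] \<alpha>0])
    then have "mcong m s (?X \<alpha>) (?X \<alpha>0)"
      unfolding mcong_def zcong_def
      by (auto simp: lookup_minus) (metis dvd_minus_iff minus_diff_eq)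
    then have c: "mcong m s (tpow s (?X \<alpha>) \<nu>) (tpow s (?X \<alpha>0) \<nu>)" for \<nu> by (rule mcong_tpow)
    let ?T = "\<lambda>\<nu>. of_int (\<Sum>i<s. coefN (tpow s (?X \<alpha>) \<nu> i i)) :: rat"
    \<comment> \<open>The quotient traces of the fine approximant, summed to M, are compared with
      the coefficients at the identity of \<open>\<alpha>0\<close>, summed to K. Both changes are
      covered by \<open>tail_approx\<close>.\<close>
    have "rnorm p ((\<Sum>\<nu>=1..M. ?T \<nu> / of_nat \<nu>) - (\<Sum>\<nu>=1..K. ?B \<nu> / of_nat \<nu>)) \<le> e"
    proof (rule tail_approx[OF _ _ _ m(1)])
      show "K \<le> M" using M by simp
      show "real \<nu> * pe \<nu> \<le> e" if "K \<le> \<nu>" for \<nu> using K that by blast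
      show "rnorm p (?T \<nu>) \<le> pe \<nu>" for \<nu>
        unfolding rnorm_of_int_le_iff
      proof (rule dvd_sum)
        fix i assume "i \<in> {..<s}"
        then have "zcong \<nu> (tpow s (?X \<alpha>) \<nu> i i) 0"
          using zcong_tpow_zero[OF X1, of \<nu>] by (simp add: mcong_def)
        from coefN_cong[OF fin_quot[of n] this] show "int p ^ \<nu> dvd coefN (tpow s (?X \<alpha>) \<nu> i i)"
          by (simp add: coefN_def[of 0])
      qed
      show "rnorm p (?T \<nu> - ?B \<nu>) \<le> pe m" if \<nu>: "1 \<le> \<nu>" "\<nu> \<le> K" for \<nu>
      proof -
        have eq: "?T \<nu> - ?B \<nu> = of_int (\<Sum>i<s. coefN (tpow s (?X \<alpha>) \<nu> i i) - lookup (tpow s (?X \<alpha>0) \<nu> i i) 0)"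
          by (simp only: sum_subtractf of_int_diff)
        have "int p ^ m dvd coefN (tpow s (?X \<alpha>) \<nu> i i) - lookup (tpow s (?X \<alpha>0) \<nu> i i) 0" if i: "i < s" for i
        proof -
        have "keys (tpow s (?X \<alpha>0) \<nu> i i) \<subseteq> ?F" using \<nu> i by auto
        from n0[rule_format, OF n this] have "coefN (tpow s (?X \<alpha>0) \<nu> i i) = lookup (tpow s (?X \<alpha>0) \<nu> i i) 0" .
        moreover have "zcong m (tpow s (?X \<alpha>) \<nu> i i) (tpow s (?X \<alpha>0) \<nu> i i)"
          using c[of \<nu>] i by (simp add: mcong_def)
        from coefN_cong[OF fin_quot[of n] this]
        have "int p ^ m dvd coefN (tpow s (?X \<alpha>) \<nu> i i) - coefN (tpow s (?X \<alpha>0) \<nu> i i)" .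
        ultimately show ?thesis by simp
        qed
        then show ?thesis unfolding eq rnorm_of_int_le_iff by (intro dvd_sum) simp
      qed
    qed
    moreover have "rnorm p (Lk M (dt n s (\<lambda>i j. tone i j - ?X \<alpha> i j)) / of_nat (qi n) + (\<Sum>\<nu>=1..M. ?T \<nu> / of_nat \<nu>)) \<le> e"
      using M X1 by (intro M1[rule_format]) simp_all
    then have "rnorm p (Lk M (dt n s \<alpha>) / of_nat (qi n) + (\<Sum>\<nu>=1..M. ?T \<nu> / of_nat \<nu>)) \<le> e" by simp
    ultimately have "rnorm p ((Lk M (dt n s \<alpha>) / of_nat (qi n) + (\<Sum>\<nu>=1..M. ?T \<nu> / of_nat \<nu>))
      - ((\<Sum>\<nu>=1..M. ?T \<nu> / of_nat \<nu>) - (\<Sum>\<nu>=1..K. ?B \<nu> / of_nat \<nu>))) \<le> e"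
      by (rule rnorm_diff_le[rotated])
    then have "rnorm p (Lk M (dt n s \<alpha>) / of_nat (qi n) - (- (\<Sum>\<nu>=1..K. ?B \<nu> / of_nat \<nu>))) \<le> e" by simp
    then show ?thesis using L by (subst (asm) rnorm_minus_commute) (rule capx_shift)
  qed
  then show "\<exists>n0 M0. \<forall>n\<ge>n0. \<forall>M\<ge>M0 n. \<forall>\<alpha>. mapx M s u \<alpha> \<longrightarrow> capx (trlog p s u) (Lk M (dt n s \<alpha>) / of_nat (qi n)) e"
    by (intro exI[of _ n0] exI[of _ "\<lambda>n. max (max m K) (M1 n)"]) blast
qed

section \<open>Existence and uniqueness of the logarithmic determinant\<close>

definition ldet :: "(nat \<Rightarrow> nat \<Rightarrow> 'g c0) \<Rightarrow> qp" where
  "ldet A = (if A \<in> GL_inf CR then THE L. \<exists>s. A \<in> GLn CR s \<and> Rel s A L else qp_zero p)"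

lemma ldet_eq:
  assumes A: "A \<in> GLn CR s" and R: "Rel s A L"
  shows "ldet A = L"
proof -
  have "(THE L. \<exists>s. A \<in> GLn CR s \<and> Rel s A L) = L"
  proof (rule the_equality)
    show "\<exists>s. A \<in> GLn CR s \<and> Rel s A L" using A R by blast
    fix L' assume "\<exists>s. A \<in> GLn CR s \<and> Rel s A L'"
    then obtain t where t: "A \<in> GLn CR t" "Rel t A L'" by blast
    have "A \<in> Mset CR s" "A \<in> Mset CR t" "A \<in> Mset CR (max s t)"
      using A t GLn_mono[OF A, of "max s t"] by (auto simp: GLn_iff)
    then show "L' = L"
      using Rel_block_iff[of A s "max s t"] Rel_block_iff[of A t "max s t"] R t
        Rel_unique[of A "max s t" L' L] by simp
  qed
  moreover have "A \<in> GL_inf CR" using A by (auto simp: GL_inf_def)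
  ultimately show ?thesis by (simp add: ldet_def)
qed

lemma EG_gen_Rel:
  assumes "W \<in> EG_gen CR (range (c0_grp p))"
  shows "\<exists>s. W \<in> GLn CR s \<and> Rel s W (qp_zero p)"
  using assms
proof induction
  case id
  have "Rel s (idm CR) (qp_zero p)" for s
    by (rule Rel_unit) (use mapx_idm tmul_tone in blast)
  then show ?case using idm_GL_inf unfolding GL_inf_def by blast
next
  case (el X i j a)
  then obtain s where s: "X \<in> GLn CR s" "Rel s X (qp_zero p)" by blast
  define t where "t = max s (Suc (max i j))"
  have X: "X \<in> GLn CR t" "Rel t X (qp_zero p)"
    using s GLn_mono[OF s(1)] Rel_block_iff[of X s t] by (auto simp: t_def GLn_iff)
  have E: "Defs.elem CR i j a \<in> GLn CR t" "Rel t (Defs.elem CR i j a) (qp_zero p)"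
    using el by (auto intro!: elem_GLn Rel_elem simp: t_def)
  show ?case
    using Rel_mmul[OF E(1) X(1) E(2) X(2)] GLn_mmul[OF E(1) X(1)] qp_add_zero[of "qp_zero p"] by auto
next
  case (gr X g)
  then obtain s where s: "X \<in> GLn CR s" "Rel s X (qp_zero p)" by blast
  obtain h where h: "g = c0_grp p h" using gr by blast
  define t where "t = max s 1"
  have X: "X \<in> GLn CR t" "Rel t X (qp_zero p)"
    using s GLn_mono[OF s(1)] Rel_block_iff[of X s t] by (auto simp: t_def GLn_iff)
  have E: "gmat CR g \<in> GLn CR t" "Rel t (gmat CR g) (qp_zero p)"
    unfolding h by (auto intro!: gmat_GLn Rel_gmat simp: t_def)
  show ?case
    using Rel_mmul[OF E(1) X(1) E(2) X(2)] GLn_mmul[OF E(1) X(1)] qp_add_zero[of "qp_zero p"] by auto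
qed

text \<open>The limit exists for generators and for matrices in 1 + pM_s, hence for some power of A,
  hence for A by division in Q_p.\<close>

lemma Rel_exists:
  assumes Wh: "Wh_torsion p TYPE('g)" and A: "A \<in> GL_inf CR"
  shows "\<exists>s L. A \<in> GLn CR s \<and> Rel s A L"
proof -
  obtain n W s u where n: "n > 0" and W: "W \<in> EG_gen CR (range (c0_grp p))"
    and u: "u \<in> one_plus_pM p s" and eq: "mpow CR A n = mmul CR W u"
    using Wh_torsion_decomposition[OF Wh A] by blast
  obtain t where t: "W \<in> GLn CR t" "Rel t W (qp_zero p)" using EG_gen_Rel[OF W] by blast
  obtain a where a: "A \<in> GLn CR a" using A by (auto simp: GL_inf_def)
  have u': "u \<in> GLn CR s" "Rel s u (trlog p s u)" using one_plus_pM_GLn[OF u] Rel_trlog[OF u] by auto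
  define b where "b = max a (max s t)"
  have W: "W \<in> GLn CR b" "Rel b W (qp_zero p)"
    using t GLn_mono[OF t(1)] Rel_block_iff[of W t b] by (auto simp: b_def GLn_iff)
  have u: "u \<in> GLn CR b" "Rel b u (trlog p s u)"
    using u' GLn_mono[OF u'(1)] Rel_block_iff[of u s b] by (auto simp: b_def GLn_iff)
  have A: "A \<in> GLn CR b" using a GLn_mono[OF a] by (auto simp: b_def)
  from Rel_mmul[OF W(1) u(1) W(2) u(2)] have "Rel b (mpow CR A n) (qp_add p (qp_zero p) (trlog p s u))"
    unfolding eq .
  from Rel_root[OF A n this] show ?thesis using A by blast
qed

lemma ldet_Rel:
  assumes "Wh_torsion p TYPE('g)" "A \<in> GLn CR s"
  shows "Rel s A (ldet A)"
proof -
  have "A \<in> GL_inf CR" using assms by (auto simp: GL_inf_def)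
  then obtain t L where t: "A \<in> GLn CR t" "Rel t A L" using Rel_exists[OF assms(1)] by blast
  have "A \<in> Mset CR s" "A \<in> Mset CR t" using assms(2) t by (auto simp: GLn_iff)
  then have "Rel s A L"
    using Rel_block_iff[of A s "max s t"] Rel_block_iff[of A t "max s t"] t by simp
  with assms(2) have "ldet A = L" by (rule ldet_eq)
  with \<open>Rel s A L\<close> show ?thesis by simp
qed

lemma logdet_hom_ldet:
  assumes Wh: "Wh_torsion p TYPE('g)"
  shows "logdet_hom p ldet"
  unfolding logdet_hom_def
proof (intro conjI allI ballI impI)
  show "ldet A = qp_zero p" if "A \<notin> GL_inf CR" for A using that by (simp add: ldet_def)
  show "ldet A \<in> Qp p" if A: "A \<in> GL_inf CR" for A
  proof -
    obtain s where "A \<in> GLn CR s" using A by (auto simp: GL_inf_def)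
    from ldet_Rel[OF Wh this] show ?thesis by (simp add: Rel_def)
  qed
  show "ldet (mmul CR A B) = qp_add p (ldet A) (ldet B)"
    if AB: "A \<in> GL_inf CR" "B \<in> GL_inf CR" for A B
  proof -
    obtain s t where "A \<in> GLn CR s" "B \<in> GLn CR t" using AB by (auto simp: GL_inf_def)
    then have A: "A \<in> GLn CR (max s t)" and B: "B \<in> GLn CR (max s t)" by (auto intro: GLn_mono)
    show ?thesis
      by (rule ldet_eq[OF GLn_mmul[OF A B] Rel_mmul[OF A B ldet_Rel[OF Wh A] ldet_Rel[OF Wh B]]])
  qed
  show "ldet (Defs.elem CR i j a) = qp_zero p" if "i \<noteq> j" "a \<in> c0Zp p" for i j a
    using that by (intro ldet_eq[of _ "Suc (max i j)"] elem_GLn Rel_elem) auto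
  show "ldet (gmat CR (c0_grp p g)) = qp_zero p" for g
    by (intro ldet_eq[of _ 1] gmat_GLn Rel_gmat) auto
  show "ldet u = trlog p s u" if "u \<in> one_plus_pM p s" for s u
    using that by (intro ldet_eq[OF one_plus_pM_GLn Rel_trlog])
qed

text \<open>The identity is the elementary matrix with entry 0.\<close>

lemma logdet_hom_idm:
  assumes "logdet_hom p (\<phi> :: (nat \<Rightarrow> nat \<Rightarrow> 'g c0) \<Rightarrow> qp)"
  shows "\<phi> (idm CR) = qp_zero p"
proof -
  have "Defs.elem CR 0 1 (c0_zero p) = idm (CR :: ('g c0) rops)"
    by (auto simp: Defs.elem_def idm_def fun_eq_iff)
  moreover have "\<phi> (Defs.elem CR 0 1 (c0_zero p)) = qp_zero p"
    using assms unfolding logdet_hom_def by simp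
  ultimately show ?thesis by simp
qed

lemma logdet_hom_EG_gen:
  assumes \<phi>: "logdet_hom p (\<phi> :: (nat \<Rightarrow> nat \<Rightarrow> 'g c0) \<Rightarrow> qp)"
    and "W \<in> EG_gen CR (range (c0_grp p))"
  shows "\<phi> W = qp_zero p"
  using assms(2)
proof induction
  case id show ?case by (rule logdet_hom_idm[OF \<phi>])
next
  case (el X i j a)
  have "Defs.elem CR i j a \<in> GL_inf CR"
  proof -
    have "Defs.elem CR i j a \<in> GLn CR (Suc (max i j))" using el by (intro elem_GLn) auto
    then show ?thesis unfolding GL_inf_def by blast
  qed
  moreover have "X \<in> GL_inf CR" by (rule EG_gen_GL_inf[OF el(1)])
  ultimately have "\<phi> (mmul CR (Defs.elem CR i j a) X) = qp_add p (\<phi> (Defs.elem CR i j a)) (\<phi> X)"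
    using \<phi> unfolding logdet_hom_def by blast
  moreover have "\<phi> (Defs.elem CR i j a) = qp_zero p"
    using \<phi> el unfolding logdet_hom_def by simp
  ultimately show ?case using el by (simp add: qp_add_zero)
next
  case (gr X g)
  then obtain h where h: "g = c0_grp p h" by blast
  have "gmat CR g \<in> GL_inf CR"
    using gmat_GLn[of 1 h] h by (auto simp: GL_inf_def)
  moreover have "X \<in> GL_inf CR" by (rule EG_gen_GL_inf[OF gr(1)])
  ultimately have "\<phi> (mmul CR (gmat CR g) X) = qp_add p (\<phi> (gmat CR g)) (\<phi> X)"
    using \<phi> unfolding logdet_hom_def by blast
  moreover have "\<phi> (gmat CR g) = qp_zero p"
    using \<phi> h unfolding logdet_hom_def by simp
  ultimately show ?case using gr by (simp add: qp_add_zero)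
qed

lemma qp_mul_of_nat_Suc:
  assumes "L \<in> Qp p"
  shows "qp_add p L (qp_mul p (qp_const p (of_nat N)) L) = qp_mul p (qp_const p (of_nat (Suc N))) L"
proof (rule Qp_eqI)
  fix e :: real assume e: "0 < e"
  obtain q where q: "capx L q e" using capx_ex[OF assms e] by blast
  have c: "capx (qp_mul p (qp_const p (of_nat k)) L) (of_nat k * q) e" for k
    using q e e by (rule capx_cmul) (use e in \<open>simp add: mult_left_le_one_le\<close>)
  have "q + of_nat N * q = of_nat (Suc N) * q" by (simp add: algebra_simps)
  then show "\<exists>q. capx (qp_add p L (qp_mul p (qp_const p (of_nat N)) L)) q e \<and> capx (qp_mul p (qp_const p (of_nat (Suc N))) L) q e"
    using capx_add[OF q c[of N] e] c[of "Suc N"] by (intro exI[of _ "of_nat (Suc N) * q"]) simp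
qed (use assms in auto)

lemma logdet_hom_mpow:
  assumes \<phi>: "logdet_hom p (\<phi> :: (nat \<Rightarrow> nat \<Rightarrow> 'g c0) \<Rightarrow> qp)" and A: "A \<in> GL_inf CR"
  shows "\<phi> (mpow CR A N) = qp_mul p (qp_const p (of_nat N)) (\<phi> A)"
proof -
  have Q: "\<phi> A \<in> Qp p" using \<phi> A unfolding logdet_hom_def by blast
  show ?thesis
  proof (induction N)
    case 0
    have "qp_zero p = qp_mul p (qp_const p (of_nat 0)) (\<phi> A)"
    proof (rule Qp_eqI)
      fix e :: real assume e: "0 < e"
      obtain q where q: "capx (\<phi> A) q e" using capx_ex[OF Q e] by blast
      have "capx (qp_mul p (qp_const p (of_nat 0)) (\<phi> A)) (of_nat 0 * q) e"
        using q e e by (rule capx_cmul) (use e in simp)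
      then show "\<exists>q. capx (qp_zero p) q e \<and> capx (qp_mul p (qp_const p (of_nat 0)) (\<phi> A)) q e"
        using capx_zero[OF e] by auto
    qed (use Q in auto)
    then show ?case using logdet_hom_idm[OF \<phi>] by (simp add: mpow_def)
  next
    case (Suc N)
    have "\<phi> (mmul CR A (mpow CR A N)) = qp_add p (\<phi> A) (\<phi> (mpow CR A N))"
      using \<phi> A mpow_GL_inf[OF A] unfolding logdet_hom_def by blast
    then show ?case using Suc qp_mul_of_nat_Suc[OF Q] by (simp add: mpow_def)
  qed
qed

text \<open>The decomposition of a power of A prescribes n times the value at A, and multiplication
  by n is injective on Q_p.\<close>

lemma logdet_hom_unique:
  assumes Wh: "Wh_torsion p TYPE('g)"
    and \<phi>: "logdet_hom p (\<phi> :: (nat \<Rightarrow> nat \<Rightarrow> 'g c0) \<Rightarrow> qp)" and \<psi>: "logdet_hom p \<psi>"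
  shows "\<phi> = \<psi>"
proof
  fix A
  show "\<phi> A = \<psi> A"
  proof (cases "A \<in> GL_inf CR")
    case False
    then show ?thesis using \<phi> \<psi> unfolding logdet_hom_def by simp
  next
    case A: True
    obtain n W s u where n: "n > 0" and W: "W \<in> EG_gen CR (range (c0_grp p))"
      and u: "u \<in> one_plus_pM p s" and eq: "mpow CR A n = mmul CR W u"
      using Wh_torsion_decomposition[OF Wh A] by blast
    have WG: "W \<in> GL_inf CR" by (rule EG_gen_GL_inf[OF W])
    have uG: "u \<in> GL_inf CR" using one_plus_pM_GLn[OF u] by (auto simp: GL_inf_def)
    have val: "qp_mul p (qp_const p (of_nat n)) (\<phi> A) = qp_add p (qp_zero p) (trlog p s u)"
      if \<phi>: "logdet_hom p \<phi>" for \<phi> :: "(nat \<Rightarrow> nat \<Rightarrow> 'g c0) \<Rightarrow> qp"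
    proof -
      have "\<phi> (mmul CR W u) = qp_add p (\<phi> W) (\<phi> u)"
        using \<phi> WG uG unfolding logdet_hom_def by blast
      moreover have "\<phi> u = trlog p s u" using \<phi> u unfolding logdet_hom_def by blast
      ultimately show ?thesis
        using logdet_hom_mpow[OF \<phi> A, of n] logdet_hom_EG_gen[OF \<phi> W] eq by simp
    qed
    have "\<phi> A \<in> Qp p" "\<psi> A \<in> Qp p" using \<phi> \<psi> A by (simp_all add: logdet_hom_def)
    then show ?thesis
    proof (rule qp_cmul_eq_iff)
      show "qp_mul p (qp_const p (of_nat n)) (\<phi> A) = qp_mul p (qp_const p (of_nat n)) (\<psi> A)"
        unfolding val[OF \<phi>] val[OF \<psi>] ..
    qed (use n in simp)
  qed
qed

text \<open>\<open>ldet\<close> is built from the sequence \<open>Gs\<close> while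
  \<open>logdet\<close> is not; uniqueness identifies them.\<close>

lemma logdet_eq_ldet:
  assumes "Wh_torsion p TYPE('g)"
  shows "logdet p r f = ldet (emb_c0 p r f)"
proof -
  have "(THE \<phi>. logdet_hom p \<phi>) = ldet"
    using logdet_hom_ldet[OF assms] logdet_hom_unique[OF assms] by (intro the_equality) auto
  then show ?thesis by (simp add: logdet_def)
qed

end

subsection \<open>Counting torsion points of an integral matrix\<close>

text \<open>The kernel of the endomorphism M of the torus (R/Z)^n. Representatives in [0,1), set to
  0 beyond n, make each point a single function.\<close>

definition tsol :: "nat \<Rightarrow> (nat \<Rightarrow> nat \<Rightarrow> int) \<Rightarrow> (nat \<Rightarrow> real) set" where
  "tsol n M = {y. (\<forall>b<n. 0 \<le> y b \<and> y b < 1) \<and> (\<forall>b\<ge>n. y b = 0) \<and>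
     (\<forall>a<n. (\<Sum>b<n. of_int (M a b) * y b) \<in> \<int>)}"

text \<open>The solutions are (k - v)/d for the d consecutive integers k starting at the ceiling of
  v.\<close>

lemma card_fibre_pos:
  fixes d :: int and v :: real
  assumes d: "0 < d"
  shows "finite {t. 0 \<le> t \<and> t < 1 \<and> of_int d * t + v \<in> \<int>} \<and>
    int (card {t. 0 \<le> t \<and> t < 1 \<and> of_int d * t + v \<in> \<int>}) = d"
proof -
  let ?h = "\<lambda>k::int. (of_int k - v) / of_int d"
  have d': "0 < real_of_int d" using d by simp
  have iff: "0 \<le> ?h k \<and> ?h k < 1 \<longleftrightarrow> k \<in> {\<lceil>v\<rceil>..<\<lceil>v\<rceil> + d}" for k
  proof -
    have "0 \<le> ?h k \<longleftrightarrow> \<lceil>v\<rceil> \<le> k" using d' by (simp add: zero_le_divide_iff ceiling_le_iff)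
    moreover have "?h k < 1 \<longleftrightarrow> k - d < \<lceil>v\<rceil>" using d' by (simp add: less_ceiling_iff algebra_simps)
    ultimately show ?thesis by auto
  qed
  have eq: "{t. 0 \<le> t \<and> t < 1 \<and> of_int d * t + v \<in> \<int>} = ?h ` {\<lceil>v\<rceil>..<\<lceil>v\<rceil> + d}"
  proof (intro equalityI subsetI)
    fix t assume "t \<in> {t. 0 \<le> t \<and> t < 1 \<and> of_int d * t + v \<in> \<int>}"
    then obtain k where k: "0 \<le> t" "t < 1" "of_int d * t + v = of_int k" by (auto elim: Ints_cases)
    then have "t = ?h k" using d' by (simp add: field_simps)
    then show "t \<in> ?h ` {\<lceil>v\<rceil>..<\<lceil>v\<rceil> + d}" using k iff by blast
  next
    fix t assume "t \<in> ?h ` {\<lceil>v\<rceil>..<\<lceil>v\<rceil> + d}"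
    then obtain k where k: "k \<in> {\<lceil>v\<rceil>..<\<lceil>v\<rceil> + d}" "t = ?h k" by blast
    have "of_int d * t + v = of_int k" using k(2) d' by simp
    then show "t \<in> {t. 0 \<le> t \<and> t < 1 \<and> of_int d * t + v \<in> \<int>}" using iff[of k] k by simp
  qed
  have "inj_on ?h {\<lceil>v\<rceil>..<\<lceil>v\<rceil> + d}" using d by (auto simp: inj_on_def)
  then show ?thesis unfolding eq using d by (simp add: card_image)
qed

lemma card_fibre:
  fixes d :: int and v :: real
  assumes d: "d \<noteq> 0"
  shows "finite {t. 0 \<le> t \<and> t < 1 \<and> of_int d * t + v \<in> \<int>} \<and>
    int (card {t. 0 \<le> t \<and> t < 1 \<and> of_int d * t + v \<in> \<int>}) = \<bar>d\<bar>"
proof (cases "0 < d")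
  case True
  then show ?thesis using card_fibre_pos[of d v] by simp
next
  case False
  have "of_int d * t + v \<in> \<int> \<longleftrightarrow> of_int (- d) * t + (- v) \<in> \<int>" for t
    using minus_in_Ints_iff[of "of_int d * t + v"] by simp
  then show ?thesis using card_fibre_pos[of "- d" "- v"] False d by simp
qed

lemma fdet_first_column:
  fixes M :: "nat \<Rightarrow> nat \<Rightarrow> int"
  assumes "\<And>i. 0 < i \<Longrightarrow> i < Suc n \<Longrightarrow> M i 0 = 0"
  shows "fdet (Suc n) M = M 0 0 * fdet n (\<lambda>i j. M (Suc i) (Suc j))"
proof -
  let ?A = "mat (Suc n) (Suc n) (\<lambda>(i, j). M i j)"
  have "det ?A = (\<Sum>i<Suc n. ?A $$ (i, 0) * cofactor ?A i 0)"
    by (rule laplace_expansion_column) auto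
  also have "\<dots> = (\<Sum>i<Suc n. if i = 0 then M 0 0 * cofactor ?A 0 0 else 0)"
    using assms by (intro sum.cong) auto
  also have "\<dots> = M 0 0 * cofactor ?A 0 0" by simp
  also have "cofactor ?A 0 0 = det (mat_delete ?A 0 0)" by (simp add: cofactor_def)
  also have "mat_delete ?A 0 0 = mat n n (\<lambda>(i, j). M (Suc i) (Suc j))"
    by (intro eq_matI) (auto simp: mat_delete_def)
  finally show ?thesis by (simp add: fdet_def)
qed

text \<open>Only the first row involves the first coordinate. The other coordinates solve the
  smaller system, and over each of its solutions the first coordinate solves one inhomogeneous
  equation.\<close>

lemma tsol_first_column:
  fixes M :: "nat \<Rightarrow> nat \<Rightarrow> int"
  assumes col: "\<And>i. 0 < i \<Longrightarrow> i < Suc n \<Longrightarrow> M i 0 = 0"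
  shows "bij_betw (\<lambda>(z, t). case_nat t z)
    (SIGMA z:tsol n (\<lambda>i j. M (Suc i) (Suc j)).
      {t. 0 \<le> t \<and> t < 1 \<and> of_int (M 0 0) * t + (\<Sum>b<n. of_int (M 0 (Suc b)) * z b) \<in> \<int>})
    (tsol (Suc n) M)"
proof -
  let ?N = "\<lambda>i j. M (Suc i) (Suc j)"
  let ?S = "SIGMA z:tsol n ?N. {t. 0 \<le> t \<and> t < 1 \<and> of_int (M 0 0) * t + (\<Sum>b<n. of_int (M 0 (Suc b)) * z b) \<in> \<int>}"
  have iff: "case_nat t z \<in> tsol (Suc n) M \<longleftrightarrow> (z, t) \<in> ?S" for t and z :: "nat \<Rightarrow> real"
  proof -
    have sums: "(\<Sum>b<Suc n. of_int (M a b) * case_nat t z b) = of_int (M a 0) * t + (\<Sum>b<n. of_int (M a (Suc b)) * z b)" for a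
      unfolding sum.lessThan_Suc_shift by simp
    have all: "(\<forall>b<Suc n. P b) \<longleftrightarrow> P 0 \<and> (\<forall>b<n. P (Suc b))" for P
      by (auto simp: less_Suc_eq_0_disj)
    have all2: "(\<forall>b\<ge>Suc n. P b) \<longleftrightarrow> (\<forall>b\<ge>n. P (Suc b))" for P
      by (metis Suc_le_D Suc_le_mono)
    show ?thesis
      unfolding tsol_def mem_Collect_eq sums all all2 mem_Sigma_iff using col by auto
  qed
  show ?thesis
  proof (rule bij_betw_byWitness[where f' = "\<lambda>y. (\<lambda>b. y (Suc b), y 0)"])
    show "\<forall>a\<in>?S. (\<lambda>y. (\<lambda>b. y (Suc b), y 0)) ((\<lambda>(z, t). case_nat t z) a) = a" by auto
    have c: "case_nat (y 0) (\<lambda>b. y (Suc b)) = y" for y :: "nat \<Rightarrow> real"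
      by (auto simp: fun_eq_iff split: nat.split)
    then show "\<forall>a'\<in>tsol (Suc n) M. (\<lambda>(z, t). case_nat t z) ((\<lambda>y. (\<lambda>b. y (Suc b), y 0)) a') = a'" by simp
    show "(\<lambda>(z, t). case_nat t z) ` ?S \<subseteq> tsol (Suc n) M" using iff by auto
    show "(\<lambda>y. (\<lambda>b. y (Suc b), y 0)) ` tsol (Suc n) M \<subseteq> ?S"
    proof
      fix w assume "w \<in> (\<lambda>y. (\<lambda>b. y (Suc b), y 0)) ` tsol (Suc n) M"
      then obtain y where y: "y \<in> tsol (Suc n) M" "w = (\<lambda>b. y (Suc b), y 0)" by blast
      show "w \<in> ?S" unfolding y(2) using iff[of "y 0" "\<lambda>b. y (Suc b)"] y(1) by (simp only: c)
    qed
  qed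
qed

definition counts_det :: "nat \<Rightarrow> (nat \<Rightarrow> nat \<Rightarrow> int) \<Rightarrow> bool" where
  "counts_det n M \<longleftrightarrow> (fdet n M \<noteq> 0 \<longrightarrow> finite (tsol n M) \<and> int (card (tsol n M)) = \<bar>fdet n M\<bar>)"

lemma counts_det_first_column:
  assumes "\<And>i. 0 < i \<Longrightarrow> i < Suc n \<Longrightarrow> M i 0 = 0" "counts_det n (\<lambda>i j. M (Suc i) (Suc j))"
  shows "counts_det (Suc n) M"
  unfolding counts_det_def
proof
  let ?N = "\<lambda>i j. M (Suc i) (Suc j)"
  let ?F = "\<lambda>z :: nat \<Rightarrow> real. {t. 0 \<le> t \<and> t < 1 \<and> of_int (M 0 0) * t + (\<Sum>b<n. of_int (M 0 (Suc b)) * z b) \<in> \<int>}"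
  assume nz: "fdet (Suc n) M \<noteq> 0"
  have det: "fdet (Suc n) M = M 0 0 * fdet n ?N" using assms(1) by (rule fdet_first_column)
  then have N: "finite (tsol n ?N)" "int (card (tsol n ?N)) = \<bar>fdet n ?N\<bar>" and d: "M 0 0 \<noteq> 0"
    using nz assms(2) by (auto simp: counts_det_def)
  note F = card_fibre[OF d]
  have bij: "bij_betw (\<lambda>(z, t). case_nat t z) (Sigma (tsol n ?N) ?F) (tsol (Suc n) M)"
    using assms(1) by (rule tsol_first_column)
  have "finite (Sigma (tsol n ?N) ?F)" using N(1) F by (intro finite_SigmaI) auto
  then have "finite (tsol (Suc n) M)" using bij_betw_finite[OF bij] by simp
  moreover have "card (tsol (Suc n) M) = (\<Sum>z\<in>tsol n ?N. card (?F z))"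
    using bij_betw_same_card[OF bij] N(1) F by (simp add: card_SigmaI)
  then have "int (card (tsol (Suc n) M)) = (\<Sum>z\<in>tsol n ?N. \<bar>M 0 0\<bar>)" using F by simp
  then have "int (card (tsol (Suc n) M)) = \<bar>fdet (Suc n) M\<bar>" by (simp add: N(2) det abs_mult)
  ultimately show "finite (tsol (Suc n) M) \<and> int (card (tsol (Suc n) M)) = \<bar>fdet (Suc n) M\<bar>" by simp
qed

lemma tsol_tmul_subset:
  assumes "y \<in> tsol n M"
  shows "y \<in> tsol n (tmul n E M)"
proof -
  have "(\<Sum>b<n. of_int (tmul n E M a b) * y b) \<in> \<int>" for a
  proof -
    have "(\<Sum>b<n. of_int (tmul n E M a b) * y b) = (\<Sum>b<n. \<Sum>k<n. of_int (E a k) * (of_int (M k b) * y b))"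
      by (simp add: tmul_def sum_distrib_right mult.assoc)
    also have "\<dots> = (\<Sum>k<n. of_int (E a k) * (\<Sum>b<n. of_int (M k b) * y b))"
      by (subst sum.swap) (simp add: sum_distrib_left)
    also have "\<dots> \<in> \<int>" 
    proof (rule Ints_sum)
      fix k assume "k \<in> {..<n}"
      then have "(\<Sum>b<n. of_int (M k b) * y b) \<in> \<int>" using assms by (simp add: tsol_def)
      then show "of_int (E a k) * (\<Sum>b<n. of_int (M k b) * y b) \<in> \<int>" by (rule Ints_mult[OF Ints_of_int])
    qed
    finally show ?thesis .
  qed
  then show ?thesis using assms by (simp add: tsol_def)
qed

lemma tsol_cong: "(\<And>i j. i < n \<Longrightarrow> j < n \<Longrightarrow> M i j = M' i j) \<Longrightarrow> tsol n M = tsol n M'"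
  unfolding tsol_def by simp

text \<open>Multiplication by an integral matrix can only enlarge the kernel; applied to the row
  operation and to its inverse this gives equality, and the determinant changes at most by a
  sign.\<close>

lemma counts_det_telem:
  assumes kl: "k \<noteq> l" "k < n" "l < n" and c: "counts_det n (tmul n (telem k l a) M)"
  shows "counts_det n M"
proof -
  let ?E = "telem k l a :: nat \<Rightarrow> nat \<Rightarrow> int"
  let ?E' = "telem k l (- a) :: nat \<Rightarrow> nat \<Rightarrow> int"
  have inv: "tmul n ?E ?E' i j = tone i j" "tmul n ?E' ?E i j = tone i j" if "i < n" "j < n" for i j
    using tmul_telem[OF kl that, of a] tmul_telem[OF kl that, of "- a"] by simp_all
  have "tmul n ?E' (tmul n ?E M) i j = M i j" if "i < n" "j < n" for i j
  proof -
    have "tmul n ?E' (tmul n ?E M) i j = tmul n (tmul n ?E' ?E) M i j" by (simp only: tmul_assoc)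
    also have "\<dots> = tmul n tone M i j" using inv that by (simp add: tmul_def[of n "tmul n ?E' ?E"] tmul_def[of n tone])
    finally show ?thesis using that by (simp add: tmul_tone)
  qed
  then have "tsol n (tmul n ?E' (tmul n ?E M)) = tsol n M" by (rule tsol_cong)
  then have "tsol n (tmul n ?E M) = tsol n M"
    using tsol_tmul_subset[of _ n M ?E] tsol_tmul_subset[of _ n "tmul n ?E M" ?E'] by blast
  moreover have "\<bar>fdet n (tmul n ?E M)\<bar> = \<bar>fdet n M\<bar>"
    using fdet_unit[of n ?E ?E'] inv(1) by (auto simp: fdet_tmul)
  moreover from this have "fdet n (tmul n ?E M) \<noteq> 0 \<longleftrightarrow> fdet n M \<noteq> 0" by auto
  ultimately show ?thesis using c by (simp add: counts_det_def)
qed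

lemma tmul_telem_row:
  assumes "k \<noteq> l" "k < n" "l < n" "i < n"
  shows "tmul n (telem k l a) M i j = (if i = k then M k j + a * M l j else M i j)"
proof -
  have "tmul n (telem k l a) M i j = (\<Sum>t<n. (if t = i then M i j else 0) + (if t = l then if i = k then a * M l j else 0 else 0))"
    unfolding tmul_def using assms by (intro sum.cong) (auto simp: telem_def tone_def)
  then show ?thesis using assms by (auto simp: sum.distrib)
qed

text \<open>Row operations run the Euclidean algorithm in the first column.\<close>
lemma counts_det_all: "counts_det n M"
proof (induction n arbitrary: M)
  case 0
  have "tsol 0 M = {\<lambda>_. 0}" by (auto simp: tsol_def)
  moreover have "fdet 0 M = 1" by (simp add: fdet_def)
  ultimately show ?case by (simp add: counts_det_def)
next
  case (Suc n)
  let ?m = "Suc n"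
  show ?case
  proof (induction "nat (\<Sum>i<?m. \<bar>M i 0\<bar>)" arbitrary: M rule: less_induct)
    case less
    show ?case
    proof (cases "\<exists>k l. k \<noteq> l \<and> k < ?m \<and> l < ?m \<and> M k 0 \<noteq> 0 \<and> M l 0 \<noteq> 0 \<and> \<bar>M l 0\<bar> \<le> \<bar>M k 0\<bar>")
      case True
      then obtain k l where kl: "k \<noteq> l" "k < ?m" "l < ?m" and nz: "M k 0 \<noteq> 0" "M l 0 \<noteq> 0" "\<bar>M l 0\<bar> \<le> \<bar>M k 0\<bar>" by blast
      \<comment> \<open>With this sign the smaller of the two entries is subtracted from the larger
        in absolute value, which strictly decreases the sum of absolute values in the
        column.\<close>
      define a where "a = - (sgn (M k 0) * sgn (M l 0))"
      let ?M = "tmul ?m (telem k l a) M"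
      have "\<bar>M k 0 + a * M l 0\<bar> < \<bar>M k 0\<bar>"
        using nz unfolding a_def by (auto simp: sgn_if split: if_splits)
      then have "(\<Sum>i<?m. \<bar>?M i 0\<bar>) < (\<Sum>i<?m. \<bar>M i 0\<bar>)"
        using kl by (intro sum_strict_mono_ex1) (auto simp: tmul_telem_row[OF kl])
      moreover have "0 \<le> (\<Sum>i<?m. \<bar>?M i 0\<bar>)" by (intro sum_nonneg) auto
      ultimately have "counts_det ?m ?M" by (intro less) linarith
      then show ?thesis by (rule counts_det_telem[OF kl])
    next
      case F: False
      show ?thesis
      proof (cases "\<exists>i. 0 < i \<and> i < ?m \<and> M i 0 \<noteq> 0")
        case False
        then show ?thesis by (intro counts_det_first_column Suc) blast
      next
        case True
        then obtain i where i: "0 < i" "i < ?m" "M i 0 \<noteq> 0" by blast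
        have z: "M j 0 = 0" if "j < ?m" "j \<noteq> i" for j
          using F i that by (metis linear)
        have k1: "0 \<noteq> i" "0 < ?m" "i < ?m" and k2: "i \<noteq> 0" "i < ?m" "0 < ?m" using i by auto
        \<comment> \<open>The only nonzero entry of the column is moved to the top: row i is added
          to row 0, then row 0 is subtracted from row i.\<close>
        let ?M1 = "tmul ?m (telem 0 i 1) M"
        let ?M2 = "tmul ?m (telem i 0 (-1)) ?M1"
        have M1: "?M1 j 0 = (if j = 0 then M i 0 else M j 0)" if "j < ?m" for j
          using tmul_telem_row[OF k1 that, of 1 M 0] z[of 0] i by simp
        have "?M2 j 0 = 0" if "0 < j" "j < ?m" for j
          using tmul_telem_row[OF k2 that(2), of "-1" ?M1 0] M1[of j] M1[of 0] M1[of i] that i z[of j] by auto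
        then have "counts_det ?m ?M2" by (intro counts_det_first_column Suc)
        then show ?thesis using counts_det_telem[OF k2] counts_det_telem[OF k1] by blast
      qed
    qed
  qed
qed

lemma card_tsol:
  assumes "fdet n M \<noteq> 0"
  shows "finite (tsol n M)" "int (card (tsol n M)) = \<bar>fdet n M\<bar>"
  using counts_det_all[of n M] assms by (auto simp: counts_det_def)

subsection \<open>Points fixed by a normal subgroup\<close>

definition ZG_pm :: "(nat \<Rightarrow> nat \<Rightarrow> 'g \<Rightarrow> int) \<Rightarrow> nat \<Rightarrow> nat \<Rightarrow> 'g \<Rightarrow>\<^sub>0 int" where
  "ZG_pm f = (\<lambda>i j. Abs_poly_mapping (f i j))"

lemma lookup_ZG_pm: "ZG_mat r f \<Longrightarrow> lookup (ZG_pm f i j) g = f i j g"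
  by (simp add: ZG_pm_def ZG_mat_def)

lemma finite_fsupp: "ZG_mat r f \<Longrightarrow> finite (fsupp r f)"
proof -
  assume "ZG_mat r f"
  then have "finite (\<Union>i\<in>{..<r}. \<Union>j\<in>{..<r}. {g. f i j g \<noteq> 0})" by (auto simp: ZG_mat_def)
  moreover have "fsupp r f \<subseteq> (\<Union>i\<in>{..<r}. \<Union>j\<in>{..<r}. {g. f i j g \<noteq> 0})" by (auto simp: fsupp_def)
  ultimately show ?thesis by (rule rev_finite_subset)
qed

context fin_quot
begin

text \<open>A point constant on cosets is a vector indexed by pairs of coordinate and coset. The
  relation of X_f at g and j is then the row of index j * q + \<open>\<kappa> g\<close>.\<close>

lemma bigM_apply:
  fixes x :: "'g \<Rightarrow> nat \<Rightarrow> real"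
  assumes f: "ZG_mat r f" and x: "\<And>g i. i < r \<Longrightarrow> x g i = y (i * q + \<kappa> g)" and j: "j < r"
  shows "(\<Sum>b<r * q. of_int (bigM (ZG_pm f) (j * q + \<kappa> g) b) * y b)
    = (\<Sum>d\<in>fsupp r f. \<Sum>i<r. x (g + d) i * of_int (f j i d))"
proof -
  have dm: "(j * q + \<kappa> g) div q = j" "(j * q + \<kappa> g) mod q = \<kappa> g" using \<kappa>_less[of g] by auto
  have "(\<Sum>b<r * q. of_int (bigM (ZG_pm f) (j * q + \<kappa> g) b) * y b)
    = (\<Sum>b<r * q. of_int (Rc (ZG_pm f j (b div q)) (\<kappa> g) (b mod q)) * y (b div q * q + b mod q))"
    unfolding bigM_def dm by simp
  also have "\<dots> = (\<Sum>i<r. \<Sum>c<q. of_int (Rc (ZG_pm f j i) (\<kappa> g) c) * y (i * q + c))"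
    by (rule sum_div_mod[OF q_pos])
  also have "\<dots> = (\<Sum>i<r. \<Sum>d\<in>fsupp r f. x (g + d) i * of_int (f j i d))"
  proof (intro sum.cong refl)
    fix i assume "i \<in> {..<r}"
    then have i: "i < r" by simp
    have "keys (ZG_pm f j i) \<subseteq> fsupp r f"
      unfolding fsupp_def using i j by (intro subsetI) (simp add: in_keys_iff lookup_ZG_pm[OF f], blast)
    then have "Rc (ZG_pm f j i) (\<kappa> g) c = (\<Sum>d\<in>fsupp r f. if \<kappa> (g + d) = c then f j i d else 0)" for c
      using Rc_superset[OF finite_fsupp[OF f]] by (simp add: \<kappa>_crep_add lookup_ZG_pm[OF f] cong: if_cong)
    then have "(\<Sum>c<q. of_int (Rc (ZG_pm f j i) (\<kappa> g) c) * y (i * q + c))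
      = (\<Sum>c<q. \<Sum>d\<in>fsupp r f. if \<kappa> (g + d) = c then of_int (f j i d) * y (i * q + c) else 0)"
      by (simp add: sum_distrib_right if_distrib[of real_of_int] if_distrib[of "\<lambda>z. z * _"] cong: if_cong)
    also have "\<dots> = (\<Sum>d\<in>fsupp r f. \<Sum>c<q. if \<kappa> (g + d) = c then of_int (f j i d) * y (i * q + c) else 0)"
      by (rule sum.swap)
    also have "\<dots> = (\<Sum>d\<in>fsupp r f. x (g + d) i * of_int (f j i d))"
      by (simp add: \<kappa>_less x[OF i] mult.commute)
    finally show "(\<Sum>c<q. of_int (Rc (ZG_pm f j i) (\<kappa> g) c) * y (i * q + c))
      = (\<Sum>d\<in>fsupp r f. x (g + d) i * of_int (f j i d))" .
  qed
  also have "\<dots> = (\<Sum>d\<in>fsupp r f. \<Sum>i<r. x (g + d) i * of_int (f j i d))" by (rule sum.swap)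
  finally show ?thesis .
qed

text \<open>The action is by left translation whereas the cosets are x + N; normality turns - h + g
  in N into g - h in N.\<close>

lemma FixN_\<kappa>:
  assumes "x \<in> FixN r f N" "\<kappa> g = \<kappa> h"
  shows "x g = x h"
proof -
  have "- h + g \<in> N" using assms(2) \<kappa>_iff[of h g] by simp
  then have "h + (- h + g) - h \<in> N" using normal unfolding normal_fi_def by blast
  then have n: "g - h \<in> N" by (simp only: add.assoc[symmetric] right_minus add_0_left)
  have "\<forall>n\<in>N. \<forall>g'. x (- n + g') = x g'" using assms(1) by (simp add: FixN_def)
  then have "x (- (g - h) + g) = x g" using n by blast
  moreover have "- (g - h) + g = h" by (simp add: minus_diff_eq diff_add_cancel)
  ultimately show ?thesis by simp
qed

lemma bij_FixN:
  assumes f: "ZG_mat r f"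
  shows "bij_betw (\<lambda>y g i. if i < r then y (i * q + \<kappa> g) else 0) (tsol (r * q) (bigM (ZG_pm f))) (FixN r f N)"
proof -
  let ?\<Psi> = "\<lambda>y g i. if i < r then y (i * q + \<kappa> g) else 0 :: real"
  let ?\<Phi> = "\<lambda>x a. if a < r * q then x (crep (a mod q)) (a div q) else 0 :: real"
  have lt: "i * q + \<kappa> g < r * q" if "i < r" for i g
  proof -
    have "i * q + \<kappa> g < Suc i * q" using \<kappa>_less[of g] by simp
    also have "\<dots> \<le> r * q" using that by (intro mult_le_mono1) simp
    finally show ?thesis .
  qed
  have dm: "(i * q + \<kappa> g) div q = i" "(i * q + \<kappa> g) mod q = \<kappa> g" for i g using \<kappa>_less[of g] by auto
  have \<Psi>: "?\<Psi> y \<in> FixN r f N" if y: "y \<in> tsol (r * q) (bigM (ZG_pm f))" for y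
  proof -
    have "(\<Sum>d\<in>fsupp r f. \<Sum>i<r. ?\<Psi> y (g + d) i * of_int (f j i d)) \<in> \<int>" if j: "j < r" for g j
    proof -
      have "(\<Sum>b<r * q. of_int (bigM (ZG_pm f) (j * q + \<kappa> g) b) * y b) \<in> \<int>"
        using y lt[OF j] by (simp add: tsol_def)
      then show ?thesis by (subst (asm) bigM_apply[OF f, of "?\<Psi> y"]) (use j in simp_all)
    qed
    \<comment> \<open>Again by normality: left translation by N preserves the cosets x + N.\<close>
    moreover have "\<kappa> (- h + g) = \<kappa> g" if "h \<in> N" for h g
    proof -
      have "- g + h - (- g) \<in> N" using normal that unfolding normal_fi_def by blast
      then have "- (- h + g) + g \<in> N" by (simp add: minus_add)
      then show ?thesis using \<kappa>_iff by blast
    qed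
    ultimately show ?thesis using y lt by (auto simp: FixN_def Xf_def tsol_def fun_eq_iff)
  qed
  have \<Phi>: "?\<Phi> x \<in> tsol (r * q) (bigM (ZG_pm f))" and \<Psi>\<Phi>: "?\<Psi> (?\<Phi> x) = x" if x: "x \<in> FixN r f N" for x
  proof -
    have xX: "x \<in> Xf r f" using x by (simp add: FixN_def)
    have xk: "x (crep (\<kappa> g)) = x g" for g using x by (rule FixN_\<kappa>) (simp add: \<kappa>_crep \<kappa>_less)
    have eq: "x g i = ?\<Phi> x (i * q + \<kappa> g)" if "i < r" for g i
      using lt[OF that, of g] xk by (simp only: if_True dm)
    then show "?\<Psi> (?\<Phi> x) = x"
      using xX by (intro ext) (auto simp: Xf_def simp del: mod_mult_self3 div_mult_self3)
    have "(\<Sum>b<r * q. of_int (bigM (ZG_pm f) a b) * ?\<Phi> x b) \<in> \<int>" if a: "a < r * q" for a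
    proof -
      have a': "a div q < r" "a mod q < q" using div_mod_lt[OF a] by auto
      have aa: "a = a div q * q + \<kappa> (crep (a mod q))" by (simp add: \<kappa>_crep[OF a'(2)])
      have "(\<Sum>b<r * q. of_int (bigM (ZG_pm f) (a div q * q + \<kappa> (crep (a mod q))) b) * ?\<Phi> x b)
        = (\<Sum>d\<in>fsupp r f. \<Sum>i<r. x (crep (a mod q) + d) i * of_int (f (a div q) i d))"
        by (rule bigM_apply[where x = x and y = "?\<Phi> x" and j = "a div q" and g = "crep (a mod q)", OF f eq a'(1)])
      also have "\<dots> \<in> \<int>" using xX a'(1) by (simp add: Xf_def)
      finally show ?thesis unfolding aa[symmetric] .
    qed
    then show "?\<Phi> x \<in> tsol (r * q) (bigM (ZG_pm f))"
      using xX by (auto simp: tsol_def Xf_def dest: div_mod_lt)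
  qed
  have \<Phi>\<Psi>: "?\<Phi> (?\<Psi> y) = y" if "y \<in> tsol (r * q) (bigM (ZG_pm f))" for y
  proof
    fix a
    show "?\<Phi> (?\<Psi> y) a = y a"
      using that div_mod_lt[of a r q] by (cases "a < r * q") (auto simp: tsol_def \<kappa>_crep)
  qed
  show ?thesis
    by (rule bij_betw_byWitness[where f' = ?\<Phi>]) (use \<Psi> \<Phi> \<Psi>\<Phi> \<Phi>\<Psi> in blast)+
qed

lemma card_FixN:
  assumes f: "ZG_mat r f" and nz: "qdet r (ZG_pm f) \<noteq> 0"
  shows "finite (FixN r f N)" "int (card (FixN r f N)) = \<bar>qdet r (ZG_pm f)\<bar>"
  using card_tsol[OF nz[unfolded qdet_def]] bij_betw_finite[OF bij_FixN[OF f]] bij_betw_same_card[OF bij_FixN[OF f]]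
  by (simp_all add: qdet_def)

end

context padic_quotients
begin

text \<open>The integral matrix is its own approximant at every precision, so its exact determinant
  appears in the limit.\<close>

lemma mapx_emb_c0:
  fixes f :: "nat \<Rightarrow> nat \<Rightarrow> 'g \<Rightarrow> int"
  assumes "ZG_mat r f"
  shows "mapx M r (emb_c0 p r f) (ZG_pm f)"
  by (simp add: mapx_def zapx_def emb_c0_def lookup_ZG_pm[OF assms] capx_const)

lemma entropy_tendsto:
  fixes f :: "nat \<Rightarrow> nat \<Rightarrow> 'g \<Rightarrow> int"
  assumes Wh: "Wh_torsion p TYPE('g)" and f: "ZG_mat r f" and GL: "emb_c0 p r f \<in> GLn CR r"
  shows "finite (FixN r f (Gs n))"
    "qp_tendsto p (\<lambda>n. qp_mul p (qp_const p (1 / of_nat (qi n))) (qp_log p (qp_const p (of_nat (card (FixN r f (Gs n)))))))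
       (logdet p r f)"
proof -
  define d where "d = (\<lambda>n. dt n r (ZG_pm f))"
  have cop: "coprime (d n) (int p)" for n
    unfolding d_def by (rule dt_coprime[OF GL mapx_emb_c0[OF f, of 1]]) simp
  have "d n \<noteq> 0" for n using cop[of n] prime_int_p by auto
  then have fin: "finite (FixN r f (Gs n))" and card: "int (card (FixN r f (Gs n))) = \<bar>d n\<bar>" for n
    using fin_quot.card_FixN[OF fin_quot f] by (simp_all add: d_def)
  show "finite (FixN r f (Gs n))" by (rule fin)
  have card': "(of_nat (card (FixN r f (Gs n))) :: rat) = of_int \<bar>d n\<bar>" for n
    unfolding card[symmetric] by simp
  have cop': "coprime \<bar>d n\<bar> (int p)" for n using cop by simp
  let ?l = "\<lambda>n. qp_log p (qp_const p (of_int \<bar>d n\<bar>))"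
  have lQ: "?l n \<in> Qp p" for n
    using capx_qp_log[OF cop', of 1 n] capx_Qp by fastforce
  have R: "Rel r (emb_c0 p r f) (logdet p r f)"
    unfolding logdet_eq_ldet[OF Wh] by (rule ldet_Rel[OF Wh GL])
  show "qp_tendsto p (\<lambda>n. qp_mul p (qp_const p (1 / of_nat (qi n))) (qp_log p (qp_const p (of_nat (card (FixN r f (Gs n)))))))
       (logdet p r f)"
    unfolding card'
  proof (rule qp_tendstoI)
    show "logdet p r f \<in> Qp p" using R by (simp add: Rel_def)
    show "qp_mul p (qp_const p (1 / of_nat (qi n))) (?l n) \<in> Qp p" for n using lQ by simp
    fix e :: real assume e: "0 < e"
    obtain n0 M0 where M0: "\<And>n M \<alpha>. n \<ge> n0 \<Longrightarrow> M \<ge> M0 n \<Longrightarrow> mapx M r (emb_c0 p r f) \<alpha> \<Longrightarrow>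
        capx (logdet p r f) (Lk M (dt n r \<alpha>) / of_nat (qi n)) e"
      using RelD[OF R e] by metis
    have "\<exists>a. capx (qp_mul p (qp_const p (1 / of_nat (qi n))) (?l n)) a e \<and> capx (logdet p r f) a e" if n: "n0 \<le> n" for n
    proof -
      define c where "c = rnorm p (of_nat (qi n))"
      have "c \<noteq> 0" unfolding c_def rnorm_eq_0_iff by (rule qi_nz)
      then have c: "0 < c" using rnorm_nonneg[of "of_nat (qi n)"] unfolding c_def by linarith
      then have ec: "0 < e * c" using e by simp
      obtain M1 where M1: "\<forall>M\<ge>M1. capx (?l n) (Lk M \<bar>d n\<bar>) (e * c)" using capx_qp_log[OF cop' ec] ..
      \<comment> \<open>The successor ensures M >= 1, as needed to drop the absolute value of the
        determinant under \<open>Lk\<close>.\<close>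
      define M where "M = max (Suc M1) (M0 n)"
      have "capx (?l n) (Lk M (d n)) (e * c)" using M1[rule_format, of M] Lk_abs[of M "d n"] by (simp add: M_def del: of_int_abs)
      then have "capx (qp_mul p (qp_const p (1 / of_nat (qi n))) (?l n)) (1 / of_nat (qi n) * Lk M (d n)) e"
        using ec e by (rule capx_cmul) (use c in \<open>simp add: rnorm_divide c_def[symmetric]\<close>)
      moreover have "capx (logdet p r f) (Lk M (d n) / of_nat (qi n)) e"
        unfolding d_def by (rule M0[OF n _ mapx_emb_c0[OF f]]) (simp add: M_def)
      ultimately show ?thesis by auto
    qed
    then show "\<forall>\<^sub>F n in sequentially. \<exists>a. capx (qp_mul p (qp_const p (1 / of_nat (qi n))) (?l n)) a e \<and> capx (logdet p r f) a e"
      by (rule eventually_sequentiallyI)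
  qed
qed

end

theorem theorem5p6:
  fixes p r :: nat
    and f :: "nat \<Rightarrow> nat \<Rightarrow> 'g::{group_add, countable} \<Rightarrow> int"
    and Gs :: "nat \<Rightarrow> 'g set"
  assumes "prime p"
    and "residually_finite TYPE('g)"
    and "Wh_torsion p TYPE('g)"
    and "ZG_mat r f"
    and "emb_c0 p r f \<in> GLn (c0_ring p) r"
    and "tends_to_e Gs"
  shows "(\<forall>n. finite (FixN r f (Gs n))) \<and>
         qp_tendsto p
           (\<lambda>n. qp_mul p (qp_const p (1 / of_nat (grp_index (Gs n))))
                  (qp_log p (qp_const p (of_nat (card (FixN r f (Gs n)))))))
           (logdet p r f)"
proof -
  have "\<forall>n. \<exists>\<kappa>. fin_quot \<kappa> (grp_index (Gs n)) (Gs n)"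
    using assms(6) by (intro allI ex_fin_quot) (simp add: tends_to_e_def)
  then obtain \<kappa> where \<kappa>: "\<And>n. fin_quot (\<kappa> n) (grp_index (Gs n)) (Gs n)" by metis
  then interpret padic_quotients p Gs \<kappa>
    unfolding padic_quotients_def padic_quotients_axioms_def padic_def using assms by blast
  show ?thesis using entropy_tendsto[OF assms(3-5)] by blast
qed

end
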